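(* Let $M$ be a smooth $n$-dimensional manifold and $S\in\mathfrak{X}(TM)$ a semispray. Let $U\subset M$ be the domain of a chart with image diffeomorphic to $\mathbb{R}^n$. Then, over $U$, the semispray $S$ is Lagrangian if and only if there exists a non-trivial, semi-basic $1$-form $\theta\in\Lambda^1(TU)$ that satisfies on $TU$ the following Helmholtz conditions: (1) $d_J\theta=0$; (2) $d_\Phi\theta=0$; (3) $\nabla d_v\theta=0$.
   Context: $TM$ is the tangent bundle with projection $\pi:TM\to M$ and induced local coordinates $(x^i,y^i)$. The Liouville vector field is $\mathbb{C}=y^i\frac{\partial}{\partial y^i}$ and the tangent structure is $J=\frac{\partial}{\partial y^i}\otimes dx^i$. A semispray is a vector field $S$ on $TM$ with $JS=\mathbb{C}$; locally $S=y^i\frac{\partial}{\partial x^i}-2G^i(x,y)\frac{\partial}{\partial y^i}$. A form on $TM$ is semi-basic if it vanishes whenever one of its arguments is vertical (tangent to the fibres of $\pi$); a semi-basic $1$-form is locally $\theta=\theta_i(x,y)dx^i$. A semi-basic $1$-form $\theta$ is non-trivial if the matrix $g_{ij}=\partial\theta_i/\partial y^j$ is not identically zero. A Lagrangian is a smooth function $L$ whose Hessian $\frac{\partial^2L}{\partial y^i\partial y^j}$ is not identically zero. For a vector-valued $1$-form $K$ (a $(1,1)$-tensor), $i_K$ is the derivation of degree $0$ on forms, $(i_K\alpha)(X_1,\dots,X_k)=\sum_a\alpha(X_1,\dots,KX_a,\dots,X_k)$ ($i_Kf=0$ on functions), and $d_K=i_K\circ d-d\circ i_K$. For a semispray $S$,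 let $[S,K]=\mathcal{L}_SK$. The horizontal and vertical projectors are $h=\frac12(\mathrm{Id}-[S,J])$, $v=\frac12(\mathrm{Id}+[S,J])$; locally $h=\frac{\delta}{\delta x^i}\otimes dx^i$, $v=\frac{\partial}{\partial y^i}\otimes\delta y^i$, with $\frac{\delta}{\delta x^i}=\frac{\partial}{\partial x^i}-N^j_i\frac{\partial}{\partial y^j}$, $\delta y^i=dy^i+N^i_jdx^j$, $N^i_j=\frac{\partial G^i}{\partial y^j}$. The almost complex structure is $\mathbb{F}=h\circ[S,h]-J$, locally $\mathbb{F}=\frac{\delta}{\delta x^i}\otimes\delta y^i-\frac{\partial}{\partial y^i}\otimes dx^i$. The Jacobi endomorphism is $\Phi=v\circ[S,h]$, locally $\Phi=R^i_j\frac{\partial}{\partial y^i}\otimes dx^j$ with $R^i_j=2\frac{\partial G^i}{\partial x^j}-S(N^i_j)-N^i_rN^r_j$. The dynamical covariant derivative is given by $\nabla f=S(f)$ on functions, $\nabla X=h[S,hX]+v[S,vX]$ on vector fields, and on forms $\nabla=\mathcal{L}_S-i_{\mathbb{F}+J-\Phi}$. The Lagrange differential of a function $L$ is $\delta_SL=\mathcal{L}_Sd_JL-dL=\left\{S\left(\frac{\partial L}{\partial y^i}\right)-\frac{\partial L}{\partial x^i}\right\}dx^i$. Definition: over $U$, $S$ is Lagrangian if there exists a Lagrangian $L\in C^\infty(TU)$ such that $\delta_SL=0$ on $TU$. *)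

theory Defs
  imports "HOL-Analysis.Analysis"
begin

section \<open>Smooth maps between open subsets of Euclidean spaces\<close>

fun Ck_on :: "nat \<Rightarrow> ('a::euclidean_space \<Rightarrow> 'b::real_normed_vector) \<Rightarrow> 'a set \<Rightarrow> bool" where
  "Ck_on 0 f S \<longleftrightarrow> continuous_on S f"
| "Ck_on (Suc k) f S \<longleftrightarrow> (\<forall>x\<in>S. f differentiable (at x)) \<and>
     (\<forall>v. Ck_on k (\<lambda>x. frechet_derivative f (at x) v) S)"

definition smooth_on :: "('a::euclidean_space \<Rightarrow> 'b::real_normed_vector) \<Rightarrow> 'a set \<Rightarrow> bool" where
  "smooth_on f S \<longleftrightarrow> (\<forall>k. Ck_on k f S)"

definition diffeomorphic_sets :: "'a::euclidean_space set \<Rightarrow> 'b::euclidean_space set \<Rightarrow> bool" where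
  "diffeomorphic_sets S T \<longleftrightarrow> (\<exists>f g. smooth_on f S \<and> smooth_on g T \<and> f ` S = T \<and> g ` T = S \<and>
     (\<forall>x\<in>S. g (f x) = x) \<and> (\<forall>y\<in>T. f (g y) = y))"


section \<open>Charts and smooth manifolds\<close>

text \<open>A chart is a domain together with a coordinate map; the values of the map outside the domain
  are irrelevant.\<close>

type_synonym ('p, 'e) chart = "'p set \<times> ('p \<Rightarrow> 'e)"

abbreviation chart_dom :: "('p, 'e) chart \<Rightarrow> 'p set" where
  "chart_dom c \<equiv> fst c"

abbreviation chart_map :: "('p, 'e) chart \<Rightarrow> 'p \<Rightarrow> 'e" where
  "chart_map c \<equiv> snd c"

definition chart_inv :: "('p, 'e) chart \<Rightarrow> 'e \<Rightarrow> 'p" where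
  "chart_inv c = inv_into (chart_dom c) (chart_map c)"

definition transition :: "('p, 'e) chart \<Rightarrow> ('p, 'e) chart \<Rightarrow> 'e \<Rightarrow> 'e" where
  "transition c d = chart_map d \<circ> chart_inv c"

definition chart_on :: "'p topology \<Rightarrow> ('p, 'e::euclidean_space) chart \<Rightarrow> bool" where
  "chart_on M c \<longleftrightarrow> openin M (chart_dom c) \<and> open (chart_map c ` chart_dom c) \<and>
     homeomorphic_map (subtopology M (chart_dom c))
       (top_of_set (chart_map c ` chart_dom c)) (chart_map c)"

definition compatible_charts ::
  "('p, 'e::euclidean_space) chart \<Rightarrow> ('p, 'e) chart \<Rightarrow> bool" where
  "compatible_charts c d \<longleftrightarrow>
     smooth_on (transition c d) (chart_map c ` (chart_dom c \<inter> chart_dom d)) \<and>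
     smooth_on (transition d c) (chart_map d ` (chart_dom c \<inter> chart_dom d))"

definition smooth_manifold :: "'p topology \<Rightarrow> ('p, 'e::euclidean_space) chart set \<Rightarrow> bool" where
  "smooth_manifold M A \<longleftrightarrow> Hausdorff_space M \<and> second_countable M \<and>
     (\<forall>c\<in>A. chart_on M c) \<and> (\<Union>c\<in>A. chart_dom c) = topspace M \<and>
     (\<forall>c\<in>A. \<forall>d\<in>A. compatible_charts c d) \<and>
     (\<forall>c. chart_on M c \<and> (\<forall>d\<in>A. compatible_charts c d) \<longrightarrow> c \<in> A)"


section \<open>Tangent vectors and vector fields\<close>

text \<open>A tangent vector at \<open>p\<close> is the family of its coordinate vectors, one for each chart of the
  atlas around \<open>p\<close>, related by the derivatives of the transition maps. The component at every other
  argument is zero, so that equal tangent vectors are equal functions.\<close>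

definition tangent_space ::
  "('p, 'e::euclidean_space) chart set \<Rightarrow> 'p \<Rightarrow> (('p, 'e) chart \<Rightarrow> 'e) set" where
  "tangent_space B p = {\<xi>.
     (\<forall>c\<in>B. \<forall>d\<in>B. p \<in> chart_dom c \<and> p \<in> chart_dom d \<longrightarrow>
        \<xi> d = frechet_derivative (transition c d) (at (chart_map c p)) (\<xi> c)) \<and>
     (\<forall>c. \<not> (c \<in> B \<and> p \<in> chart_dom c) \<longrightarrow> \<xi> c = 0)}"

definition smooth_funs :: "('p, 'e::euclidean_space) chart set \<Rightarrow> 'p set \<Rightarrow> ('p \<Rightarrow> real) set" where
  "smooth_funs B W = {f. \<forall>c\<in>B. smooth_on (f \<circ> chart_inv c) (chart_map c ` (chart_dom c \<inter> W))}"

type_synonym ('p, 'e) vfield = "'p \<Rightarrow> ('p, 'e) chart \<Rightarrow> 'e"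

text \<open>Below, \<open>B\<close> is an atlas and \<open>W\<close> an open subset of the manifold. Vector fields on \<open>W\<close> are
  extended by zero, so that they are determined by their values on \<open>W\<close>.\<close>

definition vfields :: "('p, 'e::euclidean_space) chart set \<Rightarrow> 'p set \<Rightarrow> ('p, 'e) vfield set" where
  "vfields B W = {X. (\<forall>p\<in>W. X p \<in> tangent_space B p) \<and> (\<forall>p. p \<notin> W \<longrightarrow> X p = (\<lambda>_. 0)) \<and>
     (\<forall>c\<in>B. smooth_on (\<lambda>z. X (chart_inv c z) c) (chart_map c ` (chart_dom c \<inter> W)))}"

definition restrict_vfield :: "'p set \<Rightarrow> ('p, 'e::euclidean_space) vfield \<Rightarrow> ('p, 'e) vfield" where
  "restrict_vfield W X = (\<lambda>p. if p \<in> W then X p else (\<lambda>_. 0))"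

text \<open>The function \<open>X(f)\<close>. By the chain rule its value does not depend on the chart selected.\<close>

definition vf_apply ::
  "('p, 'e::euclidean_space) chart set \<Rightarrow> ('p, 'e) vfield \<Rightarrow> ('p \<Rightarrow> real) \<Rightarrow> 'p \<Rightarrow> real" where
  "vf_apply B X f p = (let c = (SOME c. c \<in> B \<and> p \<in> chart_dom c) in
     frechet_derivative (f \<circ> chart_inv c) (at (chart_map c p)) (X p c))"

definition lie_bracket ::
  "('p, 'e::euclidean_space) chart set \<Rightarrow> 'p set \<Rightarrow> ('p, 'e) vfield \<Rightarrow> ('p, 'e) vfield \<Rightarrow> ('p, 'e) vfield"
  where
  "lie_bracket B W X Y p c = (if p \<in> W \<and> c \<in> B \<and> p \<in> chart_dom c
     then frechet_derivative (\<lambda>z. Y (chart_inv c z) c) (at (chart_map c p)) (X p c)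
        - frechet_derivative (\<lambda>z. X (chart_inv c z) c) (at (chart_map c p)) (Y p c)
     else 0)"

text \<open>The vector field on \<open>W \<subseteq> chart_dom c\<close> whose coordinate vector in the chart \<open>c\<close> is the
  constant \<open>e\<close>.\<close>

definition coord_vfield ::
  "('p, 'e::euclidean_space) chart set \<Rightarrow> 'p set \<Rightarrow> ('p, 'e) chart \<Rightarrow> 'e \<Rightarrow> ('p, 'e) vfield" where
  "coord_vfield B W c e p d = (if p \<in> W \<and> d \<in> B \<and> p \<in> chart_dom d
     then frechet_derivative (transition c d) (at (chart_map c p)) e else 0)"


section \<open>Differential forms and derivations\<close>

text \<open>A \<open>k\<close>-form on \<open>W\<close> is an alternating map, multilinear over the smooth functions, from
  \<open>k\<close>-tuples (lists of length \<open>k\<close>) of vector fields on \<open>W\<close> to smooth functions on \<open>W\<close>. A function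
  \<open>f\<close>, seen as a \<open>0\<close>-form, is \<open>\<lambda>_. f\<close>. A \<open>(1,1)\<close>-tensor is an operator on vector fields.\<close>

type_synonym ('p, 'e) form = "('p, 'e) vfield list \<Rightarrow> 'p \<Rightarrow> real"
type_synonym ('p, 'e) endo = "('p, 'e) vfield \<Rightarrow> ('p, 'e) vfield"

definition forms ::
  "('p, 'e::euclidean_space) chart set \<Rightarrow> 'p set \<Rightarrow> nat \<Rightarrow> ('p, 'e) form set" where
  "forms B W k = {\<alpha>.
     (\<forall>Xs. length Xs = k \<and> set Xs \<subseteq> vfields B W \<longrightarrow> \<alpha> Xs \<in> smooth_funs B W) \<and>
     (\<forall>Xs a X Y f g. length Xs = k \<and> set Xs \<subseteq> vfields B W \<and> a < k \<and>
        X \<in> vfields B W \<and> Y \<in> vfields B W \<and> f \<in> smooth_funs B W \<and> g \<in> smooth_funs B W \<longrightarrow>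
        (\<forall>p\<in>W. \<alpha> (Xs[a := (\<lambda>q c. f q *\<^sub>R X q c + g q *\<^sub>R Y q c)]) p =
           f p * \<alpha> (Xs[a := X]) p + g p * \<alpha> (Xs[a := Y]) p)) \<and>
     (\<forall>Xs a b. length Xs = k \<and> set Xs \<subseteq> vfields B W \<and> a < b \<and> b < k \<and> Xs ! a = Xs ! b \<longrightarrow>
        (\<forall>p\<in>W. \<alpha> Xs p = 0))}"

definition form_vanishes ::
  "('p, 'e::euclidean_space) chart set \<Rightarrow> 'p set \<Rightarrow> nat \<Rightarrow> ('p, 'e) form \<Rightarrow> bool" where
  "form_vanishes B W k \<alpha> \<longleftrightarrow>
     (\<forall>Xs. length Xs = k \<and> set Xs \<subseteq> vfields B W \<longrightarrow> (\<forall>p\<in>W. \<alpha> Xs p = 0))"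

definition form_diff :: "('p, 'e) form \<Rightarrow> ('p, 'e) form \<Rightarrow> ('p, 'e) form" where
  "form_diff \<alpha> \<beta> = (\<lambda>Xs p. \<alpha> Xs p - \<beta> Xs p)"

text \<open>The exterior derivative, by the invariant formula (without a normalising factor);
  \<open>nths Xs (- I)\<close> is the list with the entries at the positions in \<open>I\<close> omitted.\<close>

definition ext_d ::
  "('p, 'e::euclidean_space) chart set \<Rightarrow> 'p set \<Rightarrow> ('p, 'e) form \<Rightarrow> ('p, 'e) form" where
  "ext_d B W \<alpha> = (\<lambda>Xs p.
     (\<Sum>i<length Xs. (-1) ^ i * vf_apply B (Xs ! i) (\<alpha> (nths Xs (- {i}))) p) +
     (\<Sum>j<length Xs. \<Sum>i<j. (-1) ^ (i + j) *
        \<alpha> (lie_bracket B W (Xs ! i) (Xs ! j) # nths Xs (- {i, j})) p))"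

definition insert_endo :: "('p, 'e) endo \<Rightarrow> ('p, 'e) form \<Rightarrow> ('p, 'e) form" where
  "insert_endo K \<alpha> = (\<lambda>Xs p. \<Sum>a<length Xs. \<alpha> (Xs[a := K (Xs ! a)]) p)"

definition d_endo ::
  "('p, 'e::euclidean_space) chart set \<Rightarrow> 'p set \<Rightarrow> ('p, 'e) endo \<Rightarrow> ('p, 'e) form \<Rightarrow> ('p, 'e) form"
  where
  "d_endo B W K \<alpha> = form_diff (insert_endo K (ext_d B W \<alpha>)) (ext_d B W (insert_endo K \<alpha>))"

definition lie_form ::
  "('p, 'e::euclidean_space) chart set \<Rightarrow> 'p set \<Rightarrow> ('p, 'e) vfield \<Rightarrow> ('p, 'e) form \<Rightarrow> ('p, 'e) form"
  where
  "lie_form B W X \<alpha> = (\<lambda>Xs p. vf_apply B X (\<alpha> Xs) p -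
     (\<Sum>a<length Xs. \<alpha> (Xs[a := lie_bracket B W X (Xs ! a)]) p))"

definition lie_endo ::
  "('p, 'e::euclidean_space) chart set \<Rightarrow> 'p set \<Rightarrow> ('p, 'e) vfield \<Rightarrow> ('p, 'e) endo \<Rightarrow> ('p, 'e) endo"
  where
  "lie_endo B W X K = (\<lambda>Y p c. lie_bracket B W X (K Y) p c - K (lie_bracket B W X Y) p c)"


section \<open>The tangent bundle\<close>

type_synonym ('a, 'e) tangent = "'a \<times> (('a, 'e) chart \<Rightarrow> 'e)"

definition tangent_over ::
  "('a, 'e::euclidean_space) chart set \<Rightarrow> 'a set \<Rightarrow> ('a, 'e) tangent set" where
  "tangent_over A U = {(p, v). p \<in> U \<and> v \<in> tangent_space A p}"

definition tangent_bundle :: "('a, 'e::euclidean_space) chart set \<Rightarrow> ('a, 'e) tangent set" where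
  "tangent_bundle A = tangent_over A (\<Union>c\<in>A. chart_dom c)"

text \<open>The induced coordinates \<open>(x, y)\<close>; the first factor of the model space \<open>'e \<times> 'e\<close> carries the
  coordinates of the base point, the second those of the vector.\<close>

definition induced_chart ::
  "('a, 'e::euclidean_space) chart set \<Rightarrow> ('a, 'e) chart \<Rightarrow> (('a, 'e) tangent, 'e \<times> 'e) chart" where
  "induced_chart A c = (tangent_over A (chart_dom c), \<lambda>(p, v). (chart_map c p, v c))"

definition induced_atlas ::
  "('a, 'e::euclidean_space) chart set \<Rightarrow> (('a, 'e) tangent, 'e \<times> 'e) chart set" where
  "induced_atlas A = induced_chart A ` A"

definition liouville ::
  "('a, 'e::euclidean_space) chart set \<Rightarrow> (('a, 'e) tangent, 'e \<times> 'e) vfield" where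
  "liouville A u d =
     (if d \<in> induced_atlas A \<and> u \<in> chart_dom d then (0, snd (chart_map d u)) else (0, 0))"

definition tangent_structure :: "('p, 'e::euclidean_space \<times> 'e) endo" where
  "tangent_structure X = (\<lambda>u d. (0, fst (X u d)))"

definition semispray ::
  "('a, 'e::euclidean_space) chart set \<Rightarrow> (('a, 'e) tangent, 'e \<times> 'e) vfield \<Rightarrow> bool" where
  "semispray A S \<longleftrightarrow> S \<in> vfields (induced_atlas A) (tangent_bundle A) \<and>
     (\<forall>u\<in>tangent_bundle A. tangent_structure S u = liouville A u)"

text \<open>The differential of the bundle projection \<open>fst\<close>: in induced coordinates, the first component.
  Vertical vectors form its kernel.\<close>

definition d_proj ::
  "('a, 'e::euclidean_space) chart set \<Rightarrow> ((('a, 'e) tangent, 'e \<times> 'e) chart \<Rightarrow> 'e \<times> 'e) \<Rightarrow>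
     ('a, 'e) chart \<Rightarrow> 'e" where
  "d_proj A \<xi> = (\<lambda>c. if c \<in> A then fst (\<xi> (induced_chart A c)) else 0)"

definition vertical ::
  "('a, 'e::euclidean_space) chart set \<Rightarrow> ('a, 'e) tangent set \<Rightarrow>
     (('a, 'e) tangent, 'e \<times> 'e) vfield \<Rightarrow> bool" where
  "vertical A W X \<longleftrightarrow> (\<forall>u\<in>W. d_proj A (X u) = (\<lambda>_. 0))"

definition semi_basic ::
  "('a, 'e::euclidean_space) chart set \<Rightarrow> ('a, 'e) tangent set \<Rightarrow> nat \<Rightarrow>
     (('a, 'e) tangent, 'e \<times> 'e) form \<Rightarrow> bool" where
  "semi_basic A W k \<alpha> \<longleftrightarrow>
     (\<forall>Xs. length Xs = k \<and> set Xs \<subseteq> vfields (induced_atlas A) W \<and> (\<exists>X\<in>set Xs. vertical A W X) \<longrightarrow>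
        (\<forall>u\<in>W. \<alpha> Xs u = 0))"


section \<open>The geometry of a semispray\<close>

text \<open>Here \<open>B\<close> is the induced atlas of a tangent bundle, \<open>W\<close> an open subset of the tangent bundle
  and \<open>S\<close> a vector field on \<open>W\<close>.\<close>

definition h_proj :: "('p, 'e::euclidean_space \<times> 'e) chart set \<Rightarrow> 'p set \<Rightarrow> ('p, 'e \<times> 'e) vfield \<Rightarrow>
    ('p, 'e \<times> 'e) endo" where
  "h_proj B W S = (\<lambda>X u d. (1/2) *\<^sub>R (X u d - lie_endo B W S tangent_structure X u d))"

definition v_proj :: "('p, 'e::euclidean_space \<times> 'e) chart set \<Rightarrow> 'p set \<Rightarrow> ('p, 'e \<times> 'e) vfield \<Rightarrow>
    ('p, 'e \<times> 'e) endo" where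
  "v_proj B W S = (\<lambda>X u d. (1/2) *\<^sub>R (X u d + lie_endo B W S tangent_structure X u d))"

definition almost_complex ::
  "('p, 'e::euclidean_space \<times> 'e) chart set \<Rightarrow> 'p set \<Rightarrow> ('p, 'e \<times> 'e) vfield \<Rightarrow> ('p, 'e \<times> 'e) endo"
  where
  "almost_complex B W S = (\<lambda>X u d.
     h_proj B W S (lie_endo B W S (h_proj B W S) X) u d - tangent_structure X u d)"

definition jacobi_endo ::
  "('p, 'e::euclidean_space \<times> 'e) chart set \<Rightarrow> 'p set \<Rightarrow> ('p, 'e \<times> 'e) vfield \<Rightarrow> ('p, 'e \<times> 'e) endo"
  where
  "jacobi_endo B W S = (\<lambda>X. v_proj B W S (lie_endo B W S (h_proj B W S) X))"

definition dyn_cov ::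
  "('p, 'e::euclidean_space \<times> 'e) chart set \<Rightarrow> 'p set \<Rightarrow> ('p, 'e \<times> 'e) vfield \<Rightarrow>
     ('p, 'e \<times> 'e) form \<Rightarrow> ('p, 'e \<times> 'e) form" where
  "dyn_cov B W S \<alpha> = form_diff (lie_form B W S \<alpha>)
     (insert_endo (\<lambda>X u d. almost_complex B W S X u d + tangent_structure X u d
        - jacobi_endo B W S X u d) \<alpha>)"

definition lagrange_diff ::
  "('p, 'e::euclidean_space \<times> 'e) chart set \<Rightarrow> 'p set \<Rightarrow> ('p, 'e \<times> 'e) vfield \<Rightarrow>
     ('p \<Rightarrow> real) \<Rightarrow> ('p, 'e \<times> 'e) form" where
  "lagrange_diff B W S L =
     form_diff (lie_form B W S (d_endo B W tangent_structure (\<lambda>_. L))) (ext_d B W (\<lambda>_. L))"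


section \<open>Lagrangians and non-trivial semi-basic forms over a chart domain\<close>

text \<open>The coordinate vector fields on \<open>TU\<close>, where \<open>U\<close> is the domain of the chart \<open>c\<close>.\<close>

definition ddx :: "('a, real ^ 'n) chart set \<Rightarrow> ('a, real ^ 'n) chart \<Rightarrow> 'n \<Rightarrow>
    (('a, real ^ 'n) tangent, (real ^ 'n) \<times> (real ^ 'n)) vfield" where
  "ddx A c i = coord_vfield (induced_atlas A) (tangent_over A (chart_dom c)) (induced_chart A c)
     (axis i 1, 0)"

definition ddy :: "('a, real ^ 'n) chart set \<Rightarrow> ('a, real ^ 'n) chart \<Rightarrow> 'n \<Rightarrow>
    (('a, real ^ 'n) tangent, (real ^ 'n) \<times> (real ^ 'n)) vfield" where
  "ddy A c i = coord_vfield (induced_atlas A) (tangent_over A (chart_dom c)) (induced_chart A c)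
     (0, axis i 1)"

definition nontrivial_form :: "('a, real ^ 'n) chart set \<Rightarrow> ('a, real ^ 'n) chart \<Rightarrow>
    (('a, real ^ 'n) tangent, (real ^ 'n) \<times> (real ^ 'n)) form \<Rightarrow> bool" where
  "nontrivial_form A c \<theta> \<longleftrightarrow> (\<exists>u\<in>tangent_over A (chart_dom c). \<exists>i j.
     vf_apply (induced_atlas A) (ddy A c j) (\<theta> [ddx A c i]) u \<noteq> 0)"

definition lagrangian_function :: "('a, real ^ 'n) chart set \<Rightarrow> ('a, real ^ 'n) chart \<Rightarrow>
    (('a, real ^ 'n) tangent \<Rightarrow> real) \<Rightarrow> bool" where
  "lagrangian_function A c L \<longleftrightarrow>
     L \<in> smooth_funs (induced_atlas A) (tangent_over A (chart_dom c)) \<and>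
     (\<exists>u\<in>tangent_over A (chart_dom c). \<exists>i j.
        vf_apply (induced_atlas A) (ddy A c i) (vf_apply (induced_atlas A) (ddy A c j) L) u \<noteq> 0)"

definition lagrangian_semispray_over :: "('a, real ^ 'n) chart set \<Rightarrow> ('a, real ^ 'n) chart \<Rightarrow>
    (('a, real ^ 'n) tangent, (real ^ 'n) \<times> (real ^ 'n)) vfield \<Rightarrow> bool" where
  "lagrangian_semispray_over A c S \<longleftrightarrow> (\<exists>L. lagrangian_function A c L \<and>
     form_vanishes (induced_atlas A) (tangent_over A (chart_dom c)) 1
       (lagrange_diff (induced_atlas A) (tangent_over A (chart_dom c))
          (restrict_vfield (tangent_over A (chart_dom c)) S) L))"

end

theory Submission
  imports Defs
begin

text \<open>In the induced coordinates of \<open>TU = V \<times> \<real>\<^sup>n\<close> everything becomes a statement about a smooth covector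
  \<open>p\<close>, where \<open>\<theta> = p\<^sub>i dx\<^sup>i\<close>. The conditions say that \<open>g\<^sub>i\<^sub>j = \<partial>p\<^sub>i/\<partial>y\<^sup>j\<close> is symmetric, that \<open>g R\<close> is symmetric, and that
  \<open>\<nabla>g = 0\<close>.

  If \<open>L\<close> satisfies the Euler-Lagrange equations \<open>S(\<partial>L/\<partial>y\<^sup>i) = \<partial>L/\<partial>x\<^sup>i\<close>, put \<open>p = \<partial>L/\<partial>y\<close>. The vertical derivative of
  the equations has symmetric part \<open>\<nabla>g = 0\<close> and antisymmetric part \<open>\<omega> = 0\<close>, where
  \<open>\<omega>\<^sub>i\<^sub>j = \<delta>p\<^sub>j/\<delta>x\<^sup>i - \<delta>p\<^sub>i/\<delta>x\<^sup>j\<close> is the horizontal part of \<open>d\<theta>\<close>; comparing the horizontal derivative with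
  \<open>S(\<omega>) = 0\<close> gives the symmetry of \<open>g R\<close>.

  Conversely, the conditions no longer force \<open>\<omega> = 0\<close>, but they force \<open>\<omega>\<close> to be the pullback of a closed \<open>2\<close>-form
  on \<open>V\<close>, whence \<open>\<omega> = -d\<beta>\<close> by the Poincare lemma. Adding \<open>\<beta>\<close> to \<open>\<theta>\<close> does not change \<open>g\<close> and makes the
  Lie derivative of \<open>\<theta>\<close> along \<open>S\<close> closed; a second application of the Poincare lemma, on \<open>TU\<close>, writes it as
  \<open>dL\<close>, and this \<open>L\<close> is the Lagrangian.\<close>

section \<open>Calculus of smooth maps\<close>

text \<open>What makes the converse work is the form \<open>EL\<close> dx + \<open>p\<close> dy, the
  Lie derivative of \<theta> along the spray. Its exterior derivative has dx-dx part S(\<omega>),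
  dx-dy part \<omega>, and dy-dy part the antisymmetric part of g, which is zero. So \<omega> is the
  only obstruction to writing this form as dL. It cannot be expected to vanish: adding to \<theta>
  the pullback of any 1-form on V leaves all three conditions unchanged, since they involve
  \<open>p\<close> only through its vertical derivatives, but alters \<omega>. This same freedom is
  used to remove \<omega>.

  The chart image being diffeomorphic to Euclidean space enters only through a smooth contraction,
  which serves both uses of the Poincare lemma.

  The other obstacle is the encoding: forms and (1,1)-tensors are operators on vector fields, not
  fields of matrices. A 1-form yields a covector only after fields are expanded in coordinate
  fields; over one chart domain these are globally defined, so no cut-off functions are
  required.\<close>

abbreviation dd :: "('a::real_normed_vector \<Rightarrow> 'b::real_normed_vector) \<Rightarrow> 'a \<Rightarrow> 'a \<Rightarrow> 'b"  ("\<DD>") where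
  "\<DD> f x \<equiv> frechet_derivative f (at x)"

lemmas dd_eqI = frechet_derivative_at[symmetric]

text \<open>\<open>frechet_derivative\<close> is a choice among candidate derivatives. Functions
  that agree near \<open>x\<close> have the same candidates there, so the choices coincide even
  where no derivative exists.\<close>

lemma dd_cong_open:
  assumes "open S" "x \<in> S" "\<And>y. y \<in> S \<Longrightarrow> f y = g y"
  shows "\<DD> f x = \<DD> g x" "f differentiable (at x) \<longleftrightarrow> g differentiable (at x)"
proof -
  have *: "(f has_derivative f') (at x) \<longleftrightarrow> (g has_derivative f') (at x)" for f'
    using assms has_derivative_transform_within_open[of f f' x UNIV S g]
      has_derivative_transform_within_open[of g f' x UNIV S f] by auto
  show "\<DD> f x = \<DD> g x" by (simp add: frechet_derivative_def *)
  show "f differentiable (at x) \<longleftrightarrow> g differentiable (at x)" by (simp add: differentiable_def *)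
qed

text \<open>A differentiation rule gives the derivative only at points of \<open>S\<close>, whereas
  \<open>Ck_on\<close> speaks of the total function \<open>\<DD> f\<close>. Every closure property
  below passes from one to the other by this lemma.\<close>

lemma Ck_on_cong:
  assumes "open S" "\<And>x. x \<in> S \<Longrightarrow> f x = g x" "Ck_on k f S"
  shows "Ck_on k g S"
  using assms(2,3)
proof (induction k arbitrary: f g)
  case 0
  then show ?case by (metis Ck_on.simps(1) continuous_on_cong)
next
  case (Suc k)
  have "Ck_on k (\<lambda>x. \<DD> g x v) S" for v
    using Suc.IH[of "\<lambda>x. \<DD> f x v" "\<lambda>x. \<DD> g x v"] Suc.prems dd_cong_open(1)[OF assms(1), of _ f g]
    by auto
  then show ?case
    using Suc.prems dd_cong_open(2)[OF assms(1) _ Suc.prems(1)] by simp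
qed

lemma Ck_on_SucD: "Ck_on (Suc k) f S \<Longrightarrow> Ck_on k f S"
proof (induction k arbitrary: f)
  case 0
  then show ?case
    by (simp add: continuous_at_imp_continuous_on differentiable_imp_continuous_within)
next
  case (Suc k)
  then show ?case by (metis Ck_on.simps(2))
qed

lemma Ck_on_subset: "Ck_on k f S \<Longrightarrow> T \<subseteq> S \<Longrightarrow> Ck_on k f T"
  by (induction k arbitrary: f) (auto intro: continuous_on_subset)

lemma Ck_on_has_derivative:
  "Ck_on (Suc k) f S \<Longrightarrow> x \<in> S \<Longrightarrow> (f has_derivative \<DD> f x) (at x)"
  by (simp add: frechet_derivative_works)

lemma Ck_on_const: "Ck_on k (\<lambda>x. a) S"
  by (induction k arbitrary: a) auto

lemma Ck_on_bounded_linear: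
  assumes "open S" "bounded_linear L" "Ck_on k f S"
  shows "Ck_on k (\<lambda>x. L (f x)) S"
  using assms(3)
proof (induction k arbitrary: f)
  case 0
  then show ?case using assms(2) by (simp add: bounded_linear.continuous_on)
next
  case (Suc k)
  have hd: "((\<lambda>x. L (f x)) has_derivative (\<lambda>v. L (\<DD> f x v))) (at x)" if "x \<in> S" for x
    using bounded_linear.has_derivative[OF assms(2)] Ck_on_has_derivative[OF Suc.prems that] by blast
  have "Ck_on k (\<lambda>x. \<DD> (\<lambda>x. L (f x)) x v) S" for v
    by (rule Ck_on_cong[OF assms(1), where f="\<lambda>x. L (\<DD> f x v)"])
      (use Suc dd_eqI[OF hd] in auto)
  then show ?case using hd by (auto simp: differentiable_def)
qed

lemma Ck_on_add:
  assumes "open S" "Ck_on k f S" "Ck_on k g S"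
  shows "Ck_on k (\<lambda>x. f x + g x) S"
  using assms(2,3)
proof (induction k arbitrary: f g)
  case 0
  then show ?case by (simp add: continuous_on_add)
next
  case (Suc k)
  have hd: "((\<lambda>x. f x + g x) has_derivative (\<lambda>v. \<DD> f x v + \<DD> g x v)) (at x)" if "x \<in> S" for x
    using Ck_on_has_derivative[OF Suc.prems(1) that] Ck_on_has_derivative[OF Suc.prems(2) that]
    by (rule has_derivative_add)
  have "Ck_on k (\<lambda>x. \<DD> (\<lambda>x. f x + g x) x v) S" for v
    by (rule Ck_on_cong[OF assms(1), where f="\<lambda>x. \<DD> f x v + \<DD> g x v"])
      (use Suc dd_eqI[OF hd] in auto)
  then show ?case using hd by (auto simp: differentiable_def)
qed

lemma Ck_on_sum:
  assumes "open S" "\<And>i. i \<in> I \<Longrightarrow> Ck_on k (f i) S"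
  shows "Ck_on k (\<lambda>x. \<Sum>i\<in>I. f i x) S"
  using assms(2) by (induction I rule: infinite_finite_induct)
    (auto intro: Ck_on_const Ck_on_add[OF assms(1)])

lemma Ck_on_bilinear:
  assumes "open S" "bounded_bilinear p" "Ck_on k f S" "Ck_on k g S"
  shows "Ck_on k (\<lambda>x. p (f x) (g x)) S"
  using assms(3,4)
proof (induction k arbitrary: f g)
  case 0
  then show ?case using assms(2) by (simp add: bounded_bilinear.continuous_on)
next
  case (Suc k)
  have hd: "((\<lambda>x. p (f x) (g x)) has_derivative (\<lambda>v. p (f x) (\<DD> g x v) + p (\<DD> f x v) (g x))) (at x)"
    if "x \<in> S" for x
    using bounded_bilinear.FDERIV[OF assms(2)] Ck_on_has_derivative[OF Suc.prems(1) that]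
      Ck_on_has_derivative[OF Suc.prems(2) that] by blast
  have "Ck_on k (\<lambda>x. \<DD> (\<lambda>x. p (f x) (g x)) x v) S" for v
    by (rule Ck_on_cong[OF assms(1), where f="\<lambda>x. p (f x) (\<DD> g x v) + p (\<DD> f x v) (g x)"])
      (use Suc.prems dd_eqI[OF hd] Ck_on_SucD[OF Suc.prems(1)] Ck_on_SucD[OF Suc.prems(2)]
        in \<open>auto intro!: Ck_on_add[OF assms(1)] Suc.IH\<close>)
  then show ?case using hd by (auto simp: differentiable_def)
qed

lemma linear_sum_Basis:
  assumes "linear L"
  shows "L (v::'a::euclidean_space) = (\<Sum>b\<in>Basis. (v \<bullet> b) *\<^sub>R L b)"
proof -
  have "L v = L (\<Sum>b\<in>Basis. (v \<bullet> b) *\<^sub>R b)" by (simp add: euclidean_representation)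
  also have "\<dots> = (\<Sum>b\<in>Basis. (v \<bullet> b) *\<^sub>R L b)" using assms by (simp add: linear_sum linear_scale)
  finally show ?thesis .
qed

text \<open>By the chain rule \<open>f\<close> is differentiated in the direction
  \<open>\<DD> g x v\<close>, which moves with \<open>x\<close>, but \<open>Ck_on\<close> controls
  fixed directions only. Expanding the direction in the basis leaves derivatives of \<open>f\<close>
  along basis vectors, composed with \<open>g\<close>, to which the induction hypothesis
  applies.\<close>

lemma Ck_on_compose:
  fixes g :: "'a::euclidean_space \<Rightarrow> 'b::euclidean_space" and f :: "'b \<Rightarrow> 'c::real_normed_vector"
  assumes "open S" "Ck_on k g S" "Ck_on k f T" "g ` S \<subseteq> T"
  shows "Ck_on k (\<lambda>x. f (g x)) S"
  using assms(2,3)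
proof (induction k arbitrary: f)
  case 0
  then show ?case using assms(4) by (auto intro: continuous_on_compose2)
next
  case (Suc k)
  have hd: "((\<lambda>x. f (g x)) has_derivative (\<lambda>v. \<DD> f (g x) (\<DD> g x v))) (at x)"
    if "x \<in> S" for x
    using has_derivative_compose[OF Ck_on_has_derivative[OF Suc.prems(1) that]
        Ck_on_has_derivative[OF Suc.prems(2)]] that assms(4) by auto
  have lin: "linear (\<DD> f (g x))" if "x \<in> S" for x
    using Suc.prems(2) assms(4) that by (auto intro: linear_frechet_derivative)
  have "Ck_on k (\<lambda>x. \<DD> (\<lambda>x. f (g x)) x v) S" for v
  proof (rule Ck_on_cong[OF assms(1)])
    show "(\<Sum>b\<in>Basis. (\<DD> g x v \<bullet> b) *\<^sub>R \<DD> f (g x) b) = \<DD> (\<lambda>x. f (g x)) x v" if "x \<in> S" for x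
      using dd_eqI[OF hd[OF that]] linear_sum_Basis[OF lin[OF that]] by metis
    show "Ck_on k (\<lambda>x. \<Sum>b\<in>Basis. (\<DD> g x v \<bullet> b) *\<^sub>R \<DD> f (g x) b) S"
    proof (intro Ck_on_sum Ck_on_bilinear[OF _ bounded_bilinear_scaleR] assms(1))
      fix b :: 'b
      show "Ck_on k (\<lambda>x. \<DD> g x v \<bullet> b) S"
        by (rule Ck_on_bounded_linear[OF assms(1) bounded_linear_inner_left]) (use Suc.prems in simp)
      show "Ck_on k (\<lambda>x. \<DD> f (g x) b) S"
        using Suc.IH[of "\<lambda>y. \<DD> f y b"] Suc.prems Ck_on_SucD by auto
    qed
  qed
  then show ?case using hd by (auto simp: differentiable_def)
qed

lemma smooth_on_has_derivative:
  "smooth_on f S \<Longrightarrow> x \<in> S \<Longrightarrow> (f has_derivative \<DD> f x) (at x)"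
  unfolding smooth_on_def using Ck_on_has_derivative by blast

lemma smooth_on_differentiable: "smooth_on f S \<Longrightarrow> x \<in> S \<Longrightarrow> f differentiable (at x)"
  using smooth_on_has_derivative differentiable_def by blast

lemma smooth_on_linear_dd: "smooth_on f S \<Longrightarrow> x \<in> S \<Longrightarrow> linear (\<DD> f x)"
  by (simp add: linear_frechet_derivative smooth_on_differentiable)

lemma smooth_on_dd: "smooth_on f S \<Longrightarrow> smooth_on (\<lambda>x. \<DD> f x v) S"
  unfolding smooth_on_def by (metis Ck_on.simps(2))

lemma smooth_on_continuous_on: "smooth_on f S \<Longrightarrow> continuous_on S f"
  unfolding smooth_on_def using Ck_on.simps(1) by blast

lemma smooth_onI:
  assumes "\<And>x. x \<in> S \<Longrightarrow> f differentiable (at x)" "\<And>v. smooth_on (\<lambda>x. \<DD> f x v) S"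
  shows "smooth_on f S"
proof -
  have "Ck_on (Suc k) f S" for k using assms unfolding smooth_on_def by auto
  then show ?thesis unfolding smooth_on_def using Ck_on_SucD by blast
qed

lemma smooth_on_cong:
  assumes "open S" "smooth_on f S" "\<And>x. x \<in> S \<Longrightarrow> f x = g x"
  shows "smooth_on g S"
  using assms Ck_on_cong unfolding smooth_on_def by blast

lemma smooth_on_subset: "smooth_on f S \<Longrightarrow> T \<subseteq> S \<Longrightarrow> smooth_on f T"
  unfolding smooth_on_def using Ck_on_subset by blast

lemma smooth_on_const [simp]: "smooth_on (\<lambda>x. a) S"
  unfolding smooth_on_def using Ck_on_const by blast

lemma smooth_on_bounded_linear:
  "open S \<Longrightarrow> bounded_linear L \<Longrightarrow> smooth_on f S \<Longrightarrow> smooth_on (\<lambda>x. L (f x)) S"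
  unfolding smooth_on_def using Ck_on_bounded_linear by blast

lemma smooth_on_ident [simp]: "smooth_on (\<lambda>x. x) S"
  by (rule smooth_onI) auto

lemma smooth_on_add:
  "open S \<Longrightarrow> smooth_on f S \<Longrightarrow> smooth_on g S \<Longrightarrow> smooth_on (\<lambda>x. f x + g x) S"
  unfolding smooth_on_def using Ck_on_add by blast

lemma smooth_on_uminus: "open S \<Longrightarrow> smooth_on f S \<Longrightarrow> smooth_on (\<lambda>x. - f x) S"
  by (rule smooth_on_bounded_linear[OF _ bounded_linear_minus[OF bounded_linear_ident]])

lemma smooth_on_diff:
  "open S \<Longrightarrow> smooth_on f S \<Longrightarrow> smooth_on g S \<Longrightarrow> smooth_on (\<lambda>x. f x - g x) S"
  using smooth_on_add[of S f "\<lambda>x. - g x"] smooth_on_uminus by auto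

lemma smooth_on_sum:
  "open S \<Longrightarrow> (\<And>i. i \<in> I \<Longrightarrow> smooth_on (f i) S) \<Longrightarrow> smooth_on (\<lambda>x. \<Sum>i\<in>I. f i x) S"
  unfolding smooth_on_def using Ck_on_sum[of S I _ f] by blast

lemma smooth_on_scaleR:
  "open S \<Longrightarrow> smooth_on f S \<Longrightarrow> smooth_on g S \<Longrightarrow> smooth_on (\<lambda>x. f x *\<^sub>R g x) S"
  unfolding smooth_on_def using Ck_on_bilinear[OF _ bounded_bilinear_scaleR] by blast

lemma smooth_on_mult:
  fixes f g :: "_ \<Rightarrow> real"
  shows "open S \<Longrightarrow> smooth_on f S \<Longrightarrow> smooth_on g S \<Longrightarrow> smooth_on (\<lambda>x. f x * g x) S"
  unfolding smooth_on_def using Ck_on_bilinear[OF _ bounded_bilinear_mult] by blast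

lemma smooth_on_inner:
  "open S \<Longrightarrow> smooth_on f S \<Longrightarrow> smooth_on g S \<Longrightarrow> smooth_on (\<lambda>x. f x \<bullet> g x) S"
  unfolding smooth_on_def using Ck_on_bilinear[OF _ bounded_bilinear_inner] by blast

lemma smooth_on_compose:
  fixes g :: "'a::euclidean_space \<Rightarrow> 'b::euclidean_space"
  shows "open S \<Longrightarrow> smooth_on g S \<Longrightarrow> smooth_on f T \<Longrightarrow> g ` S \<subseteq> T \<Longrightarrow> smooth_on (\<lambda>x. f (g x)) S"
  unfolding smooth_on_def using Ck_on_compose by blast

lemma smooth_on_fst: "open S \<Longrightarrow> smooth_on f S \<Longrightarrow> smooth_on (\<lambda>x. fst (f x)) S"
  by (rule smooth_on_bounded_linear[OF _ bounded_linear_fst])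

lemma smooth_on_snd: "open S \<Longrightarrow> smooth_on f S \<Longrightarrow> smooth_on (\<lambda>x. snd (f x)) S"
  by (rule smooth_on_bounded_linear[OF _ bounded_linear_snd])

lemma smooth_on_Pair:
  assumes "open S" "smooth_on f S" "smooth_on g S"
  shows "smooth_on (\<lambda>x. (f x, g x)) S"
proof -
  have "smooth_on (\<lambda>x. (f x, 0) + (0, g x)) S"
    by (intro smooth_on_add assms smooth_on_bounded_linear[OF _ _ assms(2), where L="\<lambda>a. (a, 0)"]
        smooth_on_bounded_linear[OF _ _ assms(3), where L="\<lambda>a. (0, a)"]
        bounded_linear_Pair bounded_linear_ident bounded_linear_zero)
  then show ?thesis by simp
qed

text \<open>The basis expansion once more: it turns the moving direction into smooth coefficients of
  derivatives in fixed directions.\<close>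

lemma smooth_on_dd_field:
  fixes f :: "'a::euclidean_space \<Rightarrow> 'b::real_normed_vector"
  assumes "open S" "smooth_on f S" "smooth_on X S"
  shows "smooth_on (\<lambda>x. \<DD> f x (X x)) S"
proof (rule smooth_on_cong[OF assms(1)])
  show "smooth_on (\<lambda>x. \<Sum>b\<in>Basis. (X x \<bullet> b) *\<^sub>R \<DD> f x b) S"
    by (intro smooth_on_sum smooth_on_scaleR smooth_on_inner smooth_on_dd assms smooth_on_const)
  show "(\<Sum>b\<in>Basis. (X x \<bullet> b) *\<^sub>R \<DD> f x b) = \<DD> f x (X x)" if "x \<in> S" for x
    using linear_sum_Basis[OF smooth_on_linear_dd[OF assms(2) that]] by metis
qed

lemmas smooth_intros = smooth_on_const smooth_on_ident smooth_on_add smooth_on_uminus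
  smooth_on_diff smooth_on_sum smooth_on_scaleR smooth_on_mult smooth_on_inner
  smooth_on_fst smooth_on_snd smooth_on_Pair smooth_on_dd_field

section \<open>Symmetry of second derivatives\<close>

lemma second_difference:
  fixes f :: "'a::euclidean_space \<Rightarrow> real"
  assumes f: "smooth_on f S" and h: "0 < h"
    and S: "\<And>s t. 0 \<le> s \<Longrightarrow> s \<le> h \<Longrightarrow> 0 \<le> t \<Longrightarrow> t \<le> h \<Longrightarrow> x + s *\<^sub>R v + t *\<^sub>R w \<in> S"
  obtains s t where "0 < s" "s < h" "0 < t" "t < h"
    "f (x + h *\<^sub>R v + h *\<^sub>R w) - f (x + h *\<^sub>R v) - f (x + h *\<^sub>R w) + f x
      = h\<^sup>2 * \<DD> (\<lambda>y. \<DD> f y v) (x + s *\<^sub>R v + t *\<^sub>R w) w"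
proof -
  have line: "((\<lambda>s. g (y + s *\<^sub>R u)) has_derivative (\<lambda>r. r * \<DD> g (y + s *\<^sub>R u) u)) (at s)"
    if g: "smooth_on g S" and y: "y + s *\<^sub>R u \<in> S" for g :: "'a \<Rightarrow> real" and y u s
  proof -
    have "((\<lambda>s. g (y + s *\<^sub>R u)) has_derivative (\<lambda>r. \<DD> g (y + s *\<^sub>R u) (r *\<^sub>R u))) (at s)"
      by (rule has_derivative_compose[where f="\<lambda>s. y + s *\<^sub>R u", OF _ smooth_on_has_derivative[OF g y]])
        (auto intro!: derivative_eq_intros)
    then show ?thesis using linear_scale[OF smooth_on_linear_dd[OF g y]] by simp
  qed
  \<comment> \<open>The second difference is the increment of \<open>G\<close> over an interval of
    length \<open>h\<close>; the mean value theorem gives a difference of first derivatives along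
    \<open>v\<close>, which is \<open>h\<close> times an increment of \<open>K\<close> below, and a
    second mean value theorem along \<open>w\<close> finishes.\<close>
  define G where "G = (\<lambda>s. f (x + h *\<^sub>R w + s *\<^sub>R v) - f (x + s *\<^sub>R v))"
  have G: "(G has_derivative (\<lambda>r. r * (\<DD> f (x + h *\<^sub>R w + s *\<^sub>R v) v - \<DD> f (x + s *\<^sub>R v) v))) (at s)"
    if "0 \<le> s" "s \<le> h" for s
  proof -
    have swap: "x + h *\<^sub>R w + s *\<^sub>R v = x + s *\<^sub>R v + h *\<^sub>R w" by simp
    have "x + h *\<^sub>R w + s *\<^sub>R v \<in> S" "x + s *\<^sub>R v \<in> S"
      unfolding swap using S[of s h] S[of s 0] that h by simp_all
    from has_derivative_diff[OF line[OF f this(1)] line[OF f this(2)]]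
    show ?thesis unfolding G_def right_diff_distrib .
  qed
  have Gc: "continuous_on {0..h} G"
    by (rule has_derivative_continuous_on, rule has_derivative_at_withinI, rule G) auto
  obtain s where s: "0 < s" "s < h" and
    1: "G h - G 0 = h * (\<DD> f (x + h *\<^sub>R w + s *\<^sub>R v) v - \<DD> f (x + s *\<^sub>R v) v)"
    using mvt[OF h Gc G] by auto
  define K where "K = (\<lambda>t. \<DD> f (x + s *\<^sub>R v + t *\<^sub>R w) v)"
  have K: "(K has_derivative (\<lambda>r. r * \<DD> (\<lambda>y. \<DD> f y v) (x + s *\<^sub>R v + t *\<^sub>R w) w)) (at t)"
    if "0 \<le> t" "t \<le> h" for t
    unfolding K_def by (rule line[OF smooth_on_dd[OF f]]) (use S s that in auto)
  have Kc: "continuous_on {0..h} K"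
    by (rule has_derivative_continuous_on, rule has_derivative_at_withinI, rule K) auto
  obtain t where t: "0 < t" "t < h" and
    2: "K h - K 0 = h * \<DD> (\<lambda>y. \<DD> f y v) (x + s *\<^sub>R v + t *\<^sub>R w) w"
    using mvt[OF h Kc K] by auto
  show thesis
  proof (rule that[OF s t])
    show "f (x + h *\<^sub>R v + h *\<^sub>R w) - f (x + h *\<^sub>R v) - f (x + h *\<^sub>R w) + f x
      = h\<^sup>2 * \<DD> (\<lambda>y. \<DD> f y v) (x + s *\<^sub>R v + t *\<^sub>R w) w"
      using 1 2 by (simp add: G_def K_def power2_eq_square algebra_simps)
  qed
qed

text \<open>The second difference over the parallelogram on \<open>v\<close> and \<open>w\<close>
  does not depend on their order, so both iterated derivatives take a common value at points
  arbitrarily close to \<open>x\<close>; continuity of both forces equality at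
  \<open>x\<close>.\<close>

lemma dd_commute_real:
  fixes f :: "'a::euclidean_space \<Rightarrow> real"
  assumes S: "open S" and f: "smooth_on f S" and x: "x \<in> S"
  shows "\<DD> (\<lambda>y. \<DD> f y v) x w = \<DD> (\<lambda>y. \<DD> f y w) x v"
proof (rule ccontr)
  define A where "A = (\<lambda>y. \<DD> (\<lambda>y. \<DD> f y v) y w)"
  define B where "B = (\<lambda>y. \<DD> (\<lambda>y. \<DD> f y w) y v)"
  assume "\<not> ?thesis"
  then have e: "0 < \<bar>A x - B x\<bar> / 2" (is "0 < ?e") by (simp add: A_def B_def)
  have "isCont A x" "isCont B x"
    using S x smooth_on_continuous_on[OF smooth_on_dd[OF smooth_on_dd[OF f]]]
    by (auto simp: A_def B_def continuous_on_eq_continuous_at)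
  then obtain d1 d2 where d: "d1 > 0" "\<And>y. dist y x < d1 \<Longrightarrow> dist (A y) (A x) < ?e"
    "d2 > 0" "\<And>y. dist y x < d2 \<Longrightarrow> dist (B y) (B x) < ?e"
    using e unfolding continuous_at_eps_delta by metis
  obtain d3 where d3: "d3 > 0" "ball x d3 \<subseteq> S" using S x openE by blast
  define d where "d = min d1 (min d2 d3)"
  \<comment> \<open>Small enough that the whole parallelogram stays within distance d/2 of
    \<open>x\<close>; the summand 1 covers the case that both vectors are zero.\<close>
  define h where "h = d / (2 * (norm v + norm w + 1))"
  have dpos: "d > 0" using d d3 by (auto simp: d_def)
  have np: "norm v + norm w + 1 > 0" by (smt (verit) norm_ge_zero)
  have h: "h > 0" using dpos np by (simp add: h_def)
  have near: "dist (x + s *\<^sub>R v + t *\<^sub>R w) x < d" if "0 \<le> s" "s \<le> h" "0 \<le> t" "t \<le> h" for s t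
  proof -
    have "dist (x + s *\<^sub>R v + t *\<^sub>R w) x = norm (s *\<^sub>R v + t *\<^sub>R w)" by (simp add: dist_norm)
    also have "\<dots> \<le> s * norm v + t * norm w" using that by (intro norm_triangle_le) simp
    also have "\<dots> \<le> h * norm v + h * norm w" using that by (intro add_mono mult_right_mono) auto
    also have "\<dots> \<le> h * (norm v + norm w + 1)" using h by (simp add: algebra_simps)
    also have "\<dots> = d / 2" using np by (simp add: h_def field_simps del: distrib_left_numeral)
    also have "\<dots> < d" using dpos by simp
    finally show ?thesis .
  qed
  have inS: "x + s *\<^sub>R v + t *\<^sub>R w \<in> S" if "0 \<le> s" "s \<le> h" "0 \<le> t" "t \<le> h" for s t
    using near[OF that] d3 by (auto simp: d_def dist_commute)
  obtain s t where 1: "0 < s" "s < h" "0 < t" "t < h"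
    "f (x + h *\<^sub>R v + h *\<^sub>R w) - f (x + h *\<^sub>R v) - f (x + h *\<^sub>R w) + f x = h\<^sup>2 * A (x + s *\<^sub>R v + t *\<^sub>R w)"
    unfolding A_def by (rule second_difference[OF f h inS])
  have inS': "x + s *\<^sub>R w + t *\<^sub>R v \<in> S" if "0 \<le> s" "s \<le> h" "0 \<le> t" "t \<le> h" for s t
    using inS[of t s] that by (simp add: algebra_simps)
  obtain s' t' where 2: "0 < s'" "s' < h" "0 < t'" "t' < h"
    "f (x + h *\<^sub>R w + h *\<^sub>R v) - f (x + h *\<^sub>R w) - f (x + h *\<^sub>R v) + f x = h\<^sup>2 * B (x + s' *\<^sub>R w + t' *\<^sub>R v)"
    unfolding B_def by (rule second_difference[OF f h inS'])
  have eq: "x + h *\<^sub>R w + h *\<^sub>R v = x + h *\<^sub>R v + h *\<^sub>R w" "x + s' *\<^sub>R w + t' *\<^sub>R v = x + t' *\<^sub>R v + s' *\<^sub>R w"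
    by simp_all
  have "h\<^sup>2 * A (x + s *\<^sub>R v + t *\<^sub>R w) = h\<^sup>2 * B (x + t' *\<^sub>R v + s' *\<^sub>R w)"
    using 1(5) 2(5)[unfolded eq] by linarith
  then have AB: "A (x + s *\<^sub>R v + t *\<^sub>R w) = B (x + t' *\<^sub>R v + s' *\<^sub>R w)"
    using h by simp
  have "dist (A (x + s *\<^sub>R v + t *\<^sub>R w)) (A x) < ?e"
    using d(2) near[of s t] 1 by (auto simp: d_def)
  moreover have "dist (B (x + t' *\<^sub>R v + s' *\<^sub>R w)) (B x) < ?e"
    using d(4) near[of t' s'] 2 by (auto simp: d_def)
  ultimately have "dist (A x) (B x) < ?e + ?e"
    using dist_triangle3[of "A x" "B x" "A (x + s *\<^sub>R v + t *\<^sub>R w)"] AB by simp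
  then show False by (simp add: dist_real_def)
qed

lemma dd_inner_left:
  "smooth_on f S \<Longrightarrow> x \<in> S \<Longrightarrow> \<DD> (\<lambda>y. f y \<bullet> b) x v = \<DD> f x v \<bullet> b"
  by (rule fun_cong[OF dd_eqI])
    (rule bounded_linear.has_derivative[OF bounded_linear_inner_left smooth_on_has_derivative])

lemma dd_commute:
  fixes f :: "'a::euclidean_space \<Rightarrow> 'b::euclidean_space"
  assumes S: "open S" and f: "smooth_on f S" and x: "x \<in> S"
  shows "\<DD> (\<lambda>y. \<DD> f y v) x w = \<DD> (\<lambda>y. \<DD> f y w) x v"
proof (rule euclidean_eqI)
  fix b :: 'b
  have *: "\<DD> (\<lambda>y. \<DD> f y v) x w \<bullet> b = \<DD> (\<lambda>y. \<DD> (\<lambda>y. f y \<bullet> b) y v) x w" for v w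
  proof -
    have "\<DD> (\<lambda>y. \<DD> f y v) x w \<bullet> b = \<DD> (\<lambda>y. \<DD> f y v \<bullet> b) x w"
      using dd_inner_left[OF smooth_on_dd[OF f] x] by metis
    also have "\<dots> = \<DD> (\<lambda>y. \<DD> (\<lambda>y. f y \<bullet> b) y v) x w"
      by (rule fun_cong[OF dd_cong_open(1)[OF S x]]) (simp add: dd_inner_left[OF f])
    finally show ?thesis .
  qed
  show "\<DD> (\<lambda>y. \<DD> f y v) x w \<bullet> b = \<DD> (\<lambda>y. \<DD> f y w) x v \<bullet> b"
    unfolding * by (rule dd_commute_real[OF S _ x]) (intro smooth_on_inner S f smooth_on_const)
qed

section \<open>The Poincare lemma\<close>

lemma smooth_on_chain:
  assumes "smooth_on g S" "smooth_on f T" "x \<in> S" "g x \<in> T"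
  shows "((\<lambda>x. f (g x)) has_derivative (\<lambda>v. \<DD> f (g x) (\<DD> g x v))) (at x)"
  using has_derivative_compose[OF smooth_on_has_derivative[OF assms(1,3)]
      smooth_on_has_derivative[OF assms(2,4)]] .

lemma smooth_on_partial:
  fixes f :: "'a::euclidean_space \<times> 'b::euclidean_space \<Rightarrow> 'c::real_normed_vector"
  assumes "smooth_on f S" "(x, y) \<in> S"
  shows "((\<lambda>x. f (x, y)) has_derivative (\<lambda>v. \<DD> f (x, y) (v, 0))) (at x)"
    "((\<lambda>y. f (x, y)) has_derivative (\<lambda>v. \<DD> f (x, y) (0, v))) (at y)"
  by (rule has_derivative_compose[where f="\<lambda>x. (x, y)", OF _ smooth_on_has_derivative[OF assms]],
      auto intro!: derivative_eq_intros)
    (rule has_derivative_compose[where f="\<lambda>y. (x, y)", OF _ smooth_on_has_derivative[OF assms]],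
      auto intro!: derivative_eq_intros)

lemma has_derivative_integral:
  fixes f :: "real \<times> 'a::euclidean_space \<Rightarrow> real"
  assumes S: "open S" and f: "smooth_on f (UNIV \<times> S)" and x: "x \<in> S"
  shows "((\<lambda>x. integral {0..1} (\<lambda>t. f (t, x))) has_derivative
    (\<lambda>v. integral {0..1} (\<lambda>t. \<DD> f (t, x) (0, v)))) (at x)"
proof -
  obtain e where e: "e > 0" "ball x e \<subseteq> S" using S x openE by blast
  \<comment> \<open>\<open>leibniz_rule\<close> asks for the partial derivative as a bounded linear
    function that depends continuously on both variables. The gradient vector is continuous because
    its coordinates are, and \<open>blinfun_inner_right\<close> makes the linear function out of
    it.\<close>
  define grad where "grad = (\<lambda>w. \<Sum>b\<in>Basis. \<DD> f w (0, b) *\<^sub>R (b::'a))"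
  have grad: "grad w \<bullet> v = \<DD> f w (0, v)" if w: "w \<in> UNIV \<times> S" for w v
  proof -
    have "linear (\<lambda>v. \<DD> f w (0, v))"
      using smooth_on_linear_dd[OF f w] linear_add[of "\<DD> f w" "(0, _)" "(0, _)"]
        linear_scale[of "\<DD> f w" _ "(0, _)"]
      by (intro linearI) simp_all
    from linear_sum_Basis[OF this, of v] show ?thesis
      by (simp add: grad_def inner_sum_left inner_sum_right mult.commute inner_commute)
  qed
  have gc: "continuous_on (UNIV \<times> S) grad"
    unfolding grad_def
    by (intro continuous_on_sum continuous_on_scaleR continuous_on_const
        smooth_on_continuous_on[OF smooth_on_dd[OF f]])
  have swap: "continuous_on (ball x e \<times> cbox 0 1) (\<lambda>(y, t). g (t, y))"
    if "continuous_on (UNIV \<times> S) g" for g :: "real \<times> 'a \<Rightarrow> 'b::topological_space"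
    unfolding split_beta using e
    by (intro continuous_on_compose2[OF that] continuous_intros) auto
  define fx where "fx = (\<lambda>y t. blinfun_inner_right (grad (t, y)))"
  have "((\<lambda>y. integral (cbox 0 1) (\<lambda>t. f (t, y))) has_derivative integral (cbox 0 1) (fx x))
    (at x within ball x e)"
  proof (rule leibniz_rule)
    fix y and t :: real assume y: "y \<in> ball x e"
    then have "(t, y) \<in> UNIV \<times> S" using e by auto
    then have "blinfun_apply (fx y t) = (\<lambda>v. \<DD> f (t, y) (0, v))" "(t, y) \<in> UNIV \<times> S"
      using grad by (simp_all add: fx_def fun_eq_iff)
    then show "((\<lambda>y. f (t, y)) has_derivative blinfun_apply (fx y t)) (at y within ball x e)"
      by (simp only: has_derivative_at_withinI[OF smooth_on_partial(2)[OF f]])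
  next
    fix y assume y: "y \<in> ball x e"
    have "continuous_on (cbox 0 1) (\<lambda>t. f (t, y))"
      using y e by (intro continuous_on_compose2[OF smooth_on_continuous_on[OF f]] continuous_intros) auto
    then show "(\<lambda>t. f (t, y)) integrable_on cbox 0 1" by (rule integrable_continuous)
  next
    show "continuous_on (ball x e \<times> cbox 0 1) (\<lambda>(y, t). fx y t)"
      unfolding fx_def using bounded_linear.continuous_on[OF bounded_linear_blinfun_inner_right swap[OF gc]]
      by (simp add: split_beta)
  qed (use e in auto)
  moreover have "blinfun_apply (integral (cbox 0 1) (fx x)) = (\<lambda>v. integral {0..1} (\<lambda>t. \<DD> f (t, x) (0, v)))"
  proof
    fix v
    have "continuous_on (cbox 0 1) (fx x)"
      unfolding fx_def using x
      by (intro bounded_linear.continuous_on[OF bounded_linear_blinfun_inner_right]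
          continuous_on_compose2[OF gc] continuous_intros) auto
    then have "blinfun_apply (integral (cbox 0 1) (fx x)) v = integral (cbox 0 1) (\<lambda>t. fx x t v)"
      by (intro blinfun_apply_integral integrable_continuous)
    then show "blinfun_apply (integral (cbox 0 1) (fx x)) v = integral {0..1} (\<lambda>t. \<DD> f (t, x) (0, v))"
      using grad x by (simp add: fx_def)
  qed
  ultimately show ?thesis
    using e by (simp add: at_within_open[of x "ball x e"])
qed

lemma smooth_on_integral:
  fixes f :: "real \<times> 'a::euclidean_space \<Rightarrow> real"
  assumes S: "open S" and f: "smooth_on f (UNIV \<times> S)"
  shows "smooth_on (\<lambda>x. integral {0..1} (\<lambda>t. f (t, x))) S"
proof -
  \<comment> \<open>The induction ranges over all integrands at once, because the derivative of the
    integral is the integral of another smooth integrand.\<close>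
  have "Ck_on k (\<lambda>x. integral {0..1} (\<lambda>t. f (t, x))) S"
    if "smooth_on f (UNIV \<times> S)" for k and f :: "real \<times> 'a \<Rightarrow> real"
    using that
  proof (induction k arbitrary: f)
    case 0
    have "isCont (\<lambda>x. integral {0..1} (\<lambda>t. f (t, x))) x" if "x \<in> S" for x
      by (rule has_derivative_continuous[OF has_derivative_integral[OF S 0 that]])
    then show ?case by (simp add: continuous_at_imp_continuous_on)
  next
    case (Suc k)
    have "Ck_on k (\<lambda>x. \<DD> (\<lambda>x. integral {0..1} (\<lambda>t. f (t, x))) x v) S" for v
    proof (rule Ck_on_cong[OF S _ Suc.IH[OF smooth_on_dd[OF Suc.prems]]])
      show "integral {0..1} (\<lambda>t. \<DD> f (t, x) (0, v)) = \<DD> (\<lambda>x. integral {0..1} (\<lambda>t. f (t, x))) x v"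
        if "x \<in> S" for x
        by (simp add: dd_eqI[OF has_derivative_integral[OF S Suc.prems that]])
    qed
    then show ?case
      using has_derivative_integral[OF S Suc.prems] by (auto simp: differentiable_def)
  qed
  then show ?thesis using f by (simp add: smooth_on_def)
qed

lemma integral_dd_fst:
  fixes f :: "real \<times> 'a::euclidean_space \<Rightarrow> real"
  assumes f: "smooth_on f (UNIV \<times> S)" and x: "x \<in> S"
  shows "integral {0..1} (\<lambda>t. \<DD> f (t, x) (1, 0)) = f (1, x) - f (0, x)"
proof (rule integral_unique, rule fundamental_theorem_of_calculus)
  fix t :: real
  have tx: "(t, x) \<in> UNIV \<times> S" using x by simp
  have eq: "(\<lambda>v. \<DD> f (t, x) (v, 0)) = (\<lambda>v. v *\<^sub>R \<DD> f (t, x) (1, 0))"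
    by (simp add: linear_scale[OF smooth_on_linear_dd[OF f tx], symmetric] del: real_scaleR_def)
      (simp add: real_scaleR_def)
  show "((\<lambda>t. f (t, x)) has_vector_derivative \<DD> f (t, x) (1, 0)) (at t within {0..1})"
    using has_derivative_at_withinI[OF smooth_on_partial(1)[OF f tx]]
    unfolding has_vector_derivative_def eq .
qed simp

text \<open>A smooth homotopy from a constant map to the identity. The time runs over all reals
  instead of the unit interval, so that the domain is open and two-sided derivatives exist at times
  0 and 1.\<close>

definition smooth_contraction :: "(real \<times> 'a::euclidean_space \<Rightarrow> 'a) \<Rightarrow> 'a set \<Rightarrow> 'a \<Rightarrow> bool" where
  "smooth_contraction H S z \<longleftrightarrow> smooth_on H (UNIV \<times> S) \<and> (\<forall>t. \<forall>x\<in>S. H (t, x) \<in> S) \<and>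
     (\<forall>x\<in>S. H (1, x) = x) \<and> (\<forall>x\<in>S. H (0, x) = z)"

text \<open>These are the boundary terms of the homotopy formula: pulling a form back along
  \<open>H\<close> gives the form itself at time 1 and zero at time 0.\<close>

lemma smooth_contraction_dd:
  assumes S: "open S" and H: "smooth_contraction H S z" and x: "x \<in> S"
  shows "\<DD> H (1, x) (0, v) = v" "\<DD> H (0, x) (0, v) = 0"
proof -
  have sm: "smooth_on H (UNIV \<times> S)" using H by (simp add: smooth_contraction_def)
  have "((\<lambda>y. H (1, y)) has_derivative (\<lambda>v. v)) (at x)"
    by (rule has_derivative_transform_within_open[OF has_derivative_ident S x])
      (use H in \<open>simp add: smooth_contraction_def\<close>)
  moreover have "((\<lambda>y. H (0, y)) has_derivative (\<lambda>v. 0)) (at x)"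
    by (rule has_derivative_transform_within_open[OF has_derivative_const S x])
      (use H in \<open>simp add: smooth_contraction_def\<close>)
  ultimately show "\<DD> H (1, x) (0, v) = v" "\<DD> H (0, x) (0, v) = 0"
    using smooth_on_partial(2)[OF sm, of 1 x] smooth_on_partial(2)[OF sm, of 0 x] x
    by (auto dest: has_derivative_unique fun_cong)
qed

text \<open>Scaling towards the origin of Euclidean space, carried over to \<open>S\<close> by the
  diffeomorphism.\<close>

lemma diffeomorphic_smooth_contraction:
  assumes S: "open S" and d: "diffeomorphic_sets S (UNIV :: 'a::euclidean_space set)"
  obtains H z where "smooth_contraction H S (z::'a)"
proof -
  obtain f g where f: "smooth_on f S" and g: "smooth_on g (UNIV :: 'a set)" "g ` (UNIV :: 'a set) = S"
    "\<And>x. x \<in> S \<Longrightarrow> g (f x) = x"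
    using d unfolding diffeomorphic_sets_def by blast
  have "open ((UNIV::real set) \<times> S)" using S by (simp add: open_Times)
  then have "smooth_on (\<lambda>w. g (fst w *\<^sub>R f (snd w))) (UNIV \<times> S)"
    by (intro smooth_on_compose[OF _ _ g(1)] smooth_intros smooth_on_compose[OF _ _ f]) auto
  then have "smooth_contraction (\<lambda>w. g (fst w *\<^sub>R f (snd w))) S (g 0)"
    using g by (auto simp: smooth_contraction_def)
  then show thesis by (rule that)
qed

text \<open>With the base contracted by \<open>H\<close> and the fibres scaled linearly, a
  contraction of V is extended to the coordinate domain of TU.\<close>

lemma smooth_contraction_Times:
  fixes S :: "'a::euclidean_space set"
  assumes S: "open S" and H: "smooth_contraction H S z"
  shows "smooth_contraction (\<lambda>w. (H (fst w, fst (snd w)), fst w *\<^sub>R snd (snd w)))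
    (S \<times> (UNIV :: 'b::euclidean_space set)) (z, 0)"
proof -
  have "smooth_on H (UNIV \<times> S)" using H by (simp add: smooth_contraction_def)
  moreover have "open (UNIV \<times> S \<times> (UNIV :: 'b set))" using S by (simp add: open_Times)
  ultimately have "smooth_on (\<lambda>w. (H (fst w, fst (snd w)), fst w *\<^sub>R snd (snd w)))
      ((UNIV::real set) \<times> S \<times> (UNIV :: 'b set))"
    by (intro smooth_intros smooth_on_compose[where f=H and g="\<lambda>w. (fst w, fst (snd w))"]) auto
  then show ?thesis using H by (auto simp: smooth_contraction_def)
qed

text \<open>The homotopy operator: the potential at \<open>x\<close> is the integral of the form
  along the path t \<mapsto> \<open>H (t, x)\<close>.\<close>

lemma poincare_1_form:
  fixes q :: "'a::euclidean_space \<Rightarrow> 'a"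
  assumes S: "open S" and H: "smooth_contraction H S z" and q: "smooth_on q S"
    and closed: "\<And>x a b. x \<in> S \<Longrightarrow> \<DD> q x a \<bullet> b = \<DD> q x b \<bullet> a"
  obtains f where "smooth_on f S" "\<And>x a. x \<in> S \<Longrightarrow> \<DD> f x a = q x \<bullet> a"
proof -
  have sm: "smooth_on H (UNIV \<times> S)" and HS: "\<And>w. w \<in> UNIV \<times> S \<Longrightarrow> H w \<in> S"
    using H by (auto simp: smooth_contraction_def)
  have O: "open ((UNIV::real set) \<times> S)" using S by (simp add: open_Times)
  note dH = smooth_on_dd[OF sm]
  have qH: "smooth_on (\<lambda>w. q (H w)) (UNIV \<times> S)"
    by (rule smooth_on_compose[OF O sm q]) (use HS in auto)
  have der: "\<DD> (\<lambda>w. q (H w) \<bullet> \<DD> H w u) w v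
      = q (H w) \<bullet> \<DD> (\<lambda>w. \<DD> H w u) w v + \<DD> q (H w) (\<DD> H w v) \<bullet> \<DD> H w u"
    if w: "w \<in> UNIV \<times> S" for u v w
    by (rule fun_cong[OF dd_eqI[OF has_derivative_inner[OF smooth_on_chain[OF sm q w HS[OF w]]
            smooth_on_has_derivative[OF dH w]]]])
  define F where "F = (\<lambda>w. q (H w) \<bullet> \<DD> H w (1, 0))"
  have F: "smooth_on F (UNIV \<times> S)" unfolding F_def by (intro smooth_on_inner O qH dH)
  show thesis
  proof (rule that[OF smooth_on_integral[OF S F]])
    fix x a assume x: "x \<in> S"
    have G: "smooth_on (\<lambda>w. q (H w) \<bullet> \<DD> H w (0, a)) (UNIV \<times> S)" by (intro smooth_on_inner O qH dH)
    \<comment> \<open>Closedness of \<open>q\<close> and symmetry of the second derivative of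
      \<open>H\<close> turn the spatial derivative of the integrand into a time derivative, which
      the fundamental theorem of calculus integrates.\<close>
    have "\<DD> F (t, x) (0, a) = \<DD> (\<lambda>w. q (H w) \<bullet> \<DD> H w (0, a)) (t, x) (1, 0)" for t
    proof -
      have w: "(t, x) \<in> UNIV \<times> S" using x by simp
      show ?thesis
        unfolding F_def der[OF w] dd_commute[OF O sm w, of "(1, 0)" "(0, a)"]
          closed[OF HS[OF w], of "\<DD> H (t, x) (0, a)"] ..
    qed
    then show "\<DD> (\<lambda>x. integral {0..1} (\<lambda>t. F (t, x))) x a = q x \<bullet> a"
      using integral_dd_fst[OF G x] smooth_contraction_dd[OF S H x] H x
      by (simp add: dd_eqI[OF has_derivative_integral[OF S F x]] smooth_contraction_def)
  qed
qed

lemma bilinear_sum_Basis: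
  fixes L :: "'a::euclidean_space \<Rightarrow> 'a"
  assumes "linear L"
  shows "L a \<bullet> b = (\<Sum>i\<in>Basis. \<Sum>j\<in>Basis. (a \<bullet> i) * (b \<bullet> j) * (L i \<bullet> j))"
proof -
  have "L a \<bullet> b = (\<Sum>j\<in>Basis. (L a \<bullet> j) * (b \<bullet> j))" by (rule euclidean_inner)
  also have "\<dots> = (\<Sum>j\<in>Basis. \<Sum>i\<in>Basis. (a \<bullet> i) * (b \<bullet> j) * (L i \<bullet> j))"
    by (subst linear_sum_Basis[OF assms]) (simp add: inner_sum_left sum_distrib_left mult_ac)
  finally show ?thesis by (subst sum.swap) simp
qed

text \<open>The 2-form is stored as the linear map with \<Omega>(a, b) =
  \<open>\<Omega> x a \<bullet> b\<close>, so that its smoothness is that of a map into a normed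
  space. The primitive integrates, over time, the pullback along \<open>H\<close> contracted with
  the time direction.\<close>

lemma poincare_2_form:
  fixes \<Omega> :: "'a::euclidean_space \<Rightarrow> 'a \<Rightarrow>\<^sub>L 'a"
  assumes S: "open S" and H: "smooth_contraction H S z" and \<Omega>: "smooth_on \<Omega> S"
    and anti: "\<And>x a b. x \<in> S \<Longrightarrow> \<Omega> x a \<bullet> b = - (\<Omega> x b \<bullet> a)"
    and closed: "\<And>x a b c. x \<in> S \<Longrightarrow> \<DD> \<Omega> x a b \<bullet> c + \<DD> \<Omega> x b c \<bullet> a + \<DD> \<Omega> x c a \<bullet> b = 0"
  obtains \<beta> where "smooth_on \<beta> S" "\<And>x a b. x \<in> S \<Longrightarrow> \<DD> \<beta> x a \<bullet> b - \<DD> \<beta> x b \<bullet> a = \<Omega> x a \<bullet> b"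
proof -
  have sm: "smooth_on H (UNIV \<times> S)" and HS: "\<And>w. w \<in> UNIV \<times> S \<Longrightarrow> H w \<in> S"
    using H by (auto simp: smooth_contraction_def)
  have O: "open ((UNIV::real set) \<times> S)" using S by (simp add: open_Times)
  note dH = smooth_on_dd[OF sm]
  have \<Omega>H: "smooth_on (\<lambda>w. \<Omega> (H w)) (UNIV \<times> S)"
    by (rule smooth_on_compose[OF O sm \<Omega>]) (use HS in auto)
  have smF: "smooth_on (\<lambda>w. \<Omega> (H w) (\<DD> H w u) \<bullet> \<DD> H w u') (UNIV \<times> S)" for u u'
    unfolding smooth_on_def
    by (intro allI Ck_on_bilinear[OF O bounded_bilinear_inner]
        Ck_on_bilinear[OF O bounded_bilinear_blinfun_apply])
      (use \<Omega>H dH in \<open>auto simp: smooth_on_def\<close>)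
  have der: "\<DD> (\<lambda>w. \<Omega> (H w) (\<DD> H w u) \<bullet> \<DD> H w u') w v
      = \<Omega> (H w) (\<DD> H w u) \<bullet> \<DD> (\<lambda>w. \<DD> H w u') w v
        + (\<Omega> (H w) (\<DD> (\<lambda>w. \<DD> H w u) w v) + \<DD> \<Omega> (H w) (\<DD> H w v) (\<DD> H w u)) \<bullet> \<DD> H w u'"
    if w: "w \<in> UNIV \<times> S" for u u' v w
    by (rule fun_cong[OF dd_eqI[OF has_derivative_inner[OF bounded_bilinear.FDERIV[OF
            bounded_bilinear_blinfun_apply smooth_on_chain[OF sm \<Omega> w HS[OF w]]
            smooth_on_has_derivative[OF dH w]] smooth_on_has_derivative[OF dH w]]]])
  have anti': "\<DD> \<Omega> x v a \<bullet> b = - (\<DD> \<Omega> x v b \<bullet> a)" if x: "x \<in> S" for x v a b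
  proof -
    have *: "((\<lambda>x. \<Omega> x a \<bullet> b) has_derivative (\<lambda>v. \<DD> \<Omega> x v a \<bullet> b)) (at x)" for a b
      by (rule bounded_linear.has_derivative[OF bounded_linear_inner_left],
          rule bounded_linear.has_derivative[OF blinfun.bounded_linear_left],
          rule smooth_on_has_derivative[OF \<Omega> x])
    have "((\<lambda>x. \<Omega> x a \<bullet> b) has_derivative (\<lambda>v. - (\<DD> \<Omega> x v b \<bullet> a))) (at x)"
      by (rule has_derivative_transform_within_open[OF has_derivative_minus[OF *] S x])
        (simp add: anti[of _ a b])
    then show ?thesis using has_derivative_unique[OF *] by (metis (mono_tags, lifting))
  qed
  define F where "F = (\<lambda>b w. \<Omega> (H w) (\<DD> H w (1, 0)) \<bullet> \<DD> H w (0, b))"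
  have F: "smooth_on (F b) (UNIV \<times> S)" for b unfolding F_def by (rule smF)
  define B where "B = (\<lambda>b x. integral {0..1} (\<lambda>t. F b (t, x)))"
  have B: "smooth_on (B b) S" for b
    unfolding B_def by (rule smooth_on_integral[OF S F])
  \<comment> \<open>The facts on parameter integrals concern real integrands, so the primitive is
    assembled from its components; the identity is then shown for basis vectors and extended
    bilinearly.\<close>
  define \<beta> where "\<beta> = (\<lambda>x. \<Sum>b\<in>Basis. B b x *\<^sub>R b)"
  have sm\<beta>: "smooth_on \<beta> S" unfolding \<beta>_def by (intro smooth_intros S B)
  have \<beta>b: "\<DD> \<beta> x a \<bullet> b = \<DD> (B b) x a" if "x \<in> S" "b \<in> Basis" for x a b
    using dd_inner_left[OF sm\<beta> that(1), of b a] that(2) by (simp add: \<beta>_def)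
  have basis: "\<DD> \<beta> x a \<bullet> b - \<DD> \<beta> x b \<bullet> a = \<Omega> x a \<bullet> b"
    if x: "x \<in> S" and ab: "a \<in> Basis" "b \<in> Basis" for x a b
  proof -
    \<comment> \<open>Since the pullback along \<open>H\<close> is closed, the spatial exterior
      derivative of its contraction with the time direction equals the time derivative of its
      spatial part.\<close>
    have eq: "\<DD> (F b) (t, x) (0, a) - \<DD> (F a) (t, x) (0, b)
      = \<DD> (\<lambda>w. \<Omega> (H w) (\<DD> H w (0, a)) \<bullet> \<DD> H w (0, b)) (t, x) (1, 0)" for t
    proof -
      have w: "(t, x) \<in> UNIV \<times> S" using x by simp
      note com = dd_commute[OF O sm w, of "(1, 0)" "(0, a)"] dd_commute[OF O sm w, of "(1, 0)" "(0, b)"]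
        dd_commute[OF O sm w, of "(0, b)" "(0, a)"]
      show ?thesis
        unfolding F_def der[OF w] com
        using closed[OF HS[OF w], of "\<DD> H (t, x) (1, 0)" "\<DD> H (t, x) (0, a)" "\<DD> H (t, x) (0, b)"]
          anti'[OF HS[OF w], of "\<DD> H (t, x) (0, a)" "\<DD> H (t, x) (0, b)" "\<DD> H (t, x) (1, 0)"]
          anti[OF HS[OF w], of "\<DD> (\<lambda>w. \<DD> H w (0, b)) (t, x) (1, 0)" "\<DD> H (t, x) (0, a)"]
        by (simp add: inner_add_left)
    qed
    have int: "(\<lambda>t. \<DD> (F b) (t, x) (0, a)) integrable_on {0..1}" for a b
      using x
      by (intro integrable_continuous_real continuous_on_compose2[OF smooth_on_continuous_on[OF smooth_on_dd[OF F]]]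
          continuous_intros) auto
    have "\<DD> \<beta> x a \<bullet> b - \<DD> \<beta> x b \<bullet> a
      = integral {0..1} (\<lambda>t. \<DD> (F b) (t, x) (0, a) - \<DD> (F a) (t, x) (0, b))"
      unfolding \<beta>b[OF x ab(1)] \<beta>b[OF x ab(2)] B_def dd_eqI[OF has_derivative_integral[OF S F x]]
      by (rule Henstock_Kurzweil_Integration.integral_diff[symmetric]) (rule int)+
    also have "\<dots> = \<Omega> x a \<bullet> b"
      unfolding eq using integral_dd_fst[OF smF x] smooth_contraction_dd[OF S H x] H x
      by (simp add: smooth_contraction_def)
    finally show ?thesis .
  qed
  show thesis
  proof (rule that[OF sm\<beta>])
    fix x a b assume x: "x \<in> S"
    have lin: "linear (\<DD> \<beta> x)" by (rule smooth_on_linear_dd[OF sm\<beta> x])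
    note e = bilinear_sum_Basis[OF lin]
    have "\<DD> \<beta> x a \<bullet> b - \<DD> \<beta> x b \<bullet> a
      = (\<Sum>i\<in>Basis. \<Sum>j\<in>Basis. (a \<bullet> i) * (b \<bullet> j) * (\<DD> \<beta> x i \<bullet> j))
        - (\<Sum>i\<in>Basis. \<Sum>j\<in>Basis. (a \<bullet> i) * (b \<bullet> j) * (\<DD> \<beta> x j \<bullet> i))"
      unfolding e[of a b] e[of b a] by (subst (3) sum.swap) (simp add: mult_ac)
    also have "\<dots> = (\<Sum>i\<in>Basis. \<Sum>j\<in>Basis. (a \<bullet> i) * (b \<bullet> j) * (\<Omega> x i \<bullet> j))"
      using basis[OF x] by (simp add: sum_subtractf[symmetric] right_diff_distrib[symmetric])
    also have "\<dots> = \<Omega> x a \<bullet> b"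
      by (rule bilinear_sum_Basis[OF bounded_linear.linear[OF blinfun.bounded_linear_right], symmetric])
    finally show "\<DD> \<beta> x a \<bullet> b - \<DD> \<beta> x b \<bullet> a = \<Omega> x a \<bullet> b" .
  qed
qed

section \<open>The Helmholtz conditions in coordinates\<close>

text \<open>Product rule for the pairing of a derivative with a moving direction. The direction
  \<open>X\<close> only has to be differentiable at the point \<open>z\<close>.\<close>

lemma has_derivative_dd_field:
  fixes f :: "'a::euclidean_space \<Rightarrow> 'b::euclidean_space"
  assumes f: "smooth_on f S" and X: "(X has_derivative X') (at z)" and z: "z \<in> S"
    and S: "open S"
  shows "((\<lambda>z. \<DD> f z (X z)) has_derivative (\<lambda>u. \<DD> (\<lambda>y. \<DD> f y (X z)) z u + \<DD> f z (X' u))) (at z)"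
proof -
  have lin: "\<DD> f y v = (\<Sum>b\<in>Basis. (v \<bullet> b) *\<^sub>R \<DD> f y b)" if "y \<in> S" for y v
    by (rule linear_sum_Basis[OF smooth_on_linear_dd[OF f that]])
  have fb: "((\<lambda>y. \<DD> f y b) has_derivative \<DD> (\<lambda>y. \<DD> f y b) z) (at z)" for b
    by (rule smooth_on_has_derivative[OF smooth_on_dd[OF f] z])
  have 1: "((\<lambda>z. \<DD> f z (X z)) has_derivative
      (\<lambda>u. \<Sum>b\<in>Basis. (X z \<bullet> b) *\<^sub>R \<DD> (\<lambda>y. \<DD> f y b) z u + (X' u \<bullet> b) *\<^sub>R \<DD> f z b)) (at z)"
    by (rule has_derivative_transform_within_open[where f="\<lambda>z. \<Sum>b\<in>Basis. (X z \<bullet> b) *\<^sub>R \<DD> f z b", OF _ S z])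
      (intro has_derivative_sum has_derivative_scaleR has_derivative_inner_left X fb, metis lin)
  have 2: "((\<lambda>y. \<DD> f y (X z)) has_derivative (\<lambda>u. \<Sum>b\<in>Basis. (X z \<bullet> b) *\<^sub>R \<DD> (\<lambda>y. \<DD> f y b) z u)) (at z)"
    by (rule has_derivative_transform_within_open[where f="\<lambda>y. \<Sum>b\<in>Basis. (X z \<bullet> b) *\<^sub>R \<DD> f y b", OF _ S z])
      (intro has_derivative_sum has_derivative_scaleR_right fb, metis lin)
  show ?thesis
    using 1 unfolding dd_eqI[OF 2] by (simp add: sum.distrib lin[OF z, of "X' _"])
qed

text \<open>In the second form the fixed direction \<open>u\<close> is the inner one. For the spray
  field it exhibits S applied to the derivative along \<open>u\<close>, plus a commutator
  term.\<close>

lemma dd_dd_field: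
  fixes f :: "'a::euclidean_space \<Rightarrow> 'b::euclidean_space"
  assumes "open S" "smooth_on f S" "smooth_on X S" "z \<in> S"
  shows "\<DD> (\<lambda>z. \<DD> f z (X z)) z u = \<DD> (\<lambda>y. \<DD> f y (X z)) z u + \<DD> f z (\<DD> X z u)"
    "\<DD> (\<lambda>z. \<DD> f z (X z)) z u = \<DD> (\<lambda>y. \<DD> f y u) z (X z) + \<DD> f z (\<DD> X z u)"
proof -
  show 1: "\<DD> (\<lambda>z. \<DD> f z (X z)) z u = \<DD> (\<lambda>y. \<DD> f y (X z)) z u + \<DD> f z (\<DD> X z u)"
    by (rule fun_cong[OF dd_eqI[OF has_derivative_dd_field[OF assms(2)
            smooth_on_has_derivative[OF assms(3,4)] assms(4,1)]]])
  show "\<DD> (\<lambda>z. \<DD> f z (X z)) z u = \<DD> (\<lambda>y. \<DD> f y u) z (X z) + \<DD> f z (\<DD> X z u)"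
    unfolding 1 dd_commute[OF assms(1,2,4), of _ u] ..
qed

lemma smooth_on_dd_add: "smooth_on f S \<Longrightarrow> z \<in> S \<Longrightarrow> \<DD> f z (u + v) = \<DD> f z u + \<DD> f z v"
  by (simp add: linear_add smooth_on_linear_dd)

lemma smooth_on_dd_scaleR: "smooth_on f S \<Longrightarrow> z \<in> S \<Longrightarrow> \<DD> f z (r *\<^sub>R u) = r *\<^sub>R \<DD> f z u"
  by (simp add: linear_scale smooth_on_linear_dd)

lemma smooth_on_dd_Pair:
  fixes f :: "'a::euclidean_space \<times> 'b::euclidean_space \<Rightarrow> 'c::real_normed_vector"
  shows "smooth_on f S \<Longrightarrow> z \<in> S \<Longrightarrow> \<DD> f z (u, v) = \<DD> f z (u, 0) + \<DD> f z (0, v)"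
  using smooth_on_dd_add[of f S z "(u, 0)" "(0, v)"] by simp

text \<open>In induced coordinates a semispray is \<open>(y, s)\<close>, where \<open>s\<close> stands for \<open>-2G\<close>; the linear map
  \<open>conn z\<close> is the connection \<open>-N\<close>, and \<open>jacobi z\<close> is \<open>R\<close>.\<close>

locale spray =
  fixes V :: "'e::euclidean_space set" and s :: "'e \<times> 'e \<Rightarrow> 'e"
  assumes open_V: "open V" and smooth_s: "smooth_on s (V \<times> UNIV)"
begin

abbreviation "Z \<equiv> V \<times> (UNIV :: 'e set)"

definition spray_vf :: "'e \<times> 'e \<Rightarrow> 'e \<times> 'e" where
  "spray_vf z = (snd z, s z)"

definition conn :: "'e \<times> 'e \<Rightarrow> 'e \<Rightarrow> 'e" where
  "conn z a = (1/2) *\<^sub>R \<DD> s z (0, a)"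

definition jacobi :: "'e \<times> 'e \<Rightarrow> 'e \<Rightarrow> 'e" where
  "jacobi z a = \<DD> (\<lambda>y. conn y a) z (spray_vf z) - \<DD> s z (a, 0) - conn z (conn z a)"

lemma open_Z: "open Z" using open_V by (simp add: open_Times)

lemma smooth_spray_vf: "smooth_on spray_vf Z"
  unfolding spray_vf_def by (intro smooth_intros open_Z smooth_s)

lemma smooth_conn: "smooth_on (\<lambda>y. conn y a) Z"
  unfolding conn_def by (intro smooth_on_scaleR open_Z smooth_on_const smooth_on_dd smooth_s)

lemma dd_spray_vf: assumes "z \<in> Z" shows "\<DD> spray_vf z u = (snd u, \<DD> s z u)"
proof -
  have "(spray_vf has_derivative (\<lambda>u. (snd u, \<DD> s z u))) (at z)"
    unfolding spray_vf_def
    by (intro has_derivative_Pair has_derivative_snd has_derivative_ident smooth_on_has_derivative[OF smooth_s assms])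
  from dd_eqI[OF this] show ?thesis by simp
qed

lemma linear_conn: assumes "z \<in> Z" shows "linear (conn z)"
  using smooth_on_dd_add[OF smooth_s assms, of "(0, _)" "(0, _)"]
    smooth_on_dd_scaleR[OF smooth_s assms, of _ "(0, _)"]
  by (intro linearI) (simp_all add: conn_def scaleR_add_right)

text \<open>With g(a, b) = \<open>\<DD> p z (0, a) \<bullet> b\<close> the clauses are: g is
  symmetric, g(R a, b) is symmetric in a and b, and \<nabla>g = 0. The last one has plus signs
  because \<open>conn\<close> is minus the connection N.\<close>

definition helmholtz :: "('e \<times> 'e \<Rightarrow> 'e) \<Rightarrow> bool" where
  "helmholtz p \<longleftrightarrow> (\<forall>z\<in>Z. \<forall>a b.
     \<DD> p z (0, a) \<bullet> b = \<DD> p z (0, b) \<bullet> a \<and>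
     \<DD> p z (0, jacobi z a) \<bullet> b = \<DD> p z (0, jacobi z b) \<bullet> a \<and>
     \<DD> (\<lambda>y. \<DD> p y (0, a)) z (spray_vf z) \<bullet> b
       + \<DD> p z (0, conn z a) \<bullet> b + \<DD> p z (0, a) \<bullet> conn z b = 0)"

definition euler_lagrange :: "('e \<times> 'e \<Rightarrow> real) \<Rightarrow> bool" where
  "euler_lagrange l \<longleftrightarrow> (\<forall>z\<in>Z. \<forall>a. \<DD> (\<lambda>y. \<DD> l y (0, a)) z (spray_vf z) = \<DD> l z (a, 0))"

end

section \<open>From the Euler-Lagrange equations to the Helmholtz conditions\<close>

locale spray_form = spray +
  fixes p :: "'a \<times> 'a \<Rightarrow> 'a"
  assumes smooth_p: "smooth_on p Z"
begin

text \<open>For \<open>p\<close> the fibre derivative of a Lagrangian, this is the left-hand side of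
  the Euler-Lagrange equations; in general it is the dx-part of the Lie derivative of \<theta> along
  the spray.\<close>

definition "EL z = \<DD> p z (spray_vf z)"

lemma smooth_EL: "smooth_on EL Z"
  unfolding EL_def by (intro smooth_on_dd_field open_Z smooth_p smooth_spray_vf)

text \<open>The terms without the spray come from differentiating the spray field itself. The factor
  2 appears because the vertical derivative of \<open>s\<close> is twice
  \<open>conn\<close>.\<close>

lemma dd_EL:
  assumes "z \<in> Z"
  shows "\<DD> EL z (0, b) = \<DD> (\<lambda>y. \<DD> p y (0, b)) z (spray_vf z) + \<DD> p z (b, 0) + 2 *\<^sub>R \<DD> p z (0, conn z b)"
    and "\<DD> EL z (b, 0) = \<DD> (\<lambda>y. \<DD> p y (b, 0)) z (spray_vf z) + \<DD> p z (0, \<DD> s z (b, 0))"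
proof -
  have eq: "\<DD> EL z u = \<DD> (\<lambda>y. \<DD> p y u) z (spray_vf z) + \<DD> p z (snd u, \<DD> s z u)" for u
    unfolding EL_def using dd_dd_field(2)[OF open_Z smooth_p smooth_spray_vf assms]
    by (simp add: dd_spray_vf[OF assms])
  have "\<DD> s z (0, b) = 2 *\<^sub>R conn z b" by (simp add: conn_def)
  then have "\<DD> p z (b, \<DD> s z (0, b)) = \<DD> p z (b, 0) + 2 *\<^sub>R \<DD> p z (0, conn z b)"
    using smooth_on_dd_Pair[OF smooth_p assms, of b "\<DD> s z (0, b)"]
      smooth_on_dd_scaleR[OF smooth_p assms, of 2 "(0, conn z b)"] by simp
  then show "\<DD> EL z (0, b) = \<DD> (\<lambda>y. \<DD> p y (0, b)) z (spray_vf z) + \<DD> p z (b, 0) + 2 *\<^sub>R \<DD> p z (0, conn z b)"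
    unfolding eq by simp
  show "\<DD> EL z (b, 0) = \<DD> (\<lambda>y. \<DD> p y (b, 0)) z (spray_vf z) + \<DD> p z (0, \<DD> s z (b, 0))"
    unfolding eq by simp
qed

text \<open>\<open>(a, conn z a)\<close> is the horizontal lift of \<open>a\<close>, so this is the
  derivative of \<open>p\<close> along \<delta>/\<delta>x.\<close>

definition "hor a z = \<DD> p z (a, conn z a)"

lemma hor_split: "z \<in> Z \<Longrightarrow> hor a z = \<DD> p z (a, 0) + \<DD> p z (0, conn z a)"
  unfolding hor_def by (rule smooth_on_dd_Pair[OF smooth_p])

lemma smooth_hor: "smooth_on (hor a) Z"
  unfolding hor_def by (intro smooth_intros open_Z smooth_p smooth_conn)

lemma dd_hor:
  assumes z: "z \<in> Z"
  shows "\<DD> (hor a) z (spray_vf z) = \<DD> (\<lambda>y. \<DD> p y (a, 0)) z (spray_vf z)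
    + \<DD> (\<lambda>y. \<DD> p y (0, conn z a)) z (spray_vf z)
    + \<DD> p z (0, \<DD> (\<lambda>y. conn y a) z (spray_vf z))"
proof -
  have "((\<lambda>y. (a, conn y a)) has_derivative (\<lambda>u. (0, \<DD> (\<lambda>y. conn y a) z u))) (at z)"
    by (intro has_derivative_Pair has_derivative_const smooth_on_has_derivative[OF smooth_conn z])
  then have c: "\<DD> (\<lambda>y. (a, conn y a)) z = (\<lambda>u. (0, \<DD> (\<lambda>y. conn y a) z u))" by (rule dd_eqI)
  have "((\<lambda>y. \<DD> p y (a, conn z a)) has_derivative
    (\<lambda>u. \<DD> (\<lambda>y. \<DD> p y (a, 0)) z u + \<DD> (\<lambda>y. \<DD> p y (0, conn z a)) z u)) (at z)"
    by (rule has_derivative_transform_within_open[OF has_derivative_add[OF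
            smooth_on_has_derivative[OF smooth_on_dd[OF smooth_p] z]
            smooth_on_has_derivative[OF smooth_on_dd[OF smooth_p] z]] open_Z z])
      (rule smooth_on_dd_Pair[OF smooth_p, symmetric])
  then have f: "\<DD> (\<lambda>y. \<DD> p y (a, conn z a)) z
      = (\<lambda>u. \<DD> (\<lambda>y. \<DD> p y (a, 0)) z u + \<DD> (\<lambda>y. \<DD> p y (0, conn z a)) z u)" by (rule dd_eqI)
  have "smooth_on (\<lambda>y. (a, conn y a)) Z" by (intro smooth_intros open_Z smooth_conn)
  from dd_dd_field(1)[OF open_Z smooth_p this z, of "spray_vf z"]
  show ?thesis unfolding hor_def c f by simp
qed

lemma dd_jacobi:
  assumes "z \<in> Z"
  shows "\<DD> p z (0, jacobi z a) = \<DD> p z (0, \<DD> (\<lambda>y. conn y a) z (spray_vf z))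
    - \<DD> p z (0, \<DD> s z (a, 0)) - \<DD> p z (0, conn z (conn z a))"
  using linear_diff[OF smooth_on_linear_dd[OF smooth_p assms], of "(0, _)" "(0, _)"]
  by (simp add: jacobi_def)

lemma helmholtz_if_euler_lagrange:
  assumes l: "smooth_on l Z" and pl: "\<And>z a. z \<in> Z \<Longrightarrow> p z \<bullet> a = \<DD> l z (0, a)"
    and el: "euler_lagrange l"
  shows "helmholtz p"
proof -
  have p_dd: "\<DD> p z u \<bullet> a = \<DD> (\<lambda>y. \<DD> l y (0, a)) z u" if z: "z \<in> Z" for z u a
    unfolding dd_inner_left[OF smooth_p z, symmetric]
    by (rule fun_cong[OF dd_cong_open(1)[OF open_Z z]]) (rule pl)
  have EL_l: "EL z \<bullet> a = \<DD> l z (a, 0)" if "z \<in> Z" for z a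
    using el that unfolding EL_def p_dd[OF that] euler_lagrange_def by blast
  have EL_dd: "\<DD> EL z u \<bullet> a = \<DD> (\<lambda>y. \<DD> l y (a, 0)) z u" if z: "z \<in> Z" for z u a
    unfolding dd_inner_left[OF smooth_EL z, symmetric]
    by (rule fun_cong[OF dd_cong_open(1)[OF open_Z z]]) (rule EL_l)
  have sym: "\<DD> p z (0, a) \<bullet> b = \<DD> p z (0, b) \<bullet> a" if z: "z \<in> Z" for z a b
    unfolding p_dd[OF z] by (rule dd_commute[OF open_Z l z])
  have dsym: "\<DD> (\<lambda>y. \<DD> p y (0, a)) z u \<bullet> b = \<DD> (\<lambda>y. \<DD> p y (0, b)) z u \<bullet> a" if z: "z \<in> Z" for z a b u
    unfolding dd_inner_left[OF smooth_on_dd[OF smooth_p] z, symmetric]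
    by (rule fun_cong[OF dd_cong_open(1)[OF open_Z z]]) (rule sym)
  \<comment> \<open>The mixed derivative of \<open>l\<close> in one x- and one y-direction, computed
    in both orders, with the Euler-Lagrange equation inserted.\<close>
  have star: "\<DD> (\<lambda>y. \<DD> p y (0, b)) z (spray_vf z) \<bullet> a + \<DD> p z (b, 0) \<bullet> a + 2 * (\<DD> p z (0, conn z b) \<bullet> a)
      = \<DD> p z (a, 0) \<bullet> b" if z: "z \<in> Z" for z a b
  proof -
    have "\<DD> EL z (0, b) \<bullet> a = \<DD> p z (a, 0) \<bullet> b"
      unfolding EL_dd[OF z] p_dd[OF z] by (rule dd_commute[OF open_Z l z])
    then show ?thesis by (simp add: dd_EL[OF z] inner_add_left)
  qed
  \<comment> \<open>Adding \<open>star\<close> to its copy with \<open>a\<close> and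
    \<open>b\<close> exchanged cancels the x-derivatives of \<open>p\<close>.\<close>
  have nabla: "\<DD> (\<lambda>y. \<DD> p y (0, a)) z (spray_vf z) \<bullet> b
       + \<DD> p z (0, conn z a) \<bullet> b + \<DD> p z (0, a) \<bullet> conn z b = 0" if z: "z \<in> Z" for z a b
    using star[OF z, of a b] star[OF z, of b a] dsym[OF z, of a "spray_vf z" b] sym[OF z, of a "conn z b"]
    by linarith
  \<comment> \<open>Subtracting the two copies of \<open>star\<close> instead removes the symmetric
    S(g) and leaves twice the antisymmetric part of \<open>hor\<close>.\<close>
  have hor_sym: "hor a z \<bullet> b = hor b z \<bullet> a" if z: "z \<in> Z" for z a b
    using star[OF z, of a b] star[OF z, of b a] dsym[OF z, of a "spray_vf z" b]
    by (simp add: hor_split[OF z] inner_add_left)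
  have hor_dsym: "\<DD> (hor a) z u \<bullet> b = \<DD> (hor b) z u \<bullet> a" if z: "z \<in> Z" for z a b u
    unfolding dd_inner_left[OF smooth_hor z, symmetric]
    by (rule fun_cong[OF dd_cong_open(1)[OF open_Z z]]) (rule hor_sym)
  have "\<DD> p z (0, jacobi z a) \<bullet> b = \<DD> p z (0, jacobi z b) \<bullet> a" if z: "z \<in> Z" for z a b
  proof -
    \<comment> \<open>Both S(\<open>hor a\<close>) paired with \<open>b\<close> and the x-derivative
      of \<open>EL\<close> are symmetric. By \<open>nabla\<close>, their difference is g(R a, b) -
      g(\<open>conn\<close> a, \<open>conn\<close> b), whose second term is symmetric too.\<close>
    have "\<DD> EL z (a, 0) \<bullet> b = \<DD> EL z (b, 0) \<bullet> a"
      unfolding EL_dd[OF z] by (rule dd_commute[OF open_Z l z])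
    moreover note hor_dsym[OF z, of a "spray_vf z" b] nabla[OF z, of "conn z a" b] nabla[OF z, of "conn z b" a]
      sym[OF z, of "conn z a" "conn z b"]
    ultimately show ?thesis
      by (simp add: dd_jacobi[OF z] dd_EL(2)[OF z] dd_hor[OF z] inner_add_left inner_diff_left)
  qed
  with sym nabla show ?thesis by (auto simp: helmholtz_def)
qed

end

lemma bilinear_form_sum_Basis:
  fixes B :: "'a::euclidean_space \<Rightarrow> 'b::euclidean_space \<Rightarrow> real"
  assumes "\<And>b. linear (\<lambda>a. B a b)" "\<And>a. linear (B a)"
  shows "B a b = (\<Sum>i\<in>Basis. \<Sum>j\<in>Basis. (a \<bullet> i) * (b \<bullet> j) * B i j)"
  by (subst linear_sum_Basis[OF assms(1), of a b], subst linear_sum_Basis[OF assms(2), of _ b])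
    (simp add: sum_distrib_left mult.assoc)

section \<open>From the Helmholtz conditions to a Lagrangian\<close>

locale helmholtz_form = spray_form +
  assumes helmholtz: "helmholtz p"
begin

definition "\<omega> a b z = hor a z \<bullet> b - hor b z \<bullet> a"

lemma smooth_\<omega>: "smooth_on (\<omega> a b) Z"
  unfolding \<omega>_def by (intro smooth_intros open_Z smooth_hor)

lemma \<omega>_alt: "z \<in> Z \<Longrightarrow> \<omega> a b z = \<DD> p z (a, 0) \<bullet> b + \<DD> p z (0, conn z a) \<bullet> b
    - \<DD> p z (b, 0) \<bullet> a - \<DD> p z (0, conn z b) \<bullet> a"
  by (simp add: \<omega>_def hor_split inner_add_left)

lemma sym: "z \<in> Z \<Longrightarrow> \<DD> p z (0, a) \<bullet> b = \<DD> p z (0, b) \<bullet> a"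
  and jacobi_sym: "z \<in> Z \<Longrightarrow> \<DD> p z (0, jacobi z a) \<bullet> b = \<DD> p z (0, jacobi z b) \<bullet> a"
  and nabla: "z \<in> Z \<Longrightarrow> \<DD> (\<lambda>y. \<DD> p y (0, a)) z (spray_vf z) \<bullet> b
       + \<DD> p z (0, conn z a) \<bullet> b + \<DD> p z (0, a) \<bullet> conn z b = 0"
  using helmholtz unfolding helmholtz_def by blast+

lemma dsym: assumes z: "z \<in> Z"
  shows "\<DD> (\<lambda>y. \<DD> p y (0, a)) z u \<bullet> b = \<DD> (\<lambda>y. \<DD> p y (0, b)) z u \<bullet> a"
  unfolding dd_inner_left[OF smooth_on_dd[OF smooth_p] z, symmetric]
  by (rule fun_cong[OF dd_cong_open(1)[OF open_Z z]]) (rule sym)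

text \<open>The dx-dy component of the exterior derivative of \<open>EL\<close> dx +
  \<open>p\<close> dy. The condition \<nabla>g = 0 removes S(g), and what remains is exactly
  \<omega>.\<close>

lemma EL_mixed: assumes z: "z \<in> Z"
  shows "\<DD> EL z (0, b) \<bullet> a - \<DD> p z (a, 0) \<bullet> b = \<omega> b a z"
  using nabla[OF z, of b a] sym[OF z, of b "conn z a"]
  by (simp add: dd_EL[OF z] \<omega>_alt[OF z] inner_add_left)

text \<open>The dx-dx component. The computation is the one that gave the symmetry of g R, read
  backwards: now this symmetry is known, and S(\<omega>) is what is left.\<close>

lemma EL_horizontal: assumes z: "z \<in> Z"
  shows "\<DD> EL z (a, 0) \<bullet> b - \<DD> EL z (b, 0) \<bullet> a = \<DD> (\<omega> a b) z (spray_vf z)"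
proof -
  have "(\<omega> a b has_derivative (\<lambda>u. \<DD> (hor a) z u \<bullet> b - \<DD> (hor b) z u \<bullet> a)) (at z)"
    unfolding \<omega>_def
    by (intro has_derivative_diff has_derivative_inner_left smooth_on_has_derivative[OF smooth_hor z])
  then have "\<DD> (\<omega> a b) z = (\<lambda>u. \<DD> (hor a) z u \<bullet> b - \<DD> (hor b) z u \<bullet> a)" by (rule dd_eqI)
  then show ?thesis
    using nabla[OF z, of "conn z a" b] nabla[OF z, of "conn z b" a] sym[OF z, of "conn z a" "conn z b"]
      jacobi_sym[OF z, of a b]
    by (simp add: dd_jacobi[OF z] dd_EL(2)[OF z] dd_hor[OF z] inner_add_left inner_diff_left)
qed

lemma dd_EL_mixed: assumes z: "z \<in> Z"
  shows "\<DD> (\<lambda>y. \<DD> EL y (0, b)) z u \<bullet> a - \<DD> (\<lambda>y. \<DD> p y (a, 0)) z u \<bullet> b = \<DD> (\<omega> b a) z u"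
proof -
  have "(\<omega> b a has_derivative (\<lambda>u. \<DD> (\<lambda>y. \<DD> EL y (0, b)) z u \<bullet> a - \<DD> (\<lambda>y. \<DD> p y (a, 0)) z u \<bullet> b)) (at z)"
    by (rule has_derivative_transform_within_open[OF _ open_Z z EL_mixed])
      (intro has_derivative_diff has_derivative_inner_left
        smooth_on_has_derivative[OF smooth_on_dd[OF smooth_p] z]
        smooth_on_has_derivative[OF smooth_on_dd[OF smooth_EL] z])
  from dd_eqI[OF this] show ?thesis by simp
qed

text \<open>As a function of \<open>(c, b, a)\<close>, the vertical derivative of \<open>\<omega> b a\<close> in the direction \<open>c\<close> is symmetric in
  \<open>c, b\<close> and antisymmetric in \<open>b, a\<close>.\<close>

lemma dd_\<omega>_vertical: assumes z: "z \<in> Z" shows "\<DD> (\<omega> a b) z (0, c) = 0"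
proof -
  \<comment> \<open>By \<open>dd_EL_mixed\<close> there are two terms. The second vertical
    derivative of \<open>EL\<close> is symmetric by itself; in the other term the x-derivative is
    moved outside, which leaves g, symmetric by the first condition.\<close>
  have swap: "\<DD> (\<omega> b a) z (0, c) = \<DD> (\<omega> c a) z (0, b)" for a b c
    unfolding dd_EL_mixed[OF z, symmetric] dd_commute[OF open_Z smooth_p z, of _ "(0, _)"]
      dd_commute[OF open_Z smooth_EL z, of "(0, b)" "(0, c)"] dsym[OF z, of c _ b] ..
  have anti: "\<DD> (\<omega> a b) z u = - \<DD> (\<omega> b a) z u" for a b u
  proof -
    have "(\<omega> a b has_derivative (\<lambda>u. - \<DD> (\<omega> b a) z u)) (at z)"
      by (rule has_derivative_transform_within_open[OF has_derivative_minus[OF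
              smooth_on_has_derivative[OF smooth_\<omega> z]] open_Z z]) (simp add: \<omega>_def)
    from dd_eqI[OF this] show ?thesis by simp
  qed
  show ?thesis
    using swap[of a b c] swap[of c a b] swap[of b c a] anti[of a b] anti[of b c] anti[of c a] by simp
qed

text \<open>The fibre is a whole vector space, hence convex, so a vanishing vertical derivative
  makes \<omega> constant on it; the zero section serves as reference.\<close>

lemma \<omega>_basic: assumes x: "x \<in> V" shows "\<omega> a b (x, y) = \<omega> a b (x, 0)"
proof -
  have "((\<lambda>y. \<omega> a b (x, y)) has_derivative (\<lambda>u. 0)) (at y)" for y
    using smooth_on_partial(2)[OF smooth_\<omega>, of x y a b] x by (simp add: dd_\<omega>_vertical)
  then show ?thesis
    using has_derivative_zero_unique[of UNIV "\<lambda>y. \<omega> a b (x, y)" y 0] by auto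
qed

lemma dd_\<omega>_spray: assumes z: "z \<in> Z" shows "\<DD> (\<omega> a b) z (spray_vf z) = \<DD> (\<omega> a b) z (snd z, 0)"
  using smooth_on_dd_Pair[OF smooth_\<omega> z, of a b "snd z" "s z"] dd_\<omega>_vertical[OF z, of a b "s z"]
  by (simp add: spray_vf_def)

text \<open>The vertical derivative of \<open>EL_horizontal\<close> in the direction
  \<open>c\<close>. As \<omega> is basic, S(\<omega>) is linear in the fibre coordinate, so its
  vertical derivative is the x-derivative of \<omega> along \<open>c\<close>. On the other side
  \<open>EL_mixed\<close> turns the vertical derivative of \<open>EL\<close> into x-derivatives of
  \<open>p\<close>, which cancel, and the two remaining derivatives of \<omega>.\<close>

lemma \<omega>_closed: assumes z: "z \<in> Z"
  shows "\<DD> (\<omega> a b) z (c, 0) + \<DD> (\<omega> b c) z (a, 0) + \<DD> (\<omega> c a) z (b, 0) = 0"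
proof -
  have "((\<lambda>y. \<DD> (\<omega> a b) y (snd y, 0)) has_derivative
      (\<lambda>u. \<DD> (\<lambda>y. \<DD> EL y (a, 0)) z u \<bullet> b - \<DD> (\<lambda>y. \<DD> EL y (b, 0)) z u \<bullet> a)) (at z)"
    by (rule has_derivative_transform_within_open[where
          f="\<lambda>z. \<DD> EL z (a, 0) \<bullet> b - \<DD> EL z (b, 0) \<bullet> a", OF _ open_Z z])
      (intro has_derivative_diff has_derivative_inner_left
        smooth_on_has_derivative[OF smooth_on_dd[OF smooth_EL] z],
       simp add: EL_horizontal dd_\<omega>_spray)
  then have 1: "\<DD> (\<lambda>y. \<DD> (\<omega> a b) y (snd y, 0)) z (0, c)
      = \<DD> (\<lambda>y. \<DD> EL y (a, 0)) z (0, c) \<bullet> b - \<DD> (\<lambda>y. \<DD> EL y (b, 0)) z (0, c) \<bullet> a"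
    using dd_eqI by fastforce
  have "((\<lambda>y::'a \<times> 'a. (snd y, 0::'a)) has_derivative (\<lambda>u. (snd u, 0))) (at z)"
    by (auto intro!: derivative_eq_intros)
  then have "\<DD> (\<lambda>y::'a \<times> 'a. (snd y, 0::'a)) z = (\<lambda>u. (snd u, 0))" by (rule dd_eqI)
  moreover have "smooth_on (\<lambda>y::'a \<times> 'a. (snd y, 0::'a)) Z" by (intro smooth_intros open_Z)
  moreover have "\<DD> (\<lambda>y. \<DD> (\<omega> a b) y (0, c)) z u = 0" for u
    using fun_cong[OF dd_cong_open(1)[OF open_Z z, of "\<lambda>y. \<DD> (\<omega> a b) y (0, c)" "\<lambda>y. 0"]]
    by (simp add: dd_\<omega>_vertical)
  ultimately have 2: "\<DD> (\<lambda>y. \<DD> (\<omega> a b) y (snd y, 0)) z (0, c) = \<DD> (\<omega> a b) z (c, 0)"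
    by (subst dd_dd_field(2)[OF open_Z smooth_\<omega> _ z]) simp_all
  have anti: "\<DD> (\<omega> b c) z u = - \<DD> (\<omega> c b) z u" for u
  proof -
    have "(\<omega> b c has_derivative (\<lambda>u. - \<DD> (\<omega> c b) z u)) (at z)"
      by (rule has_derivative_transform_within_open[OF has_derivative_minus[OF
              smooth_on_has_derivative[OF smooth_\<omega> z]] open_Z z]) (simp add: \<omega>_def)
    from dd_eqI[OF this] show ?thesis by simp
  qed
  show ?thesis
    using 1[unfolded 2 dd_commute[OF open_Z smooth_EL z, of _ "(0, c)"]]
      dd_EL_mixed[OF z, of c "(a, 0)" b] dd_EL_mixed[OF z, of c "(b, 0)" a] anti[of "(a, 0)"]
      dd_commute[OF open_Z smooth_p z, of "(a, 0)" "(b, 0)"]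
    by simp
qed

lemma \<omega>_linear: assumes z: "z \<in> Z" shows "linear (\<lambda>a. \<omega> a b z)" "linear (\<lambda>b. \<omega> a b z)"
proof -
  have h: "linear (\<lambda>a. hor a z)"
    using linear_conn[OF z] smooth_on_dd_add[OF smooth_p z, of "(_, conn z _)" "(_, conn z _)"]
      smooth_on_dd_scaleR[OF smooth_p z, of _ "(_, conn z _)"]
    by (intro linearI) (simp_all add: hor_def linear_add linear_scale)
  show "linear (\<lambda>a. \<omega> a b z)" "linear (\<lambda>b. \<omega> a b z)"
    by (intro linearI; simp add: \<omega>_def linear_add[OF h] linear_scale[OF h] algebra_simps inner_add_left inner_add_right)+
qed

lemma \<omega>_potential:
  assumes H: "smooth_contraction H V x0"
  obtains \<beta> where "smooth_on \<beta> V"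
    "\<And>z a b. z \<in> Z \<Longrightarrow> \<DD> \<beta> (fst z) a \<bullet> b - \<DD> \<beta> (fst z) b \<bullet> a = \<omega> b a z"
proof -
  \<comment> \<open>\<open>E i j\<close> is the elementary operator sending x to (x \<bullet> i) j;
    with these \<Omega> becomes the matrix of \<omega> along the zero section, with the arguments
    exchanged. This exchange accounts for the sign in \<omega> = -d\<beta>.\<close>
  define E :: "'a \<Rightarrow> 'a \<Rightarrow> 'a \<Rightarrow>\<^sub>L 'a" where "E = (\<lambda>i j. blinfun_scaleR_left j o\<^sub>L blinfun_inner_left i)"
  define \<Omega> where "\<Omega> = (\<lambda>x. \<Sum>i\<in>Basis. \<Sum>j\<in>Basis. \<omega> j i (x, 0) *\<^sub>R E i j)"
  have \<omega>0: "smooth_on (\<lambda>x. \<omega> a b (x, 0)) V" for a b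
    by (rule smooth_on_compose[OF open_V _ smooth_\<omega>]) (auto intro!: smooth_intros open_V)
  have \<omega>0_dd: "\<DD> (\<lambda>x. \<omega> a b (x, 0)) x v = \<DD> (\<omega> a b) (x, 0) (v, 0)" if "x \<in> V" for x v a b
    using dd_eqI[OF smooth_on_partial(1)[OF smooth_\<omega>, of x 0 a b]] that by simp
  have \<Omega>: "smooth_on \<Omega> V"
    unfolding \<Omega>_def by (intro smooth_on_sum smooth_on_scaleR open_V \<omega>0 smooth_on_const)
  have \<Omega>_app: "\<Omega> x a \<bullet> b = \<omega> b a (x, 0)" if x: "x \<in> V" for x a b
  proof -
    have "\<Omega> x a \<bullet> b = (\<Sum>i\<in>Basis. \<Sum>j\<in>Basis. (a \<bullet> i) * (b \<bullet> j) * \<omega> j i (x, 0))"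
      by (simp add: \<Omega>_def E_def blinfun.sum_left blinfun.scaleR_left inner_sum_left inner_sum_right inner_commute mult_ac)
    also have "\<dots> = \<omega> b a (x, 0)"
      using bilinear_form_sum_Basis[of "\<lambda>a b. \<omega> b a (x, 0)" a b] \<omega>_linear[of "(x, 0)"] x by simp
    finally show ?thesis .
  qed
  have \<Omega>_dd: "\<DD> \<Omega> x v a \<bullet> b = \<DD> (\<omega> b a) (x, 0) (v, 0)" if x: "x \<in> V" for x v a b
  proof -
    have "((\<lambda>x. \<Omega> x a \<bullet> b) has_derivative (\<lambda>v. \<DD> \<Omega> x v a \<bullet> b)) (at x)"
      by (rule bounded_linear.has_derivative[OF bounded_linear_inner_left],
          rule bounded_linear.has_derivative[OF blinfun.bounded_linear_left],
          rule smooth_on_has_derivative[OF \<Omega> x])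
    then have "((\<lambda>x. \<omega> b a (x, 0)) has_derivative (\<lambda>v. \<DD> \<Omega> x v a \<bullet> b)) (at x)"
      by (rule has_derivative_transform_within_open[OF _ open_V x]) (rule \<Omega>_app)
    from fun_cong[OF dd_eqI[OF this], of v] show ?thesis using \<omega>0_dd[OF x] by simp
  qed
  obtain \<beta> where \<beta>: "smooth_on \<beta> V" "\<And>x a b. x \<in> V \<Longrightarrow> \<DD> \<beta> x a \<bullet> b - \<DD> \<beta> x b \<bullet> a = \<Omega> x a \<bullet> b"
  proof (rule poincare_2_form[OF open_V H \<Omega>])
    show "\<Omega> x a \<bullet> b = - (\<Omega> x b \<bullet> a)" if "x \<in> V" for x a b
      using that by (simp add: \<Omega>_app \<omega>_def)
    show "\<DD> \<Omega> x a b \<bullet> c + \<DD> \<Omega> x b c \<bullet> a + \<DD> \<Omega> x c a \<bullet> b = 0" if "x \<in> V" for x a b c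
      using \<omega>_closed[of "(x, 0)" c b a] that by (simp add: \<Omega>_dd)
  qed blast
  show thesis
  proof (rule that[OF \<beta>(1)])
    fix z a b assume "z \<in> Z"
    then show "\<DD> \<beta> (fst z) a \<bullet> b - \<DD> \<beta> (fst z) b \<bullet> a = \<omega> b a z"
      using \<beta>(2) \<Omega>_app \<omega>_basic[of "fst z" b a "snd z"] by auto
  qed
qed

lemma lagrangian_exists:
  assumes H: "smooth_contraction H V x0"
  obtains l where "smooth_on l Z" "euler_lagrange l"
    "\<And>z a b. z \<in> Z \<Longrightarrow> \<DD> (\<lambda>y. \<DD> l y (0, a)) z (0, b) = \<DD> p z (0, b) \<bullet> a"
proof -
  obtain \<beta> where \<beta>: "smooth_on \<beta> V"
    and \<beta>\<omega>: "\<And>z a b. z \<in> Z \<Longrightarrow> \<DD> \<beta> (fst z) a \<bullet> b - \<DD> \<beta> (fst z) b \<bullet> a = \<omega> b a z"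
    using \<omega>_potential[OF H] by blast
  define \<beta>' where "\<beta>' = (\<lambda>z::'a \<times> 'a. \<beta> (fst z))"
  have \<beta>': "smooth_on \<beta>' Z"
    unfolding \<beta>'_def by (rule smooth_on_compose[OF open_Z _ \<beta>]) (auto intro: smooth_intros open_Z)
  have \<beta>'_dd: "\<DD> \<beta>' z u = \<DD> \<beta> (fst z) (fst u)" if z: "z \<in> Z" for z u
  proof -
    have "fst z \<in> V" using z by auto
    then have "(\<beta>' has_derivative (\<lambda>u. \<DD> \<beta> (fst z) (fst u))) (at z)"
      unfolding \<beta>'_def
      by (intro has_derivative_compose[OF has_derivative_fst[OF has_derivative_ident]]
          smooth_on_has_derivative[OF \<beta>])
    from dd_eqI[OF this] show ?thesis by simp
  qed
  have yfield: "\<DD> (\<lambda>y::'a \<times> 'a. (snd y, 0::'a)) z = (\<lambda>u. (snd u, 0))" for z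
    by (rule dd_eqI) (auto intro!: derivative_eq_intros)
  have sm_yfield: "smooth_on (\<lambda>y::'a \<times> 'a. (snd y, 0::'a)) Z" by (intro smooth_intros open_Z)
  \<comment> \<open>The components of the Lie derivative of \<theta> + \<beta> along the spray: S(p
    + \<beta>) on dx and p + \<beta> on dy. As \<beta> lives on the base, S(\<beta>) involves only
    the velocity \<open>snd z\<close>.\<close>
  define q where "q = (\<lambda>z. (EL z + \<DD> \<beta>' z (snd z, 0), p z + \<beta>' z))"
  have sm1: "smooth_on (\<lambda>z. \<DD> \<beta>' z (snd z, 0)) Z"
    by (rule smooth_on_dd_field[OF open_Z \<beta>' sm_yfield])
  have q: "smooth_on q Z"
    unfolding q_def by (intro smooth_on_Pair smooth_on_add open_Z smooth_EL smooth_p \<beta>' sm1)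
  have q_dd: "\<DD> q z u = (\<DD> EL z u + (\<DD> (\<lambda>y. \<DD> \<beta>' y u) z (snd z, 0) + \<DD> \<beta>' z (snd u, 0)),
      \<DD> p z u + \<DD> \<beta>' z u)" if z: "z \<in> Z" for z u
  proof -
    have "(q has_derivative (\<lambda>u. (\<DD> EL z u + \<DD> (\<lambda>z. \<DD> \<beta>' z (snd z, 0)) z u, \<DD> p z u + \<DD> \<beta>' z u))) (at z)"
      unfolding q_def
      by (intro has_derivative_Pair has_derivative_add smooth_on_has_derivative[OF smooth_EL z]
          smooth_on_has_derivative[OF smooth_p z] smooth_on_has_derivative[OF \<beta>' z]
          smooth_on_has_derivative[OF sm1 z])
    from fun_cong[OF dd_eqI[OF this], of u] show ?thesis
      by (simp add: dd_dd_field(2)[OF open_Z \<beta>' sm_yfield z] yfield)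
  qed
  have \<beta>'\<omega>: "\<DD> \<beta>' z (a, 0) \<bullet> b - \<DD> \<beta>' z (b, 0) \<bullet> a = \<omega> b a z" if "z \<in> Z" for z a b
    using \<beta>\<omega>[OF that] by (simp add: \<beta>'_dd[OF that])
  have \<beta>'\<omega>_dd: "\<DD> (\<lambda>y. \<DD> \<beta>' y (a, 0)) z u \<bullet> b - \<DD> (\<lambda>y. \<DD> \<beta>' y (b, 0)) z u \<bullet> a = \<DD> (\<omega> b a) z u"
    if z: "z \<in> Z" for z a b u
  proof -
    have "(\<omega> b a has_derivative
        (\<lambda>u. \<DD> (\<lambda>y. \<DD> \<beta>' y (a, 0)) z u \<bullet> b - \<DD> (\<lambda>y. \<DD> \<beta>' y (b, 0)) z u \<bullet> a)) (at z)"
      by (rule has_derivative_transform_within_open[OF _ open_Z z \<beta>'\<omega>])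
        (intro has_derivative_diff has_derivative_inner_left
          smooth_on_has_derivative[OF smooth_on_dd[OF \<beta>'] z])
    from dd_eqI[OF this] show ?thesis by simp
  qed
  have \<beta>'_vert: "\<DD> \<beta>' z (0, b) = 0" if z: "z \<in> Z" for z b
    using linear_0[OF smooth_on_linear_dd[OF \<beta>, of "fst z"]] z by (auto simp: \<beta>'_dd)
  have \<beta>'_vert_dd: "\<DD> (\<lambda>y. \<DD> \<beta>' y (0, b)) z u = 0" if z: "z \<in> Z" for z b u
    using fun_cong[OF dd_cong_open(1)[OF open_Z z, of "\<lambda>y. \<DD> \<beta>' y (0, b)" "\<lambda>y. 0"]]
    by (simp add: \<beta>'_vert)
  \<comment> \<open>Componentwise: on dx-dx, S(\<omega>) is cancelled by S(d\<beta>); on dx-dy,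
    \<omega> is cancelled by d\<beta>; on dy-dy, closedness is the symmetry of g.\<close>
  have closed: "\<DD> q z u \<bullet> v = \<DD> q z v \<bullet> u" if z: "z \<in> Z" for z u v
  proof -
    obtain a b a' b' where uv: "u = (a, b)" "v = (a', b')" by fastforce
    have split: "\<DD> EL z (a, b) = \<DD> EL z (a, 0) + \<DD> EL z (0, b)" "\<DD> p z (a, b) = \<DD> p z (a, 0) + \<DD> p z (0, b)"
      "\<DD> \<beta>' z (a, b) = \<DD> \<beta>' z (a, 0)"
      "\<DD> (\<lambda>y. \<DD> \<beta>' y (a, b)) z w = \<DD> (\<lambda>y. \<DD> \<beta>' y (a, 0)) z w" for a b w
    proof -
      show "\<DD> EL z (a, b) = \<DD> EL z (a, 0) + \<DD> EL z (0, b)" by (rule smooth_on_dd_Pair[OF smooth_EL z])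
      show "\<DD> p z (a, b) = \<DD> p z (a, 0) + \<DD> p z (0, b)" by (rule smooth_on_dd_Pair[OF smooth_p z])
      show "\<DD> \<beta>' z (a, b) = \<DD> \<beta>' z (a, 0)" by (simp add: \<beta>'_dd[OF z])
      show "\<DD> (\<lambda>y. \<DD> \<beta>' y (a, b)) z w = \<DD> (\<lambda>y. \<DD> \<beta>' y (a, 0)) z w"
        by (rule fun_cong[OF dd_cong_open(1)[OF open_Z z]]) (simp add: \<beta>'_dd)
    qed
    have anti: "\<omega> a b z = - \<omega> b a z" for a b by (simp add: \<omega>_def)
    have \<omega>_dd_anti: "\<DD> (\<omega> a' a) z (snd z, 0) + \<DD> (\<omega> a a') z (snd z, 0) = 0"
      using \<omega>_closed[OF z] \<beta>'\<omega>_dd[OF z, of a "(snd z, 0)" a'] \<beta>'\<omega>_dd[OF z, of a' "(snd z, 0)" a] by simp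
    show ?thesis
      unfolding uv q_dd[OF z] split[of a b] split[of a' b']
      using EL_horizontal[OF z, of a a', unfolded dd_\<omega>_spray[OF z]] \<beta>'\<omega>_dd[OF z, of a "(snd z, 0)" a'] \<omega>_dd_anti
        EL_mixed[OF z, of b a'] EL_mixed[OF z, of b' a] \<beta>'\<omega>[OF z, of b a'] \<beta>'\<omega>[OF z, of b' a]
        anti[of b a'] anti[of b' a] sym[OF z, of b b']
      by (simp add: inner_add_left)
  qed
  \<comment> \<open>The dy-part of dl = q says that p + \<beta> is the fibre derivative of
    \<open>l\<close>; the dx-part is then the Euler-Lagrange equation.\<close>
  obtain l where l: "smooth_on l Z" "\<And>z u. z \<in> Z \<Longrightarrow> \<DD> l z u = q z \<bullet> u"
    using poincare_1_form[OF open_Z smooth_contraction_Times[OF open_V H] q closed] by blast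
  have l_dd: "\<DD> (\<lambda>y. \<DD> l y (0, a)) z u = \<DD> p z u \<bullet> a + \<DD> \<beta>' z u \<bullet> a" if z: "z \<in> Z" for z a u
  proof -
    have "((\<lambda>y. \<DD> l y (0, a)) has_derivative (\<lambda>u. \<DD> p z u \<bullet> a + \<DD> \<beta>' z u \<bullet> a)) (at z)"
      by (rule has_derivative_transform_within_open[where f="\<lambda>y. p y \<bullet> a + \<beta>' y \<bullet> a", OF _ open_Z z])
        (intro has_derivative_add has_derivative_inner_left smooth_on_has_derivative[OF smooth_p z]
          smooth_on_has_derivative[OF \<beta>' z],
         simp add: l(2) q_def inner_add_left)
    from dd_eqI[OF this] show ?thesis by simp
  qed
  show thesis
  proof (rule that[OF l(1)])
    show "euler_lagrange l"
      unfolding euler_lagrange_def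
    proof (intro ballI allI)
      fix z a assume z: "z \<in> Z"
      have "\<DD> \<beta>' z (spray_vf z) = \<DD> \<beta>' z (snd z, 0)" by (simp add: \<beta>'_dd[OF z] spray_vf_def)
      then show "\<DD> (\<lambda>y. \<DD> l y (0, a)) z (spray_vf z) = \<DD> l z (a, 0)"
        by (simp add: l_dd[OF z] l(2)[OF z] q_def EL_def inner_add_left)
    qed
    show "\<DD> (\<lambda>y. \<DD> l y (0, a)) z (0, b) = \<DD> p z (0, b) \<bullet> a" if z: "z \<in> Z" for z a b
      by (simp add: l_dd[OF z] \<beta>'_vert[OF z])
  qed
qed

end

section \<open>Vector fields and forms on a chart domain\<close>

lemma tangent_spaceD:
  assumes "\<xi> \<in> tangent_space B p"
  shows "c \<in> B \<Longrightarrow> d \<in> B \<Longrightarrow> p \<in> chart_dom c \<Longrightarrow> p \<in> chart_dom d \<Longrightarrow>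
      \<xi> d = \<DD> (transition c d) (chart_map c p) (\<xi> c)"
    and "\<not> (d \<in> B \<and> p \<in> chart_dom d) \<Longrightarrow> \<xi> d = 0"
  using assms unfolding tangent_space_def by blast+

text \<open>Only these consequences of \<open>smooth_manifold\<close> are kept, so that the induced
  atlas of the tangent bundle, which need not be maximal, is an instance as well.\<close>

locale smooth_atlas =
  fixes B :: "('p, 'e::euclidean_space) chart set"
  assumes inj_chart: "c \<in> B \<Longrightarrow> inj_on (chart_map c) (chart_dom c)"
    and open_overlap: "c \<in> B \<Longrightarrow> d \<in> B \<Longrightarrow> open (chart_map c ` (chart_dom c \<inter> chart_dom d))"
    and smooth_transition:
      "c \<in> B \<Longrightarrow> d \<in> B \<Longrightarrow> smooth_on (transition c d) (chart_map c ` (chart_dom c \<inter> chart_dom d))"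
begin

lemma chart_inv_map [simp]: "c \<in> B \<Longrightarrow> p \<in> chart_dom c \<Longrightarrow> chart_inv c (chart_map c p) = p"
  by (simp add: chart_inv_def inj_chart)

lemma transition_map [simp]:
  "c \<in> B \<Longrightarrow> p \<in> chart_dom c \<Longrightarrow> transition c d (chart_map c p) = chart_map d p"
  by (simp add: transition_def)

lemma dd_transition_self:
  assumes "c \<in> B" "p \<in> chart_dom c"
  shows "\<DD> (transition c c) (chart_map c p) v = v"
proof -
  have "(transition c c has_derivative (\<lambda>v. v)) (at (chart_map c p))"
    by (rule has_derivative_transform_within_open[OF has_derivative_ident open_overlap[OF assms(1,1)]])
      (use assms in auto)
  from dd_eqI[OF this] show ?thesis by simp
qed

lemma has_derivative_transition:
  assumes "c \<in> B" "d \<in> B" "p \<in> chart_dom c" "p \<in> chart_dom d"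
  shows "(transition c d has_derivative \<DD> (transition c d) (chart_map c p)) (at (chart_map c p))"
  by (rule smooth_on_has_derivative[OF smooth_transition]) (use assms in auto)

lemma linear_dd_transition:
  assumes "c \<in> B" "d \<in> B" "p \<in> chart_dom c" "p \<in> chart_dom d"
  shows "linear (\<DD> (transition c d) (chart_map c p))"
  using has_derivative_bounded_linear[OF has_derivative_transition[OF assms]] bounded_linear.linear by blast

lemma dd_transition_trans:
  assumes "c \<in> B" "d \<in> B" "e \<in> B" "p \<in> chart_dom c" "p \<in> chart_dom d" "p \<in> chart_dom e"
  shows "\<DD> (transition d e) (chart_map d p) (\<DD> (transition c d) (chart_map c p) v)
    = \<DD> (transition c e) (chart_map c p) v"
proof -
  have "((\<lambda>z. transition d e (transition c d z)) has_derivative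
      (\<lambda>v. \<DD> (transition d e) (chart_map d p) (\<DD> (transition c d) (chart_map c p) v))) (at (chart_map c p))"
    by (rule has_derivative_compose[OF has_derivative_transition])
      (use assms has_derivative_transition[of d e p] in auto)
  then have "(transition c e has_derivative
      (\<lambda>v. \<DD> (transition d e) (chart_map d p) (\<DD> (transition c d) (chart_map c p) v))) (at (chart_map c p))"
    by (rule has_derivative_transform_within_open[OF _ open_overlap[of c d]]) (use assms in auto)
  from dd_eqI[OF this] show ?thesis by simp
qed

text \<open>Inverse to reading off the coordinate vector in the chart \<open>c\<close>; the zero
  branch matches the normalisation built into \<open>tangent_space\<close>.\<close>

definition tangent_lift :: "('p, 'e) chart \<Rightarrow> 'p \<Rightarrow> 'e \<Rightarrow> ('p, 'e) chart \<Rightarrow> 'e" where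
  "tangent_lift c p v d = (if d \<in> B \<and> p \<in> chart_dom d then \<DD> (transition c d) (chart_map c p) v else 0)"

lemma tangent_lift_in: "c \<in> B \<Longrightarrow> p \<in> chart_dom c \<Longrightarrow> tangent_lift c p v \<in> tangent_space B p"
  by (auto simp: tangent_space_def tangent_lift_def dd_transition_trans)

lemma tangent_lift_self [simp]: "c \<in> B \<Longrightarrow> p \<in> chart_dom c \<Longrightarrow> tangent_lift c p v c = v"
  by (simp add: tangent_lift_def dd_transition_self)

lemma tangent_space_eq_lift:
  assumes "c \<in> B" "p \<in> chart_dom c" "\<xi> \<in> tangent_space B p"
  shows "\<xi> = tangent_lift c p (\<xi> c)"
proof
  fix d
  show "\<xi> d = tangent_lift c p (\<xi> c) d"
    using tangent_spaceD[OF assms(3)] assms(1,2) unfolding tangent_lift_def by metis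
qed

end

section \<open>Functions, vector fields and 1-forms read in a single chart\<close>

locale atlas_chart = smooth_atlas B for B :: "('p, 'e::euclidean_space) chart set" +
  fixes c :: "('p, 'e) chart"
  assumes c_in: "c \<in> B"
begin

abbreviation "W \<equiv> chart_dom c"
abbreviation "\<phi> \<equiv> chart_map c"
abbreviation "Z \<equiv> \<phi> ` W"

lemma open_Z: "open Z"
  using open_overlap[OF c_in c_in] by simp

lemma \<phi>_inv: "z \<in> Z \<Longrightarrow> \<phi> (chart_inv c z) = z"
  using c_in by auto

lemma smooth_on_chart:
  assumes d: "d \<in> B" and F: "smooth_on F Z"
  shows "smooth_on (\<lambda>w. F (transition d c w)) (chart_map d ` (chart_dom d \<inter> W))"
  by (rule smooth_on_compose[OF open_overlap[OF d c_in] smooth_transition[OF d c_in] F]) (use d in auto)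

lemma smooth_funs_iff: "f \<in> smooth_funs B W \<longleftrightarrow> smooth_on (f \<circ> chart_inv c) Z"
proof
  assume "f \<in> smooth_funs B W"
  then show "smooth_on (f \<circ> chart_inv c) Z"
    using c_in unfolding smooth_funs_def by (metis (mono_tags, lifting) Int_absorb mem_Collect_eq)
next
  assume f: "smooth_on (f \<circ> chart_inv c) Z"
  have "smooth_on (f \<circ> chart_inv d) (chart_map d ` (chart_dom d \<inter> W))" if d: "d \<in> B" for d
    by (rule smooth_on_cong[OF open_overlap[OF d c_in] smooth_on_chart[OF d f]]) (use d c_in in auto)
  then show "f \<in> smooth_funs B W" by (simp add: smooth_funs_def)
qed

definition hat :: "('p, 'e) vfield \<Rightarrow> 'e \<Rightarrow> 'e" where
  "hat X z = X (chart_inv c z) c"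

lemma hat_\<phi> [simp]: "u \<in> W \<Longrightarrow> hat X (\<phi> u) = X u c"
  using c_in by (simp add: hat_def)

lemma smooth_hat: "X \<in> vfields B W \<Longrightarrow> smooth_on (hat X) Z"
  using c_in unfolding vfields_def hat_def by (metis (mono_tags, lifting) Int_absorb mem_Collect_eq)

lemma vfield_eq_lift:
  assumes "X \<in> vfields B W" "u \<in> W"
  shows "X u = tangent_lift c u (X u c)"
  using tangent_space_eq_lift[OF c_in assms(2)] assms by (simp add: vfields_def)

lemma vfield_transition:
  assumes "X \<in> vfields B W" "u \<in> W" "d \<in> B" "u \<in> chart_dom d"
  shows "X u d = \<DD> (transition c d) (\<phi> u) (X u c)"
  using fun_cong[OF vfield_eq_lift[OF assms(1,2)], of d] assms by (simp add: tangent_lift_def)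

lemma vfield_zero:
  "X \<in> vfields B W \<Longrightarrow> \<not> (u \<in> W \<and> d \<in> B \<and> u \<in> chart_dom d) \<Longrightarrow> X u d = 0"
  using tangent_spaceD(2)[of "X u" B u d] by (cases "u \<in> W") (simp_all add: vfields_def)

text \<open>Smoothness is tested in the chart \<open>c\<close> alone: in any other chart the field
  is a smooth transition derivative applied to its representative in \<open>c\<close>.\<close>

lemma vfieldsI:
  assumes sm: "smooth_on (hat X) Z"
    and tr: "\<And>u d. u \<in> W \<Longrightarrow> d \<in> B \<Longrightarrow> u \<in> chart_dom d \<Longrightarrow> X u d = \<DD> (transition c d) (\<phi> u) (X u c)"
    and zero: "\<And>u d. \<not> (u \<in> W \<and> d \<in> B \<and> u \<in> chart_dom d) \<Longrightarrow> X u d = 0"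
  shows "X \<in> vfields B W"
proof -
  have "X u = tangent_lift c u (X u c)" if "u \<in> W" for u
    using tr[OF that] zero by (auto simp: tangent_lift_def fun_eq_iff)
  then have "X u \<in> tangent_space B u" if "u \<in> W" for u
    using tangent_lift_in[OF c_in that] that by metis
  moreover have "smooth_on (\<lambda>w. X (chart_inv d w) d) (chart_map d ` (chart_dom d \<inter> W))" if d: "d \<in> B" for d
  proof -
    have "smooth_on (\<lambda>w. \<DD> (transition c d) (transition d c w) (hat X (transition d c w)))
        (chart_map d ` (chart_dom d \<inter> W))"
    proof (rule smooth_on_compose[where f="\<lambda>z. \<DD> (transition c d) z (hat X z)"
          and T="\<phi> ` (W \<inter> chart_dom d)"])
      show "smooth_on (\<lambda>z. \<DD> (transition c d) z (hat X z)) (\<phi> ` (W \<inter> chart_dom d))"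
        by (intro smooth_on_dd_field open_overlap smooth_transition c_in d smooth_on_subset[OF sm]) auto
    qed (use d c_in open_overlap smooth_transition in auto)
    then show ?thesis
    proof (rule smooth_on_cong[OF open_overlap[OF d c_in]])
      fix w assume "w \<in> chart_map d ` (chart_dom d \<inter> W)"
      then obtain u where "u \<in> chart_dom d" "u \<in> W" "w = chart_map d u" by blast
      then show "\<DD> (transition c d) (transition d c w) (hat X (transition d c w)) = X (chart_inv d w) d"
        using d c_in tr[of u d] by simp
    qed
  qed
  ultimately show ?thesis using zero by (auto simp: vfields_def fun_eq_iff)
qed

definition lift :: "('e \<Rightarrow> 'e) \<Rightarrow> ('p, 'e) vfield" where
  "lift F u = (if u \<in> W then tangent_lift c u (F (\<phi> u)) else (\<lambda>_. 0))"

lemma lift_at [simp]: "u \<in> W \<Longrightarrow> lift F u c = F (\<phi> u)"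
  using c_in by (simp add: lift_def)

lemma lift_in: assumes "smooth_on F Z" shows "lift F \<in> vfields B W"
proof (rule vfieldsI)
  show "smooth_on (hat (lift F)) Z"
    by (rule smooth_on_cong[OF open_Z assms]) auto
qed (use c_in in \<open>auto simp: lift_def tangent_lift_def dd_transition_self\<close>)

lemma coord_vfield_eq_lift: "coord_vfield B W c e = lift (\<lambda>_. e)"
  by (auto simp: coord_vfield_def lift_def tangent_lift_def fun_eq_iff)

lemma vfield_add:
  assumes "X \<in> vfields B W" "Y \<in> vfields B W" "f \<in> smooth_funs B W" "g \<in> smooth_funs B W"
  shows "(\<lambda>u d. f u *\<^sub>R X u d + g u *\<^sub>R Y u d) \<in> vfields B W"
proof (rule vfieldsI)
  have "smooth_on (\<lambda>z. (f \<circ> chart_inv c) z *\<^sub>R hat X z + (g \<circ> chart_inv c) z *\<^sub>R hat Y z) Z"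
    using assms by (intro smooth_on_add smooth_on_scaleR open_Z) (auto simp: smooth_funs_iff smooth_hat o_def)
  then show "smooth_on (hat (\<lambda>u d. f u *\<^sub>R X u d + g u *\<^sub>R Y u d)) Z"
    by (simp add: hat_def[abs_def])
qed (use assms linear_dd_transition[OF c_in] in
    \<open>auto simp: vfield_transition vfield_zero linear_add linear_scale\<close>)

lemma const_smooth_fun: "(\<lambda>_. r) \<in> smooth_funs B W"
  by (simp add: smooth_funs_iff o_def)

lemma vfield_lincomb:
  assumes "X \<in> vfields B W" "Y \<in> vfields B W"
  shows "(\<lambda>u d. X u d + Y u d) \<in> vfields B W" "(\<lambda>u d. X u d - Y u d) \<in> vfields B W"
    "(\<lambda>u d. r *\<^sub>R X u d) \<in> vfields B W"
  using vfield_add[OF assms const_smooth_fun const_smooth_fun, of 1 1]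
    vfield_add[OF assms const_smooth_fun const_smooth_fun, of 1 "-1"]
    vfield_add[OF assms const_smooth_fun const_smooth_fun, of r 0] by simp_all

text \<open>\<open>vf_apply\<close> works in an unspecified chart around the point; the chain rule
  carries the result to \<open>c\<close>. Any function \<open>F\<close> that represents
  \<open>f\<close> on \<open>W\<close> may be used, whatever its values outside the chart
  image.\<close>

lemma vf_apply_eq:
  assumes X: "X \<in> vfields B W" and u: "u \<in> W" and F: "(F has_derivative F') (at (\<phi> u))"
    and f: "\<And>q. q \<in> W \<Longrightarrow> f q = F (\<phi> q)"
  shows "vf_apply B X f u = F' (X u c)"
proof -
  define d where "d = (SOME d. d \<in> B \<and> u \<in> chart_dom d)"
  have d: "d \<in> B" "u \<in> chart_dom d"
    using someI[of "\<lambda>d. d \<in> B \<and> u \<in> chart_dom d" c] c_in u unfolding d_def by blast+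
  have "((\<lambda>w. F (transition d c w)) has_derivative (\<lambda>v. F' (\<DD> (transition d c) (chart_map d u) v)))
      (at (chart_map d u))"
    by (rule has_derivative_compose[OF has_derivative_transition]) (use d c_in u F in auto)
  then have "((f \<circ> chart_inv d) has_derivative (\<lambda>v. F' (\<DD> (transition d c) (chart_map d u) v)))
      (at (chart_map d u))"
    by (rule has_derivative_transform_within_open[OF _ open_overlap[OF d(1) c_in]])
      (use d u f in auto)
  moreover have "X u c = \<DD> (transition d c) (chart_map d u) (X u d)"
    using tangent_spaceD(1)[of "X u" B u d c] X u d c_in by (simp add: vfields_def)
  ultimately show ?thesis
    unfolding vf_apply_def d_def[symmetric] Let_def using dd_eqI by metis
qed

lemma vf_apply_smooth:
  assumes "X \<in> vfields B W" "u \<in> W" "smooth_on F Z" "\<And>q. q \<in> W \<Longrightarrow> f q = F (\<phi> q)"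
  shows "vf_apply B X f u = \<DD> F (\<phi> u) (X u c)"
  using vf_apply_eq[OF assms(1,2) smooth_on_has_derivative[OF assms(3)] assms(4)] assms(2) by blast

lemma vf_apply_zero:
  assumes "X \<in> vfields B W" "u \<in> W" "\<And>q. q \<in> W \<Longrightarrow> f q = 0"
  shows "vf_apply B X f u = 0"
  using vf_apply_eq[OF assms(1,2) has_derivative_const assms(3)] .

lemma lie_bracket_at:
  "u \<in> W \<Longrightarrow> lie_bracket B W X Y u c = \<DD> (hat Y) (\<phi> u) (X u c) - \<DD> (hat X) (\<phi> u) (Y u c)"
  using c_in by (simp add: lie_bracket_def hat_def[abs_def])

lemma hat_lie_bracket:
  "z \<in> Z \<Longrightarrow> hat (lie_bracket B W X Y) z = \<DD> (hat Y) z (hat X z) - \<DD> (hat X) z (hat Y z)"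
  by (auto simp: lie_bracket_at)

text \<open>The definition computes the bracket separately in each chart. Under a change of chart
  each of its two terms acquires the second derivative of the transition map, evaluated on both
  fields; by symmetry these contributions cancel.\<close>

lemma lie_bracket_in:
  assumes X: "X \<in> vfields B W" and Y: "Y \<in> vfields B W"
  shows "lie_bracket B W X Y \<in> vfields B W"
proof (rule vfieldsI)
  show "smooth_on (hat (lie_bracket B W X Y)) Z"
    by (rule smooth_on_cong[OF open_Z, where f="\<lambda>z. \<DD> (hat Y) z (hat X z) - \<DD> (hat X) z (hat Y z)"])
      (use X Y in \<open>auto intro!: smooth_intros open_Z smooth_hat simp: lie_bracket_at\<close>)
next
  fix u d assume u: "u \<in> W" and d: "d \<in> B" "u \<in> chart_dom d"
  let ?O = "\<phi> ` (W \<inter> chart_dom d)" and ?\<tau> = "transition c d" and ?z = "\<phi> u"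
  have O: "open ?O" "smooth_on ?\<tau> ?O" "?z \<in> ?O"
    using open_overlap smooth_transition c_in d u by auto
  have key: "\<DD> (\<lambda>w. Y (chart_inv d w) d) (chart_map d u) (\<DD> ?\<tau> ?z a)
      = \<DD> (\<lambda>y. \<DD> ?\<tau> y a) ?z (Y u c) + \<DD> ?\<tau> ?z (\<DD> (hat Y) ?z a)"
    if Y: "Y \<in> vfields B W" for Y a
  proof -
    have "smooth_on (\<lambda>w. Y (chart_inv d w) d) (chart_map d ` (chart_dom d \<inter> W))"
      using Y d by (simp add: vfields_def)
    then have "((\<lambda>w. Y (chart_inv d w) d) has_derivative \<DD> (\<lambda>w. Y (chart_inv d w) d) (chart_map d u))
        (at (chart_map d u))"
      by (rule smooth_on_has_derivative) (use d u in auto)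
    then have "((\<lambda>z. Y (chart_inv d (?\<tau> z)) d) has_derivative
        (\<lambda>a. \<DD> (\<lambda>w. Y (chart_inv d w) d) (chart_map d u) (\<DD> ?\<tau> ?z a))) (at ?z)"
      using has_derivative_compose[OF has_derivative_transition[OF c_in d(1) u d(2)],
          of "\<lambda>w. Y (chart_inv d w) d"] c_in u by simp
    then have "((\<lambda>z. \<DD> ?\<tau> z (hat Y z)) has_derivative
        (\<lambda>a. \<DD> (\<lambda>w. Y (chart_inv d w) d) (chart_map d u) (\<DD> ?\<tau> ?z a))) (at ?z)"
    proof (rule has_derivative_transform_within_open[OF _ O(1,3)])
      fix z assume "z \<in> ?O"
      then obtain q where "q \<in> W" "q \<in> chart_dom d" "z = \<phi> q" by blast
      then show "Y (chart_inv d (?\<tau> z)) d = \<DD> ?\<tau> z (hat Y z)"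
        using d c_in vfield_transition[OF Y, of q d] by simp
    qed
    from fun_cong[OF dd_eqI[OF this], of a]
    show ?thesis
      using dd_dd_field(2)[OF O(1,2) smooth_on_subset[OF smooth_hat[OF Y]] O(3), of a] u by auto
  qed
  show "lie_bracket B W X Y u d = \<DD> ?\<tau> ?z (lie_bracket B W X Y u c)"
    using key[OF X, of "Y u c"] key[OF Y, of "X u c"] dd_commute[OF O(1,2,3), of "X u c" "Y u c"]
      vfield_transition[OF X u d] vfield_transition[OF Y u d]
      linear_diff[OF linear_dd_transition[OF c_in d(1) u d(2)]] u d
    by (simp add: lie_bracket_at[OF u] lie_bracket_def[of _ _ _ _ u d])
qed (auto simp: lie_bracket_def)

text \<open>On \<open>W\<close> a field is a combination of the coordinate fields with smooth
  coefficients, so linearity over smooth functions makes the value of \<theta> pointwise. As forms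
  are linear in combinations of two fields only, the sum is built up over finite subsets of the
  basis.\<close>

lemma form_1_coefficients:
  assumes \<theta>: "\<theta> \<in> forms B W 1"
  obtains q where "smooth_on q Z" "\<And>X u. X \<in> vfields B W \<Longrightarrow> u \<in> W \<Longrightarrow> \<theta> [X] u = q (\<phi> u) \<bullet> X u c"
proof -
  have sm: "\<theta> [X] \<in> smooth_funs B W" if "X \<in> vfields B W" for X
    using \<theta> that unfolding forms_def by (auto dest!: spec[of _ "[X]"])
  have lin: "\<theta> [\<lambda>q c. f q *\<^sub>R X q c + g q *\<^sub>R Y q c] u = f u * \<theta> [X] u + g u * \<theta> [Y] u"
    if "X \<in> vfields B W" "Y \<in> vfields B W" "f \<in> smooth_funs B W" "g \<in> smooth_funs B W" "u \<in> W" for X Y f g u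
  proof -
    have "\<forall>Xs a X Y f g. length Xs = 1 \<and> set Xs \<subseteq> vfields B W \<and> a < 1 \<and>
        X \<in> vfields B W \<and> Y \<in> vfields B W \<and> f \<in> smooth_funs B W \<and> g \<in> smooth_funs B W \<longrightarrow>
        (\<forall>p\<in>W. \<theta> (Xs[a := (\<lambda>q c. f q *\<^sub>R X q c + g q *\<^sub>R Y q c)]) p =
           f p * \<theta> (Xs[a := X]) p + g p * \<theta> (Xs[a := Y]) p)"
      using \<theta> unfolding forms_def by blast
    from this[rule_format, of "[X]" 0 X Y f g u] that show ?thesis by simp
  qed
  define q where "q z = (\<Sum>b\<in>Basis. \<theta> [lift (\<lambda>_. b)] (chart_inv c z) *\<^sub>R b)" for z
  have "smooth_on (\<lambda>z. \<theta> [lift (\<lambda>_. b)] (chart_inv c z)) Z" for b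
    using sm[OF lift_in[OF smooth_on_const]] by (simp add: smooth_funs_iff o_def)
  then have "smooth_on q Z" unfolding q_def by (intro smooth_intros open_Z)
  moreover have "\<theta> [X] u = q (\<phi> u) \<bullet> X u c" if X: "X \<in> vfields B W" and u: "u \<in> W" for X u
  proof -
    have f: "(\<lambda>u. X u c \<bullet> b) \<in> smooth_funs B W" for b
      using smooth_on_inner[OF open_Z smooth_hat[OF X] smooth_on_const, of b]
      by (simp add: smooth_funs_iff o_def hat_def)
    have part: "smooth_on (\<lambda>z. \<Sum>b\<in>I. (hat X z \<bullet> b) *\<^sub>R b) Z" for I
      by (intro smooth_intros open_Z smooth_hat X)
    have "\<theta> [lift (\<lambda>z. \<Sum>b\<in>I. (hat X z \<bullet> b) *\<^sub>R b)] u = (\<Sum>b\<in>I. (X u c \<bullet> b) * \<theta> [lift (\<lambda>_. b)] u)"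
      if "finite I" for I
      using that
    proof (induction I rule: finite_induct)
      case empty
      \<comment> \<open>Writing the zero field as a combination with zero coefficients lets the
        linearity rule yield the value 0.\<close>
      have "lift (\<lambda>z. 0) = (\<lambda>q c. 0 *\<^sub>R lift (\<lambda>z. 0) q c + 0 *\<^sub>R lift (\<lambda>z. 0) q c)"
        using c_in linear_0[OF linear_dd_transition[OF c_in]] by (auto simp: lift_def tangent_lift_def fun_eq_iff)
      then show ?case
        using lin[OF lift_in[OF smooth_on_const] lift_in[OF smooth_on_const] const_smooth_fun const_smooth_fun u, of 0 0 0 0]
        by simp
    next
      case (insert b I)
      have "lift (\<lambda>z. \<Sum>b\<in>insert b I. (hat X z \<bullet> b) *\<^sub>R b)
          = (\<lambda>u d. (X u c \<bullet> b) *\<^sub>R lift (\<lambda>_. b) u d + 1 *\<^sub>R lift (\<lambda>z. \<Sum>b\<in>I. (hat X z \<bullet> b) *\<^sub>R b) u d)"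
        using insert.hyps linear_add[OF linear_dd_transition[OF c_in]] linear_scale[OF linear_dd_transition[OF c_in]]
        by (auto simp: lift_def tangent_lift_def fun_eq_iff)
      then show ?case
        using lin[OF lift_in[OF smooth_on_const] lift_in[OF part] f const_smooth_fun u, of b b 1 I] insert by simp
    qed
    from this[of Basis] have "\<theta> [lift (hat X)] u = (\<Sum>b\<in>Basis. (X u c \<bullet> b) * \<theta> [lift (\<lambda>_. b)] u)"
      by (simp add: euclidean_representation)
    moreover have "lift (hat X) = X"
      using vfield_eq_lift[OF X] vfield_zero[OF X] by (auto simp: lift_def fun_eq_iff)
    ultimately show ?thesis
      using c_in u by (simp add: q_def inner_sum_left inner_commute[of "X u c"] mult.commute)
  qed
  ultimately show thesis by (rule that)
qed

end

lemma ext_d_singleton: "ext_d B W \<alpha> [X] u = vf_apply B X (\<alpha> []) u"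
  by (simp add: ext_d_def nths_Cons)

lemma ext_d_pair:
  "ext_d B W \<alpha> [X, Y] u = vf_apply B X (\<alpha> [Y]) u - vf_apply B Y (\<alpha> [X]) u - \<alpha> [lie_bracket B W X Y] u"
  by (simp add: ext_d_def nths_Cons lessThan_Suc)

lemma insert_endo_pair: "insert_endo K \<alpha> [X, Y] u = \<alpha> [K X, Y] u + \<alpha> [X, K Y] u"
  by (simp add: insert_endo_def lessThan_Suc)

lemma insert_endo_singleton: "insert_endo K \<alpha> [X] u = \<alpha> [K X] u"
  by (simp add: insert_endo_def lessThan_Suc)

lemma form_vanishes_1_iff:
  "form_vanishes B W 1 \<alpha> \<longleftrightarrow> (\<forall>X\<in>vfields B W. \<forall>u\<in>W. \<alpha> [X] u = 0)"
  unfolding form_vanishes_def by (auto simp: length_Suc_conv)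

lemma form_vanishes_2_iff:
  "form_vanishes B W 2 \<alpha> \<longleftrightarrow> (\<forall>X\<in>vfields B W. \<forall>Y\<in>vfields B W. \<forall>u\<in>W. \<alpha> [X, Y] u = 0)"
  unfolding form_vanishes_def numeral_2_eq_2 by (auto simp: length_Suc_conv)

section \<open>The tangent bundle\<close>

lemma chart_dom_induced: "chart_dom (induced_chart A c) = tangent_over A (chart_dom c)"
  and chart_map_induced: "chart_map (induced_chart A c) (p, v) = (chart_map c p, v c)"
  by (simp_all add: induced_chart_def)

lemma tangent_over_Int: "tangent_over A U \<inter> tangent_over A U' = tangent_over A (U \<inter> U')"
  by (auto simp: tangent_over_def)

context smooth_atlas
begin

lemma inj_induced: assumes c: "c \<in> B"
  shows "inj_on (chart_map (induced_chart B c)) (chart_dom (induced_chart B c))"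
proof (rule inj_onI, clarsimp simp: chart_dom_induced chart_map_induced)
  fix p v p' v'
  assume *: "(p, v) \<in> tangent_over B (chart_dom c)" "(p', v') \<in> tangent_over B (chart_dom c)"
    "chart_map c p = chart_map c p'" "v c = v' c"
  have p: "p \<in> chart_dom c" "p = p'"
    using inj_onD[OF inj_chart[OF c] *(3)] *(1,2) by (auto simp: tangent_over_def)
  have "v \<in> tangent_space B p" "v' \<in> tangent_space B p"
    using * p(2) by (auto simp: tangent_over_def)
  from this[THEN tangent_space_eq_lift[OF c p(1)]]
  have "v = v'" using *(4) by simp
  with p show "p = p' \<and> v = v'" by simp
qed

lemma image_induced: assumes c: "c \<in> B" and U: "U \<subseteq> chart_dom c"
  shows "chart_map (induced_chart B c) ` tangent_over B U = chart_map c ` U \<times> (UNIV :: 'e set)"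
proof (intro equalityI subsetI)
  fix w assume "w \<in> chart_map c ` U \<times> (UNIV :: 'e set)"
  then obtain p y where p: "p \<in> U" and w: "w = (chart_map c p, y)" by (cases w) auto
  then have "w = chart_map (induced_chart B c) (p, tangent_lift c p y)"
    using c U by (auto simp: chart_map_induced)
  moreover have "(p, tangent_lift c p y) \<in> tangent_over B U"
    using p tangent_lift_in[OF c, of p] U by (auto simp: tangent_over_def)
  ultimately show "w \<in> chart_map (induced_chart B c) ` tangent_over B U" by blast
qed (auto simp: tangent_over_def chart_map_induced)

lemma overlap_induced: assumes "c \<in> B" "d \<in> B"
  shows "chart_map (induced_chart B c) ` (chart_dom (induced_chart B c) \<inter> chart_dom (induced_chart B d))
    = chart_map c ` (chart_dom c \<inter> chart_dom d) \<times> UNIV"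
  unfolding chart_dom_induced tangent_over_Int by (rule image_induced) (use assms in auto)

lemma transition_induced:
  assumes c: "c \<in> B" and d: "d \<in> B"
    and w: "w \<in> chart_map c ` (chart_dom c \<inter> chart_dom d) \<times> UNIV"
  shows "transition (induced_chart B c) (induced_chart B d) w
    = (transition c d (fst w), \<DD> (transition c d) (fst w) (snd w))"
proof -
  obtain p v where u: "(p, v) \<in> chart_dom (induced_chart B c)" "(p, v) \<in> chart_dom (induced_chart B d)"
    and wu: "w = chart_map (induced_chart B c) (p, v)"
    using w unfolding overlap_induced[OF c d, symmetric] by auto
  have "transition (induced_chart B c) (induced_chart B d) w = chart_map (induced_chart B d) (p, v)"
    using u(1) by (simp add: transition_def chart_inv_def wu inj_induced[OF c])
  moreover have "v d = \<DD> (transition c d) (chart_map c p) (v c)"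
    using u c d by (intro tangent_spaceD(1)[of v B p]) (auto simp: chart_dom_induced tangent_over_def)
  ultimately show ?thesis
    using u c by (simp add: wu chart_map_induced chart_dom_induced tangent_over_def)
qed

text \<open>The derivative of an induced transition is block triangular with the same block twice on
  the diagonal. This is why vertical vectors and the tangent structure do not depend on the
  chart.\<close>

lemma transition_induced_smooth:
  assumes c: "c \<in> B" and d: "d \<in> B"
  defines "Q \<equiv> chart_map c ` (chart_dom c \<inter> chart_dom d) \<times> (UNIV :: 'e set)"
  shows "smooth_on (transition (induced_chart B c) (induced_chart B d)) Q"
    and "w \<in> Q \<Longrightarrow> fst (\<DD> (transition (induced_chart B c) (induced_chart B d)) w u)
      = \<DD> (transition c d) (fst w) (fst u)"
    and "w \<in> Q \<Longrightarrow> \<DD> (transition (induced_chart B c) (induced_chart B d)) w (0, b)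
      = (0, \<DD> (transition c d) (fst w) b)"
proof -
  have Q: "open Q" unfolding Q_def by (intro open_Times open_overlap c d) simp
  let ?\<tau> = "transition c d"
  note \<tau> = smooth_transition[OF c d]
  \<comment> \<open>The fibre component is then the derivative of \<open>f\<close> along the field
    \<open>(snd w, 0)\<close>, so the rules for moving directions apply to it.\<close>
  define f where "f = (\<lambda>w::'e \<times> 'e. ?\<tau> (fst w))"
  have f: "smooth_on f Q"
    unfolding f_def by (rule smooth_on_compose[OF Q _ \<tau>]) (auto simp: Q_def intro!: smooth_intros Q[unfolded Q_def])
  have f_dd: "\<DD> f w u = \<DD> ?\<tau> (fst w) (fst u)" if w: "w \<in> Q" for w u
  proof -
    have "(f has_derivative (\<lambda>u. \<DD> ?\<tau> (fst w) (fst u))) (at w)"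
      unfolding f_def
      by (rule has_derivative_compose[OF has_derivative_fst[OF has_derivative_ident] smooth_on_has_derivative[OF \<tau>]])
        (use w in \<open>auto simp: Q_def\<close>)
    from dd_eqI[OF this] show ?thesis by simp
  qed
  have y: "smooth_on (\<lambda>w::'e \<times> 'e. (snd w, 0::'e)) Q" by (intro smooth_intros Q)
  have y_dd: "\<DD> (\<lambda>w::'e \<times> 'e. (snd w, 0::'e)) w = (\<lambda>u. (snd u, 0))" for w
    by (rule dd_eqI) (auto intro!: derivative_eq_intros)
  have T: "(f w, \<DD> f w (snd w, 0)) = transition (induced_chart B c) (induced_chart B d) w" if "w \<in> Q" for w
    using transition_induced[OF c d] that f_dd[OF that] by (simp add: Q_def f_def)
  have dy: "smooth_on (\<lambda>w. \<DD> f w (snd w, 0)) Q" by (rule smooth_on_dd_field[OF Q f y])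
  show "smooth_on (transition (induced_chart B c) (induced_chart B d)) Q"
    by (rule smooth_on_cong[OF Q smooth_on_Pair[OF Q f dy] T])
  assume w: "w \<in> Q"
  have hd: "(transition (induced_chart B c) (induced_chart B d) has_derivative
      (\<lambda>u. (\<DD> f w u, \<DD> (\<lambda>w. \<DD> f w (snd w, 0)) w u))) (at w)"
    by (rule has_derivative_transform_within_open[OF _ Q w T])
      (intro has_derivative_Pair smooth_on_has_derivative[OF f w] smooth_on_has_derivative[OF dy w])
  show "fst (\<DD> (transition (induced_chart B c) (induced_chart B d)) w u) = \<DD> ?\<tau> (fst w) (fst u)"
    by (simp add: dd_eqI[OF hd] f_dd[OF w])
  have fv: "\<DD> f w (0, b) = 0" if "w \<in> Q" for w
    using that linear_0[OF smooth_on_linear_dd[OF \<tau>, of "fst w"]] by (auto simp: f_dd Q_def)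
  have "\<DD> (\<lambda>y. \<DD> f y (0, b)) w v = 0" for v
    using fun_cong[OF dd_cong_open(1)[OF Q w, of "\<lambda>y. \<DD> f y (0, b)" "\<lambda>y. 0"]] by (simp add: fv)
  then show "\<DD> (transition (induced_chart B c) (induced_chart B d)) w (0, b) = (0, \<DD> ?\<tau> (fst w) b)"
    by (simp add: dd_eqI[OF hd] fv[OF w] dd_dd_field(2)[OF Q f y w] y_dd f_dd[OF w, of "(b, 0)"])
qed

lemma smooth_atlas_induced: "smooth_atlas (induced_atlas B)"
proof
  fix C D assume "C \<in> induced_atlas B" "D \<in> induced_atlas B"
  then obtain c d where c: "c \<in> B" "C = induced_chart B c" and d: "d \<in> B" "D = induced_chart B d"
    by (auto simp: induced_atlas_def)
  show "inj_on (chart_map C) (chart_dom C)" using inj_induced c by simp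
  show "open (chart_map C ` (chart_dom C \<inter> chart_dom D))"
    unfolding c d overlap_induced[OF c(1) d(1)] by (intro open_Times open_overlap c d) simp
  show "smooth_on (transition C D) (chart_map C ` (chart_dom C \<inter> chart_dom D))"
    unfolding c d overlap_induced[OF c(1) d(1)] by (rule transition_induced_smooth(1)[OF c(1) d(1)])
qed

end

lemma smooth_atlas_of_manifold:
  assumes "smooth_manifold M A"
  shows "smooth_atlas A"
proof
  fix c d assume c: "c \<in> A" and d: "d \<in> A"
  have ch: "chart_on M c" "chart_on M d" using assms c d by (auto simp: smooth_manifold_def)
  let ?M = "subtopology M (chart_dom c)"
  have sub: "chart_dom c \<subseteq> topspace M" using ch by (auto simp: chart_on_def dest: openin_subset)
  have hm: "homeomorphic_map ?M (top_of_set (chart_map c ` chart_dom c)) (chart_map c)"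
    using ch by (simp add: chart_on_def)
  show "inj_on (chart_map c) (chart_dom c)"
    using homeomorphic_imp_injective_map[OF hm] sub by (simp add: Int_absorb1)
  have "openin ?M (chart_dom c \<inter> chart_dom d)"
    using ch by (auto simp: chart_on_def openin_subtopology)
  then have "openin (top_of_set (chart_map c ` chart_dom c)) (chart_map c ` (chart_dom c \<inter> chart_dom d))"
    using homeomorphic_map_openness_eq[OF hm] by blast
  then show "open (chart_map c ` (chart_dom c \<inter> chart_dom d))"
    using ch openin_open_trans by (auto simp: chart_on_def)
  show "smooth_on (transition c d) (chart_map c ` (chart_dom c \<inter> chart_dom d))"
    using assms c d by (auto simp: smooth_manifold_def compatible_charts_def)
qed

locale tangent_chart = smooth_atlas A for A :: "('a, 'e::euclidean_space) chart set" +
  fixes c :: "('a, 'e) chart"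
  assumes c_in: "c \<in> A"
begin

abbreviation "V \<equiv> chart_map c ` chart_dom c"

sublocale TB: atlas_chart "induced_atlas A" "induced_chart A c"
  by (intro atlas_chart.intro smooth_atlas_induced atlas_chart_axioms.intro)
    (use c_in in \<open>auto simp: induced_atlas_def\<close>)

lemma Z_eq: "TB.Z = V \<times> UNIV"
  using overlap_induced[OF c_in c_in] by simp

lemma open_V: "open V"
  using open_overlap[OF c_in c_in] by simp

abbreviation "vf \<equiv> vfields (induced_atlas A) TB.W"
abbreviation "J \<equiv> tangent_structure :: (('a, 'e) tangent, 'e \<times> 'e) endo"

lemma hat_J: "TB.hat (J X) z = (0, fst (TB.hat X z))"
  by (simp add: TB.hat_def tangent_structure_def)

text \<open>\<open>J\<close> is prescribed separately in every chart; the equality of the two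
  diagonal blocks of an induced transition makes the prescriptions agree.\<close>

lemma J_in: assumes X: "X \<in> vf" shows "J X \<in> vf"
proof (rule TB.vfieldsI)
  show "smooth_on (TB.hat (J X)) TB.Z"
    unfolding hat_J by (intro smooth_intros TB.open_Z TB.smooth_hat X)
next
  fix u D assume u: "u \<in> TB.W" and D: "D \<in> induced_atlas A" "u \<in> chart_dom D"
  then obtain d where d: "d \<in> A" "D = induced_chart A d" by (auto simp: induced_atlas_def)
  have w: "TB.\<phi> u \<in> chart_map c ` (chart_dom c \<inter> chart_dom d) \<times> UNIV"
    unfolding overlap_induced[OF c_in d(1), symmetric] using u D d by auto
  show "J X u D = \<DD> (transition (induced_chart A c) D) (TB.\<phi> u) (J X u (induced_chart A c))"
    using TB.vfield_transition[OF X u D] transition_induced_smooth(2,3)[OF c_in d(1) w]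
    by (simp add: tangent_structure_def d(2))
next
  fix u D assume "\<not> (u \<in> TB.W \<and> D \<in> induced_atlas A \<and> u \<in> chart_dom D)"
  from TB.vfield_zero[OF X this] show "J X u D = 0"
    by (simp add: tangent_structure_def zero_prod_def)
qed

end

section \<open>Coordinate expressions of the operators attached to a semispray\<close>

locale spray_chart = tangent_chart +
  fixes S :: "('a \<times> (('a, 'b) chart \<Rightarrow> 'b), 'b \<times> 'b) vfield"
  assumes S_in: "S \<in> vf"
    and S_fst: "u \<in> TB.W \<Longrightarrow> fst (S u (induced_chart A c)) = snd (TB.\<phi> u)"
begin

definition "s z = snd (TB.hat S z)"

sublocale G: spray V s
  by standard (use open_V TB.smooth_hat[OF S_in] Z_eq in \<open>auto simp: s_def[abs_def] intro!: smooth_on_snd open_Times\<close>)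

lemma in_Z: "z \<in> TB.Z \<Longrightarrow> z \<in> V \<times> UNIV"
  by (simp add: Z_eq)

lemma hat_S: "z \<in> TB.Z \<Longrightarrow> TB.hat S z = G.spray_vf z"
  using S_fst by (auto simp: G.spray_vf_def s_def prod_eq_iff)

lemma dd_hat_S: assumes z: "z \<in> TB.Z" shows "\<DD> (TB.hat S) z u = (snd u, \<DD> s z u)"
  using dd_cong_open(1)[OF TB.open_Z z hat_S] G.dd_spray_vf[OF in_Z[OF z]] by simp

lemma dd_hat_J: assumes X: "X \<in> vf" and z: "z \<in> TB.Z"
  shows "\<DD> (TB.hat (J X)) z u = (0, fst (\<DD> (TB.hat X) z u))"
proof -
  have "(TB.hat (J X) has_derivative (\<lambda>u. (0, fst (\<DD> (TB.hat X) z u)))) (at z)"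
    unfolding hat_J[abs_def]
    by (intro has_derivative_Pair has_derivative_const has_derivative_fst
        smooth_on_has_derivative[OF TB.smooth_hat[OF X] z])
  from dd_eqI[OF this] show ?thesis by simp
qed

lemma dd_s_vertical: "\<DD> s z (0, a) = 2 *\<^sub>R G.conn z a"
  by (simp add: G.conn_def)

lemma hat_lie_endo:
  "TB.hat (lie_endo (induced_atlas A) TB.W S K X) z
    = TB.hat (lie_bracket (induced_atlas A) TB.W S (K X)) z - TB.hat (K (lie_bracket (induced_atlas A) TB.W S X)) z"
  by (simp add: lie_endo_def TB.hat_def)

lemma lie_endo_in:
  assumes "\<And>X. X \<in> vf \<Longrightarrow> K X \<in> vf" "X \<in> vf"
  shows "lie_endo (induced_atlas A) TB.W S K X \<in> vf"
  unfolding lie_endo_def by (intro TB.vfield_lincomb TB.lie_bracket_in assms S_in)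

lemma hat_lie_S:
  assumes X: "X \<in> vf" and z: "z \<in> TB.Z"
  shows "TB.hat (lie_bracket (induced_atlas A) TB.W S X) z
    = \<DD> (TB.hat X) z (G.spray_vf z) - (snd (TB.hat X z), \<DD> s z (TB.hat X z))"
  by (simp add: TB.hat_lie_bracket[OF z] hat_S[OF z] dd_hat_S[OF z])

text \<open>The derivatives of \<open>X\<close> cancel between the two brackets, as for any Lie
  derivative of a tensor. The eigenspaces -1 and 1 of the result are the horizontal and the vertical
  vectors.\<close>

lemma hat_lie_endo_J:
  assumes X: "X \<in> vf" and z: "z \<in> TB.Z"
  shows "TB.hat (lie_endo (induced_atlas A) TB.W S J X) z
    = (- fst (TB.hat X z), snd (TB.hat X z) - 2 *\<^sub>R G.conn z (fst (TB.hat X z)))"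
  unfolding hat_lie_endo hat_J hat_lie_S[OF X z] hat_lie_S[OF J_in[OF X] z] dd_hat_J[OF X z]
  by (simp add: dd_s_vertical)

abbreviation "h \<equiv> h_proj (induced_atlas A) TB.W S"
abbreviation "v \<equiv> v_proj (induced_atlas A) TB.W S"
abbreviation "\<Phi> \<equiv> jacobi_endo (induced_atlas A) TB.W S"
abbreviation "F \<equiv> almost_complex (induced_atlas A) TB.W S"

lemma h_in: "X \<in> vf \<Longrightarrow> h X \<in> vf"
  unfolding h_proj_def by (intro TB.vfield_lincomb lie_endo_in J_in)

lemma v_in: "X \<in> vf \<Longrightarrow> v X \<in> vf"
  unfolding v_proj_def by (intro TB.vfield_lincomb lie_endo_in J_in)

lemma \<Phi>_in: "X \<in> vf \<Longrightarrow> \<Phi> X \<in> vf"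
  unfolding jacobi_endo_def by (intro v_in lie_endo_in h_in)

lemma F_in: "X \<in> vf \<Longrightarrow> F X \<in> vf"
  unfolding almost_complex_def by (intro TB.vfield_lincomb lie_endo_in h_in J_in)

lemma hat_h:
  assumes X: "X \<in> vf" and z: "z \<in> TB.Z"
  shows "TB.hat (h X) z = (fst (TB.hat X z), G.conn z (fst (TB.hat X z)))"
proof -
  have "TB.hat (h X) z = (1/2) *\<^sub>R (TB.hat X z - TB.hat (lie_endo (induced_atlas A) TB.W S J X) z)"
    by (simp add: h_proj_def TB.hat_def)
  then show ?thesis
    by (simp add: hat_lie_endo_J[OF X z] prod_eq_iff scaleR_2[symmetric] scaleR_add_right)
qed

lemma hat_v:
  assumes X: "X \<in> vf" and z: "z \<in> TB.Z"
  shows "TB.hat (v X) z = (0, snd (TB.hat X z) - G.conn z (fst (TB.hat X z)))"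
proof -
  have "TB.hat (v X) z = (1/2) *\<^sub>R (TB.hat X z + TB.hat (lie_endo (induced_atlas A) TB.W S J X) z)"
    by (simp add: v_proj_def TB.hat_def)
  then show ?thesis
    by (simp add: hat_lie_endo_J[OF X z] prod_eq_iff scaleR_2[symmetric] scaleR_add_right scaleR_diff_right)
qed

lemma has_derivative_conn:
  assumes z: "z \<in> TB.Z" and f: "(f has_derivative f') (at z)"
  shows "((\<lambda>z. G.conn z (f z)) has_derivative
    (\<lambda>u. \<DD> (\<lambda>y. G.conn y (f z)) z u + G.conn z (f' u))) (at z)"
proof -
  have "((\<lambda>z. (1/2) *\<^sub>R \<DD> s z (0, f z)) has_derivative
      (\<lambda>u. (1/2) *\<^sub>R (\<DD> (\<lambda>y. \<DD> s y (0, f z)) z u + \<DD> s z (0, f' u)))) (at z)"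
    by (intro has_derivative_scaleR_right has_derivative_dd_field[OF G.smooth_s _ in_Z[OF z] G.open_Z]
        has_derivative_Pair has_derivative_const f)
  moreover have "((\<lambda>y. G.conn y (f z)) has_derivative (\<lambda>u. (1/2) *\<^sub>R \<DD> (\<lambda>y. \<DD> s y (0, f z)) z u)) (at z)"
    unfolding G.conn_def
    by (intro has_derivative_scaleR_right smooth_on_has_derivative[OF smooth_on_dd[OF G.smooth_s] in_Z[OF z]])
  note dd_eqI[OF this]
  ultimately show ?thesis by (simp add: G.conn_def scaleR_add_right)
qed

lemma dd_hat_h:
  assumes X: "X \<in> vf" and z: "z \<in> TB.Z"
  shows "\<DD> (TB.hat (h X)) z u = (fst (\<DD> (TB.hat X) z u),
    \<DD> (\<lambda>y. G.conn y (fst (TB.hat X z))) z u + G.conn z (fst (\<DD> (TB.hat X) z u)))"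
proof -
  note X1 = has_derivative_fst[OF smooth_on_has_derivative[OF TB.smooth_hat[OF X] z]]
  have "((TB.hat (h X)) has_derivative (\<lambda>u. (fst (\<DD> (TB.hat X) z u),
    \<DD> (\<lambda>y. G.conn y (fst (TB.hat X z))) z u + G.conn z (fst (\<DD> (TB.hat X) z u))))) (at z)"
    by (rule has_derivative_transform_within_open[OF has_derivative_Pair[OF X1 has_derivative_conn[OF z X1]]
          TB.open_Z z]) (simp add: hat_h[OF X])
  from dd_eqI[OF this] show ?thesis by simp
qed

text \<open>With w = b - \<open>conn\<close> a for a field (a, b), the result splits into the
  horizontal lift of w and the vertical vector R a. Projecting with \<open>h\<close> gives
  \<open>F\<close> + \<open>J\<close>, projecting with \<open>v\<close> gives
  \<open>\<Phi>\<close>.\<close>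

lemma hat_lie_endo_h:
  assumes X: "X \<in> vf" and z: "z \<in> TB.Z"
  shows "TB.hat (lie_endo (induced_atlas A) TB.W S h X) z
    = (snd (TB.hat X z) - G.conn z (fst (TB.hat X z)),
       G.jacobi z (fst (TB.hat X z)) + G.conn z (snd (TB.hat X z) - G.conn z (fst (TB.hat X z))))"
proof -
  have "lie_bracket (induced_atlas A) TB.W S X \<in> vf" by (rule TB.lie_bracket_in[OF S_in X])
  moreover have "\<DD> s z (a, b) = \<DD> s z (a, 0) + 2 *\<^sub>R G.conn z b" for a b
    using smooth_on_dd_Pair[OF G.smooth_s in_Z[OF z], of a b] by (simp add: dd_s_vertical)
  note this[of "fst (TB.hat X z)" "G.conn z (fst (TB.hat X z))"]
  moreover note lin = G.linear_conn[OF in_Z[OF z]]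
  ultimately show ?thesis
    unfolding hat_lie_endo
    by (simp add: hat_h[OF _ z] hat_lie_S[OF _ z] h_in[OF X] X dd_hat_h[OF X z] G.jacobi_def
        linear_diff[OF lin] scaleR_2)
qed

lemma hat_F:
  assumes X: "X \<in> vf" and z: "z \<in> TB.Z"
  shows "TB.hat (F X) z = (snd (TB.hat X z) - G.conn z (fst (TB.hat X z)),
    G.conn z (snd (TB.hat X z) - G.conn z (fst (TB.hat X z))) - fst (TB.hat X z))"
proof -
  have "TB.hat (F X) z = TB.hat (h (lie_endo (induced_atlas A) TB.W S h X)) z - TB.hat (J X) z"
    by (simp add: almost_complex_def TB.hat_def)
  then show ?thesis
    using lie_endo_in[OF h_in X] by (simp add: hat_h[OF _ z] hat_lie_endo_h[OF X z] hat_J)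
qed

lemma hat_\<Phi>:
  assumes X: "X \<in> vf" and z: "z \<in> TB.Z"
  shows "TB.hat (\<Phi> X) z = (0, G.jacobi z (fst (TB.hat X z)))"
  unfolding jacobi_endo_def
  using lie_endo_in[OF h_in X] by (simp add: hat_v[OF _ z] hat_lie_endo_h[OF X z])

end

section \<open>The Helmholtz conditions on the tangent bundle\<close>

context tangent_chart
begin

text \<open>One chart decides, since induced transitions map vectors of the form (0, b) to vectors
  of the same form.\<close>

lemma vertical_iff:
  assumes X: "X \<in> vf"
  shows "vertical A TB.W X \<longleftrightarrow> (\<forall>u\<in>TB.W. fst (X u (induced_chart A c)) = 0)"
proof
  assume "vertical A TB.W X"
  then show "\<forall>u\<in>TB.W. fst (X u (induced_chart A c)) = 0"
    using c_in unfolding vertical_def d_proj_def fun_eq_iff by metis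
next
  assume 0: "\<forall>u\<in>TB.W. fst (X u (induced_chart A c)) = 0"
  have "fst (X u (induced_chart A d)) = 0" if u: "u \<in> TB.W" and d: "d \<in> A" for u d
  proof (cases "u \<in> chart_dom (induced_chart A d)")
    case True
    then have "TB.\<phi> u \<in> chart_map c ` (chart_dom c \<inter> chart_dom d) \<times> UNIV"
      unfolding overlap_induced[OF c_in d, symmetric] using u by blast
    from transition_induced_smooth(3)[OF c_in d this]
    have "fst (X u (induced_chart A d)) = fst (0, \<DD> (transition c d) (fst (TB.\<phi> u)) (snd (X u (induced_chart A c))))"
      using TB.vfield_transition[OF X u _ True] 0 u d
      by (metis imageI induced_atlas_def prod.collapse)
    then show ?thesis by simp
  next
    case False
    then show ?thesis using TB.vfield_zero[OF X] by simp
  qed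
  then show "vertical A TB.W X" by (auto simp: vertical_def d_proj_def fun_eq_iff)
qed

definition represents ::
  "(('a, 'e) tangent, 'e \<times> 'e) form \<Rightarrow> ('e \<times> 'e \<Rightarrow> 'e) \<Rightarrow> bool" where
  "represents \<theta> p \<longleftrightarrow> smooth_on p TB.Z \<and>
     (\<forall>X\<in>vf. \<forall>u\<in>TB.W. \<theta> [X] u = p (TB.\<phi> u) \<bullet> fst (X u (induced_chart A c)))"

lemma semi_basic_represents:
  assumes \<theta>: "\<theta> \<in> forms (induced_atlas A) TB.W 1" and sb: "semi_basic A TB.W 1 \<theta>"
  obtains p where "represents \<theta> p"
proof -
  obtain q where q: "smooth_on q TB.Z"
    "\<And>X u. X \<in> vf \<Longrightarrow> u \<in> TB.W \<Longrightarrow> \<theta> [X] u = q (TB.\<phi> u) \<bullet> X u (induced_chart A c)"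
    using TB.form_1_coefficients[OF \<theta>] by blast
  have "snd (q (TB.\<phi> u)) = 0" if u: "u \<in> TB.W" for u
  proof -
    \<comment> \<open>Testing \<theta> on the vertical field with constant value \<open>b\<close>
      gives b \<bullet> b = 0 at \<open>u\<close>.\<close>
    define b where "b = snd (q (TB.\<phi> u))"
    define X where "X = TB.lift (\<lambda>_. (0, b))"
    have X: "X \<in> vf" unfolding X_def by (rule TB.lift_in) simp
    have "vertical A TB.W X" unfolding vertical_iff[OF X] by (simp add: X_def)
    then have "\<theta> [X] u = 0"
      using sb X u unfolding semi_basic_def by (auto dest!: spec[of _ "[X]"])
    then show ?thesis using q(2)[OF X u] u by (simp add: X_def b_def inner_prod_def)
  qed
  then have "represents \<theta> (\<lambda>z. fst (q z))"
    using q smooth_on_fst[OF TB.open_Z q(1)] by (auto simp: represents_def inner_prod_def)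
  then show thesis by (rule that)
qed

lemma represents_exists:
  assumes p: "smooth_on p TB.Z"
  obtains \<theta> where "\<theta> \<in> forms (induced_atlas A) TB.W 1" "semi_basic A TB.W 1 \<theta>" "represents \<theta> p"
proof -
  define \<theta> :: "(('a, 'e) tangent, 'e \<times> 'e) form"
    where "\<theta> = (\<lambda>Xs u. p (TB.\<phi> u) \<bullet> fst (hd Xs u (induced_chart A c)))"
  have "\<theta> [X] \<in> smooth_funs (induced_atlas A) TB.W" if X: "X \<in> vf" for X
    unfolding TB.smooth_funs_iff
    by (rule smooth_on_cong[OF TB.open_Z, where f="\<lambda>z. p z \<bullet> fst (TB.hat X z)"])
      (intro smooth_intros TB.open_Z TB.smooth_hat X p, simp add: \<theta>_def TB.\<phi>_inv TB.hat_def)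
  then have "\<theta> \<in> forms (induced_atlas A) TB.W 1"
    unfolding forms_def by (auto simp: length_Suc_conv \<theta>_def inner_add_right)
  moreover have "semi_basic A TB.W 1 \<theta>"
    unfolding semi_basic_def by (auto simp: length_Suc_conv \<theta>_def vertical_iff)
  moreover have "represents \<theta> p" using p by (simp add: represents_def \<theta>_def)
  ultimately show thesis by (rule that)
qed

lemma restrict_spray:
  assumes "semispray A S"
  defines "S\<^sub>U \<equiv> restrict_vfield TB.W S"
  shows "S\<^sub>U \<in> vf" "u \<in> TB.W \<Longrightarrow> fst (S\<^sub>U u (induced_chart A c)) = snd (TB.\<phi> u)"
proof -
  have S: "S \<in> vfields (induced_atlas A) (tangent_bundle A)"
    and JS: "\<And>u. u \<in> tangent_bundle A \<Longrightarrow> J S u = liouville A u"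
    using assms by (auto simp: semispray_def)
  have sub: "TB.W \<subseteq> tangent_bundle A"
    using c_in by (auto simp: chart_dom_induced tangent_bundle_def tangent_over_def)
  have "smooth_on (\<lambda>z. S\<^sub>U (chart_inv d z) d) (chart_map d ` (chart_dom d \<inter> TB.W))"
    if d: "d \<in> induced_atlas A" for d
  proof (rule smooth_on_cong[OF TB.open_overlap[OF d TB.c_in]])
    show "smooth_on (\<lambda>z. S (chart_inv d z) d) (chart_map d ` (chart_dom d \<inter> TB.W))"
      by (rule smooth_on_subset[of _ "chart_map d ` (chart_dom d \<inter> tangent_bundle A)"])
        (use S d sub in \<open>auto simp: vfields_def\<close>)
  qed (use d in \<open>auto simp: S\<^sub>U_def restrict_vfield_def\<close>)
  then show "S\<^sub>U \<in> vf" using S sub by (auto simp: vfields_def S\<^sub>U_def restrict_vfield_def)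
  show "fst (S\<^sub>U u (induced_chart A c)) = snd (TB.\<phi> u)" if u: "u \<in> TB.W"
    using fun_cong[OF JS[of u], of "induced_chart A c"] u sub TB.c_in
    by (auto simp: S\<^sub>U_def restrict_vfield_def tangent_structure_def liouville_def)
qed

end

section \<open>The Helmholtz and Euler-Lagrange operators in coordinates\<close>

context spray_chart
begin

lemma \<phi>_in: "u \<in> TB.W \<Longrightarrow> TB.\<phi> u \<in> TB.Z"
  by simp

lemma has_derivative_pairing:
  assumes p: "smooth_on p TB.Z" and X: "X \<in> vf" and z: "z \<in> TB.Z"
  shows "((\<lambda>z. p z \<bullet> fst (TB.hat X z)) has_derivative
    (\<lambda>a. p z \<bullet> fst (\<DD> (TB.hat X) z a) + \<DD> p z a \<bullet> fst (TB.hat X z))) (at z)"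
  by (rule has_derivative_inner[OF smooth_on_has_derivative[OF p z]
        has_derivative_fst[OF smooth_on_has_derivative[OF TB.smooth_hat[OF X] z]]])

text \<open>The derivatives of the fields produced by the first two terms of the exterior derivative
  cancel against the bracket term.\<close>

lemma ext_d_represents:
  assumes \<theta>: "represents \<theta> p" and X: "X \<in> vf" and Y: "Y \<in> vf" and u: "u \<in> TB.W"
  shows "ext_d (induced_atlas A) TB.W \<theta> [X, Y] u
    = \<DD> p (TB.\<phi> u) (X u (induced_chart A c)) \<bullet> fst (Y u (induced_chart A c))
    - \<DD> p (TB.\<phi> u) (Y u (induced_chart A c)) \<bullet> fst (X u (induced_chart A c))"
proof -
  have p: "smooth_on p TB.Z"
    and rep: "\<And>X u. X \<in> vf \<Longrightarrow> u \<in> TB.W \<Longrightarrow> \<theta> [X] u = p (TB.\<phi> u) \<bullet> fst (X u (induced_chart A c))"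
    using \<theta> by (auto simp: represents_def)
  have "vf_apply (induced_atlas A) X (\<theta> [Y]) u
      = p (TB.\<phi> u) \<bullet> fst (\<DD> (TB.hat Y) (TB.\<phi> u) (X u (induced_chart A c)))
        + \<DD> p (TB.\<phi> u) (X u (induced_chart A c)) \<bullet> fst (TB.hat Y (TB.\<phi> u))"
    if X: "X \<in> vf" and Y: "Y \<in> vf" for X Y
    by (rule TB.vf_apply_eq[OF X u has_derivative_pairing[OF p Y \<phi>_in[OF u]]]) (simp add: rep[OF Y])
  from this[OF X Y] this[OF Y X] show ?thesis
    unfolding ext_d_pair rep[OF TB.lie_bracket_in[OF X Y] u] TB.lie_bracket_at[OF u]
    using u by (simp add: inner_diff_right)
qed

text \<open>A tensor \<open>K\<close> with vertical values annihilates the semi-basic \<theta>, so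
  only the contraction of d\<theta> with \<open>K\<close> survives.\<close>

lemma d_endo_represents:
  assumes \<theta>: "represents \<theta> p" and K: "\<And>X. X \<in> vf \<Longrightarrow> K X \<in> vf"
    and K0: "\<And>X u. X \<in> vf \<Longrightarrow> u \<in> TB.W \<Longrightarrow> K X u (induced_chart A c) = (0, \<kappa> X u)"
    and X: "X \<in> vf" and Y: "Y \<in> vf" and u: "u \<in> TB.W"
  shows "d_endo (induced_atlas A) TB.W K \<theta> [X, Y] u
    = \<DD> p (TB.\<phi> u) (0, \<kappa> X u) \<bullet> fst (Y u (induced_chart A c))
    - \<DD> p (TB.\<phi> u) (0, \<kappa> Y u) \<bullet> fst (X u (induced_chart A c))"
proof -
  have "insert_endo K \<theta> [X] u = 0" if "X \<in> vf" "u \<in> TB.W" for X u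
    using \<theta> K[OF that(1)] that K0 by (simp add: insert_endo_singleton represents_def)
  then have "ext_d (induced_atlas A) TB.W (insert_endo K \<theta>) [X, Y] u = 0"
    using TB.vf_apply_zero[OF X u] TB.vf_apply_zero[OF Y u] X Y u TB.lie_bracket_in[OF X Y]
    by (simp add: ext_d_pair)
  then show ?thesis
    using ext_d_represents[OF \<theta> K[OF X] Y u] ext_d_represents[OF \<theta> X K[OF Y] u]
    by (simp add: d_endo_def form_diff_def insert_endo_pair K0[OF X u] K0[OF Y u])
qed

lemma d_endo_vanishes_iff:
  assumes \<theta>: "represents \<theta> p" and K: "\<And>X. X \<in> vf \<Longrightarrow> K X \<in> vf"
    and K0: "\<And>X u. X \<in> vf \<Longrightarrow> u \<in> TB.W \<Longrightarrow>
      K X u (induced_chart A c) = (0, \<kappa> (TB.\<phi> u) (fst (X u (induced_chart A c))))"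
  shows "form_vanishes (induced_atlas A) TB.W 2 (d_endo (induced_atlas A) TB.W K \<theta>) \<longleftrightarrow>
    (\<forall>z\<in>TB.Z. \<forall>a b. \<DD> p z (0, \<kappa> z a) \<bullet> b = \<DD> p z (0, \<kappa> z b) \<bullet> a)"
proof -
  have eq: "d_endo (induced_atlas A) TB.W K \<theta> [X, Y] u
    = \<DD> p (TB.\<phi> u) (0, \<kappa> (TB.\<phi> u) (fst (X u (induced_chart A c)))) \<bullet> fst (Y u (induced_chart A c))
    - \<DD> p (TB.\<phi> u) (0, \<kappa> (TB.\<phi> u) (fst (Y u (induced_chart A c)))) \<bullet> fst (X u (induced_chart A c))"
    if "X \<in> vf" "Y \<in> vf" "u \<in> TB.W" for X Y u
    by (rule d_endo_represents[OF \<theta>]) (use K K0 that in simp_all)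
  show ?thesis
    unfolding form_vanishes_2_iff
  proof (intro iffI ballI allI)
    fix z a b
    assume v: "\<forall>X\<in>vf. \<forall>Y\<in>vf. \<forall>u\<in>TB.W. d_endo (induced_atlas A) TB.W K \<theta> [X, Y] u = 0" and "z \<in> TB.Z"
    then obtain u where u: "u \<in> TB.W" "z = TB.\<phi> u" by blast
    have "TB.lift (\<lambda>_. (a, 0)) \<in> vf" for a by (rule TB.lift_in) simp
    note ab = this[of a] this[of b]
    from v ab u(1) have "d_endo (induced_atlas A) TB.W K \<theta> [TB.lift (\<lambda>_. (a, 0)), TB.lift (\<lambda>_. (b, 0))] u = 0"
      by blast
    then show "\<DD> p z (0, \<kappa> z a) \<bullet> b = \<DD> p z (0, \<kappa> z b) \<bullet> a"
      unfolding eq[OF ab u(1)] using u by simp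
  qed (simp add: eq)
qed

definition nabla_form :: "('b \<times> 'b \<Rightarrow> 'b) \<Rightarrow> 'b \<times> 'b \<Rightarrow> 'b \<Rightarrow> 'b \<Rightarrow> real" where
  "nabla_form p z a b = \<DD> (\<lambda>y. \<DD> p y (0, a)) z (G.spray_vf z) \<bullet> b
     + \<DD> p z (0, G.conn z a) \<bullet> b + \<DD> p z (0, a) \<bullet> G.conn z b"

lemma dyn_cov_represents:
  assumes \<theta>: "represents \<theta> p" and X: "X \<in> vf" and Y: "Y \<in> vf" and u: "u \<in> TB.W"
  defines "cc \<equiv> induced_chart A c"
  shows "dyn_cov (induced_atlas A) TB.W S (d_endo (induced_atlas A) TB.W v \<theta>) [X, Y] u
    = nabla_form p (TB.\<phi> u) (snd (X u cc) - G.conn (TB.\<phi> u) (fst (X u cc))) (fst (Y u cc))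
    - nabla_form p (TB.\<phi> u) (snd (Y u cc) - G.conn (TB.\<phi> u) (fst (Y u cc))) (fst (X u cc))"
proof -
  define z where "z = TB.\<phi> u"
  have z: "z \<in> TB.Z" using u by (simp add: z_def)
  have p: "smooth_on p TB.Z" using \<theta> by (simp add: represents_def)
  note lin = G.linear_conn[OF in_Z[OF z]]
  let ?\<alpha> = "d_endo (induced_atlas A) TB.W v \<theta>"
  define w where "w = (\<lambda>X z. snd (TB.hat X z) - G.conn z (fst (TB.hat X z)))"
  define T where "T = (\<lambda>X Y z. \<DD> p z (0, w X z) \<bullet> fst (TB.hat Y z))"
  have v_at: "v X u cc = (0, w X (TB.\<phi> u))" if "X \<in> vf" "u \<in> TB.W" for X u
    using hat_v[OF that(1) \<phi>_in[OF that(2)]] that(2) by (simp add: w_def cc_def)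
  have \<alpha>: "?\<alpha> [X, Y] u = T X Y (TB.\<phi> u) - T Y X (TB.\<phi> u)"
    if X: "X \<in> vf" and Y: "Y \<in> vf" and u: "u \<in> TB.W" for X Y u
    using d_endo_represents[OF \<theta> v_in v_at[unfolded cc_def] X Y u] u by (simp add: T_def)
  define LX where "LX = (\<lambda>X. lie_bracket (induced_atlas A) TB.W S X)"
  define P where "P = (\<lambda>X u d. F X u d + J X u d - \<Phi> X u d)"
  have L_in: "LX X \<in> vf" if "X \<in> vf" for X
    unfolding LX_def by (rule TB.lie_bracket_in[OF S_in that])
  have P_in: "P X \<in> vf" if "X \<in> vf" for X
    unfolding P_def by (intro TB.vfield_lincomb F_in J_in \<Phi>_in that)
  have hat_P: "TB.hat (P X) z = (w X z, G.conn z (w X z) - G.jacobi z (fst (TB.hat X z)))"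
    if X: "X \<in> vf" for X
  proof -
    have "TB.hat (P X) z = TB.hat (F X) z + TB.hat (J X) z - TB.hat (\<Phi> X) z"
      by (simp add: P_def TB.hat_def)
    then show ?thesis by (simp add: hat_F[OF X z] hat_J hat_\<Phi>[OF X z] w_def)
  qed
  note hat_L = hat_lie_S[OF _ z, folded LX_def]
  define T' where "T' = (\<lambda>X Y a. \<DD> p z (0, w X z) \<bullet> fst (\<DD> (TB.hat Y) z a)
      + (\<DD> (\<lambda>y. \<DD> p y (0, w X z)) z a
        + \<DD> p z (0, snd (\<DD> (TB.hat X) z a) - (\<DD> (\<lambda>y. G.conn y (fst (TB.hat X z))) z a
            + G.conn z (fst (\<DD> (TB.hat X) z a))))) \<bullet> fst (TB.hat Y z))"
  have T': "(T X Y has_derivative T' X Y) (at z)" if X: "X \<in> vf" and Y: "Y \<in> vf" for X Y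
    unfolding T_def T'_def w_def
    by (intro has_derivative_inner has_derivative_dd_field[OF p _ z TB.open_Z]
        has_derivative_Pair has_derivative_const has_derivative_diff has_derivative_conn[OF z]
        has_derivative_fst has_derivative_snd smooth_on_has_derivative[OF TB.smooth_hat[OF X] z]
        smooth_on_has_derivative[OF TB.smooth_hat[OF Y] z])
  have key: "T' X Y (G.spray_vf z) - T (LX X) Y z - T X (LX Y) z - T (P X) Y z - T X (P Y) z
      = nabla_form p z (w X z) (fst (TB.hat Y z))" if X: "X \<in> vf" and Y: "Y \<in> vf" for X Y
  proof -
    have "\<DD> s z (a, b) = \<DD> s z (a, 0) + 2 *\<^sub>R G.conn z b" for a b
      using smooth_on_dd_Pair[OF G.smooth_s in_Z[OF z], of a b] by (simp add: dd_s_vertical)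
    note s_split = this[of "fst (TB.hat X z)" "snd (TB.hat X z)", unfolded prod.collapse]
    have w_at: "w X z = snd (TB.hat X z) - G.conn z (fst (TB.hat X z))" for X by (simp add: w_def)
    define D where "D = snd (\<DD> (TB.hat X) z (G.spray_vf z))
        - (\<DD> (\<lambda>y. G.conn y (fst (TB.hat X z))) z (G.spray_vf z)
            + G.conn z (fst (\<DD> (TB.hat X) z (G.spray_vf z))))"
    \<comment> \<open>The Jacobi term of \<open>P\<close> compensates the derivatives of the
      connection and the x-derivative of \<open>s\<close>, and the derivatives of \<open>X\<close>
      cancel; a single \<open>conn\<close> is left. The companion identity for \<open>Y\<close>
      likewise leaves a single \<open>conn\<close>.\<close>
    have "D - w (LX X) z - w (P X) z = G.conn z (w X z)"
      by (simp add: D_def w_at[of "LX X"] w_at[of "P X"] hat_L[OF X] hat_P[OF X] s_split G.jacobi_def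
          linear_diff[OF lin] scaleR_2) (simp add: w_at linear_diff[OF lin])
    moreover have "linear (\<lambda>a. \<DD> p z (0, a))"
      using smooth_on_dd_add[OF p z, of "(0, _)" "(0, _)"] smooth_on_dd_scaleR[OF p z, of _ "(0, _)"]
      by (intro linearI) simp_all
    note linear_diff[OF this]
    ultimately have 1: "\<DD> p z (0, D) - \<DD> p z (0, w (LX X) z) - \<DD> p z (0, w (P X) z) = \<DD> p z (0, G.conn z (w X z))"
      by metis
    have 2: "fst (\<DD> (TB.hat Y) z (G.spray_vf z)) - fst (TB.hat (LX Y) z) - fst (TB.hat (P Y) z)
        = G.conn z (fst (TB.hat Y z))"
      by (simp add: hat_L[OF Y] hat_P[OF Y] w_def)
    show ?thesis
      unfolding nabla_form_def T'_def T_def D_def[symmetric] 1[symmetric] 2[symmetric]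
      by (simp add: inner_add_left inner_diff_left inner_diff_right)
  qed
  have "vf_apply (induced_atlas A) S (?\<alpha> [X, Y]) u
      = T' X Y (S u cc) - T' Y X (S u cc)"
    unfolding cc_def
    by (rule TB.vf_apply_eq[OF S_in u has_derivative_diff[OF T'[OF X Y, unfolded z_def] T'[OF Y X, unfolded z_def]]])
      (simp add: \<alpha>[OF X Y])
  moreover have "S u cc = G.spray_vf z" using hat_S[OF z] u by (simp add: z_def cc_def)
  ultimately have "dyn_cov (induced_atlas A) TB.W S ?\<alpha> [X, Y] u
      = (T' X Y (G.spray_vf z) - T (LX X) Y z - T X (LX Y) z - T (P X) Y z - T X (P Y) z)
      - (T' Y X (G.spray_vf z) - T (LX Y) X z - T Y (LX X) z - T (P Y) X z - T Y (P X) z)"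
    unfolding dyn_cov_def P_def[symmetric] form_diff_def insert_endo_pair lie_form_def
    by (simp add: lessThan_Suc LX_def[symmetric] \<alpha>[OF L_in[OF X] Y u] \<alpha>[OF X L_in[OF Y] u]
        \<alpha>[OF P_in[OF X] Y u] \<alpha>[OF X P_in[OF Y] u] z_def)
  then show ?thesis
    unfolding key[OF X Y] key[OF Y X] using u by (simp add: w_def z_def cc_def)
qed

lemma dyn_cov_vanishes_iff:
  assumes \<theta>: "represents \<theta> p"
  shows "form_vanishes (induced_atlas A) TB.W 2
      (dyn_cov (induced_atlas A) TB.W S (d_endo (induced_atlas A) TB.W v \<theta>)) \<longleftrightarrow>
    (\<forall>z\<in>TB.Z. \<forall>a b. nabla_form p z a b = 0)"
  unfolding form_vanishes_2_iff
proof (intro iffI ballI allI)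
  fix z a b
  assume v: "\<forall>X\<in>vf. \<forall>Y\<in>vf. \<forall>u\<in>TB.W.
      dyn_cov (induced_atlas A) TB.W S (d_endo (induced_atlas A) TB.W v \<theta>) [X, Y] u = 0" and z: "z \<in> TB.Z"
  then obtain u where u: "u \<in> TB.W" "z = TB.\<phi> u" by blast
  \<comment> \<open>A vertical field paired with a coordinate field of the base isolates
    \<open>nabla_form p z a b\<close>: in the exchanged term the base part of the vertical field is
    zero.\<close>
  have ab: "TB.lift (\<lambda>_. (0, a)) \<in> vf" "TB.lift (\<lambda>_. (b, 0)) \<in> vf" by (rule TB.lift_in; simp)+
  from v ab u(1) have "dyn_cov (induced_atlas A) TB.W S (d_endo (induced_atlas A) TB.W v \<theta>)
      [TB.lift (\<lambda>_. (0, a)), TB.lift (\<lambda>_. (b, 0))] u = 0"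
    by blast
  then show "nabla_form p z a b = 0"
    unfolding dyn_cov_represents[OF \<theta> ab u(1)]
    using u linear_0[OF G.linear_conn[OF in_Z[OF z]]] by (simp add: nabla_form_def)
qed (simp add: dyn_cov_represents[OF \<theta>])

lemma helmholtz_iff:
  assumes \<theta>: "represents \<theta> p"
  shows "form_vanishes (induced_atlas A) TB.W 2 (d_endo (induced_atlas A) TB.W tangent_structure \<theta>) \<and>
      form_vanishes (induced_atlas A) TB.W 2 (d_endo (induced_atlas A) TB.W \<Phi> \<theta>) \<and>
      form_vanishes (induced_atlas A) TB.W 2
        (dyn_cov (induced_atlas A) TB.W S (d_endo (induced_atlas A) TB.W v \<theta>)) \<longleftrightarrow>
    G.helmholtz p"
proof -
  have 1: "form_vanishes (induced_atlas A) TB.W 2 (d_endo (induced_atlas A) TB.W tangent_structure \<theta>) \<longleftrightarrow>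
      (\<forall>z\<in>TB.Z. \<forall>a b. \<DD> p z (0, a) \<bullet> b = \<DD> p z (0, b) \<bullet> a)"
    by (rule d_endo_vanishes_iff[OF \<theta> J_in, where \<kappa>="\<lambda>z a. a"]) (simp_all add: tangent_structure_def)
  have 2: "form_vanishes (induced_atlas A) TB.W 2 (d_endo (induced_atlas A) TB.W \<Phi> \<theta>) \<longleftrightarrow>
      (\<forall>z\<in>TB.Z. \<forall>a b. \<DD> p z (0, G.jacobi z a) \<bullet> b = \<DD> p z (0, G.jacobi z b) \<bullet> a)"
  proof (rule d_endo_vanishes_iff[OF \<theta> \<Phi>_in])
    fix X u assume "X \<in> vf" and u: "u \<in> TB.W"
    from hat_\<Phi>[OF this(1) \<phi>_in[OF u]] u
    show "\<Phi> X u (induced_chart A c) = (0, G.jacobi (TB.\<phi> u) (fst (X u (induced_chart A c))))" by simp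
  qed
  show ?thesis
    unfolding 1 2 dyn_cov_vanishes_iff[OF \<theta>] G.helmholtz_def nabla_form_def Z_eq by blast
qed

lemma lagrange_diff_vanishes_iff:
  assumes L: "L \<in> smooth_funs (induced_atlas A) TB.W"
  defines "l \<equiv> L \<circ> chart_inv (induced_chart A c)"
  shows "form_vanishes (induced_atlas A) TB.W 1 (lagrange_diff (induced_atlas A) TB.W S L) \<longleftrightarrow>
    G.euler_lagrange l"
proof -
  have l: "smooth_on l TB.Z" using L by (simp add: l_def TB.smooth_funs_iff)
  have Ll: "L u = l (TB.\<phi> u)" if "u \<in> TB.W" for u using that TB.c_in by (simp add: l_def)
  let ?dJL = "d_endo (induced_atlas A) TB.W tangent_structure (\<lambda>_. L)"
  have apply_L: "vf_apply (induced_atlas A) X L u = \<DD> l (TB.\<phi> u) (X u (induced_chart A c))"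
    if "X \<in> vf" "u \<in> TB.W" for X u
    by (rule TB.vf_apply_smooth[OF that l Ll])
  have dJL: "?dJL [X] u = \<DD> l (TB.\<phi> u) (0, fst (X u (induced_chart A c)))"
    if X: "X \<in> vf" and u: "u \<in> TB.W" for X u
  proof -
    \<comment> \<open>Contraction kills functions, so the form to be differentiated is the
      contraction of dL with \<open>J\<close>, that is, the fibre derivative of \<open>l\<close>
      paired with dx.\<close>
    have "insert_endo J (\<lambda>_. L) [] = (\<lambda>_. 0)" by (simp add: insert_endo_def)
    then show ?thesis
      using TB.vf_apply_zero[OF X u] apply_L[OF J_in[OF X] u]
      by (simp add: d_endo_def form_diff_def insert_endo_singleton ext_d_singleton tangent_structure_def)
  qed
  have eq: "lagrange_diff (induced_atlas A) TB.W S L [X] u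
      = \<DD> (\<lambda>y. \<DD> l y (0, fst (X u (induced_chart A c)))) (TB.\<phi> u) (G.spray_vf (TB.\<phi> u))
        - \<DD> l (TB.\<phi> u) (fst (X u (induced_chart A c)), 0)"
    if X: "X \<in> vf" and u: "u \<in> TB.W" for X u
  proof -
    define z where "z = TB.\<phi> u"
    have z: "z \<in> TB.Z" using u by (simp add: z_def)
    define X' where "X' = TB.hat X z"
    have Xu: "X u (induced_chart A c) = X'" using u by (simp add: X'_def z_def)
    have hd: "((\<lambda>z. \<DD> l z (0, fst (TB.hat X z))) has_derivative
        (\<lambda>a. \<DD> (\<lambda>y. \<DD> l y (0, fst (TB.hat X z))) z a + \<DD> l z (0, fst (\<DD> (TB.hat X) z a)))) (at z)"
      by (intro has_derivative_dd_field[OF l _ z TB.open_Z] has_derivative_Pair has_derivative_const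
          has_derivative_fst smooth_on_has_derivative[OF TB.smooth_hat[OF X] z])
    have Su: "S u (induced_chart A c) = G.spray_vf z" using hat_S[OF z] u by (simp add: z_def)
    have 1: "vf_apply (induced_atlas A) S (?dJL [X]) u
        = \<DD> (\<lambda>y. \<DD> l y (0, fst X')) z (G.spray_vf z) + \<DD> l z (0, fst (\<DD> (TB.hat X) z (G.spray_vf z)))"
      unfolding Su[symmetric] X'_def
      by (rule TB.vf_apply_eq[OF S_in u hd[unfolded z_def], folded z_def]) (simp add: dJL[OF X])
    have L: "lie_bracket (induced_atlas A) TB.W S X u (induced_chart A c)
        = \<DD> (TB.hat X) z (G.spray_vf z) - (snd X', \<DD> s z X')"
      using hat_lie_S[OF X z] u by (simp add: z_def X'_def)
    have lin: "\<DD> l z (0, a - b) = \<DD> l z (0, a) - \<DD> l z (0, b)" for a b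
      using linear_diff[OF smooth_on_linear_dd[OF l z], of "(0, a)" "(0, b)"] by simp
    \<comment> \<open>The bracket contributes the fibre derivative of \<open>l\<close> along
      \<open>snd X'\<close>, which cancels the vertical half of dL; the expression thus depends only
      on the base part of \<open>X\<close>.\<close>
    have split: "\<DD> l z X' = \<DD> l z (fst X', 0) + \<DD> l z (0, snd X')"
      using smooth_on_dd_Pair[OF l z, of "fst X'" "snd X'"] by simp
    show ?thesis
      unfolding lagrange_diff_def form_diff_def lie_form_def Xu z_def[symmetric]
      using dJL[OF TB.lie_bracket_in[OF S_in X] u] apply_L[OF X u]
      by (simp add: lessThan_Suc 1 L lin split ext_d_singleton Xu z_def[symmetric])
  qed
  show ?thesis
    unfolding form_vanishes_1_iff G.euler_lagrange_def Z_eq[symmetric]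
  proof (intro iffI ballI allI)
    fix z a
    assume v: "\<forall>X\<in>vf. \<forall>u\<in>TB.W. lagrange_diff (induced_atlas A) TB.W S L [X] u = 0" and "z \<in> TB.Z"
    then obtain u where u: "u \<in> TB.W" "z = TB.\<phi> u" by blast
    have a: "TB.lift (\<lambda>_. (a, 0)) \<in> vf" by (rule TB.lift_in) simp
    have "lagrange_diff (induced_atlas A) TB.W S L [TB.lift (\<lambda>_. (a, 0))] u = 0" using v a u(1) by blast
    then show "\<DD> (\<lambda>y. \<DD> l y (0, a)) z (G.spray_vf z) = \<DD> l z (a, 0)"
      unfolding eq[OF a u(1)] using u by simp
  qed (simp add: eq)
qed

end

section \<open>Non-degeneracy conditions in coordinates, and the equivalence\<close>

lemma (in tangent_chart) coord_vfields:
  "coord_vfield (induced_atlas A) (tangent_over A (chart_dom c)) (induced_chart A c) e \<in> vf"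
  "u \<in> TB.W \<Longrightarrow>
    coord_vfield (induced_atlas A) (tangent_over A (chart_dom c)) (induced_chart A c) e u (induced_chart A c) = e"
  unfolding chart_dom_induced[symmetric] TB.coord_vfield_eq_lift by (auto intro: TB.lift_in)

lemma nontrivial_form_iff:
  fixes A :: "('a, real ^ 'n) chart set"
  assumes "tangent_chart A c" and \<theta>: "tangent_chart.represents A c \<theta> p"
  shows "nontrivial_form A c \<theta> \<longleftrightarrow>
    (\<exists>z\<in>chart_map c ` chart_dom c \<times> UNIV. \<exists>i j. \<DD> p z (0, axis j 1) \<bullet> axis i 1 \<noteq> 0)"
proof -
  interpret tangent_chart A c by fact
  have p: "smooth_on p TB.Z"
    and rep: "\<And>X u. X \<in> vf \<Longrightarrow> u \<in> TB.W \<Longrightarrow> \<theta> [X] u = p (TB.\<phi> u) \<bullet> fst (X u (induced_chart A c))"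
    using \<theta> by (auto simp: represents_def)
  have "vf_apply (induced_atlas A) (ddy A c j) (\<theta> [ddx A c i]) u = \<DD> p (TB.\<phi> u) (0, axis j 1) \<bullet> axis i 1"
    if u: "u \<in> TB.W" for i j u
  proof -
    have "vf_apply (induced_atlas A) (ddy A c j) (\<theta> [ddx A c i]) u
        = \<DD> (\<lambda>z. p z \<bullet> axis i 1) (TB.\<phi> u) (ddy A c j u (induced_chart A c))"
      by (rule TB.vf_apply_smooth) (auto simp: ddx_def ddy_def coord_vfields rep u
          intro!: smooth_on_inner TB.open_Z p)
    then show ?thesis
      using dd_inner_left[OF p, of "TB.\<phi> u"] u by (simp add: ddy_def coord_vfields)
  qed
  then show ?thesis
    unfolding nontrivial_form_def chart_dom_induced[symmetric] Z_eq[symmetric] by auto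
qed

lemma lagrangian_function_iff:
  fixes A :: "('a, real ^ 'n) chart set"
  assumes "tangent_chart A c"
  shows "lagrangian_function A c L \<longleftrightarrow>
    (let l = L \<circ> chart_inv (induced_chart A c) in smooth_on l (chart_map c ` chart_dom c \<times> UNIV) \<and>
      (\<exists>z\<in>chart_map c ` chart_dom c \<times> UNIV. \<exists>i j. \<DD> (\<lambda>y. \<DD> l y (0, axis j 1)) z (0, axis i 1) \<noteq> 0))"
proof -
  interpret tangent_chart A c by fact
  define l where "l = L \<circ> chart_inv (induced_chart A c)"
  have "vf_apply (induced_atlas A) (ddy A c i) (vf_apply (induced_atlas A) (ddy A c j) L) u
      = \<DD> (\<lambda>y. \<DD> l y (0, axis j 1)) (TB.\<phi> u) (0, axis i 1)"
    if l: "smooth_on l TB.Z" and u: "u \<in> TB.W" for i j u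
  proof -
    have "vf_apply (induced_atlas A) (ddy A c j) L q = \<DD> l (TB.\<phi> q) (0, axis j 1)" if q: "q \<in> TB.W" for q
      using TB.vf_apply_smooth[OF _ q l, of "ddy A c j" L] TB.c_in q
      by (simp add: ddy_def coord_vfields l_def)
    then show ?thesis
      using TB.vf_apply_smooth[OF _ u smooth_on_dd[OF l], of "ddy A c i" "vf_apply (induced_atlas A) (ddy A c j) L"] u
      by (simp add: ddy_def coord_vfields)
  qed
  then show ?thesis
    unfolding lagrangian_function_def chart_dom_induced[symmetric] Z_eq[symmetric] TB.smooth_funs_iff
      l_def[symmetric] Let_def by (simp cong: bex_cong conj_cong)
qed

theorem corollary3p3:
  fixes M :: "'a topology"
    and A :: "('a, real ^ 'n) chart set"
    and S :: "(('a, real ^ 'n) tangent, (real ^ 'n) \<times> (real ^ 'n)) vfield"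
    and c :: "('a, real ^ 'n) chart"
  defines "TA \<equiv> induced_atlas A"
    and "TU \<equiv> tangent_over A (chart_dom c)"
  defines "S\<^sub>U \<equiv> restrict_vfield TU S"
  assumes "smooth_manifold M A"
    and "semispray A S"
    and "c \<in> A"
    and "diffeomorphic_sets (chart_map c ` chart_dom c) (UNIV :: (real ^ 'n) set)"
  shows "lagrangian_semispray_over A c S \<longleftrightarrow>
    (\<exists>\<theta>. \<theta> \<in> forms TA TU 1 \<and> semi_basic A TU 1 \<theta> \<and> nontrivial_form A c \<theta> \<and>
       form_vanishes TA TU 2 (d_endo TA TU tangent_structure \<theta>) \<and>
       form_vanishes TA TU 2 (d_endo TA TU (jacobi_endo TA TU S\<^sub>U) \<theta>) \<and>
       form_vanishes TA TU 2 (dyn_cov TA TU S\<^sub>U (d_endo TA TU (v_proj TA TU S\<^sub>U) \<theta>)))"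
proof -
  have T: "tangent_chart A c"
    using smooth_atlas_of_manifold[OF assms(4)] assms(6)
    by (simp add: tangent_chart_def tangent_chart_axioms_def)
  have TU: "TU = chart_dom (induced_chart A c)" by (simp add: TU_def chart_dom_induced)
  interpret spray_chart A c S\<^sub>U
    by (intro spray_chart.intro T spray_chart_axioms.intro)
      (use tangent_chart.restrict_spray[OF T assms(5)] in \<open>simp_all add: S\<^sub>U_def TU\<close>)
  obtain H x0 where H: "smooth_contraction H (chart_map c ` chart_dom c) x0"
    using diffeomorphic_smooth_contraction[OF open_V assms(7)] by blast
  have lag: "lagrangian_semispray_over A c S \<longleftrightarrow> (\<exists>L. lagrangian_function A c L \<and>
      form_vanishes TA TU 1 (lagrange_diff TA TU S\<^sub>U L))"
    by (simp add: lagrangian_semispray_over_def TA_def TU_def S\<^sub>U_def)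
  show ?thesis
    unfolding lag unfolding TA_def TU
  proof
    assume "\<exists>L. lagrangian_function A c L \<and>
      form_vanishes (induced_atlas A) TB.W 1 (lagrange_diff (induced_atlas A) TB.W S\<^sub>U L)"
    then obtain L where L: "lagrangian_function A c L"
      and EL: "form_vanishes (induced_atlas A) TB.W 1 (lagrange_diff (induced_atlas A) TB.W S\<^sub>U L)" by blast
    define l where "l = L \<circ> chart_inv (induced_chart A c)"
    obtain z0 i j where l: "smooth_on l TB.Z" and z0: "z0 \<in> TB.Z"
      and ij: "\<DD> (\<lambda>y. \<DD> l y (0, axis j 1)) z0 (0, axis i 1) \<noteq> 0"
      using L unfolding lagrangian_function_iff[OF T] Let_def l_def[symmetric] Z_eq by blast
    have "L \<in> smooth_funs (induced_atlas A) TB.W" using l by (simp add: TB.smooth_funs_iff l_def)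
    then have el: "G.euler_lagrange l" using EL lagrange_diff_vanishes_iff by (simp add: l_def)
    \<comment> \<open>The fibre derivative of \<open>l\<close>, turned into a vector by the inner
      product.\<close>
    define p where "p = (\<lambda>z. \<Sum>b\<in>Basis. \<DD> l z (0, b) *\<^sub>R (b :: real ^ 'n))"
    have p: "smooth_on p TB.Z"
      unfolding p_def by (intro smooth_on_sum smooth_on_scaleR smooth_on_const smooth_on_dd l TB.open_Z)
    have pl: "p z \<bullet> a = \<DD> l z (0, a)" if z: "z \<in> TB.Z" for z a
    proof -
      have "linear (\<lambda>a. \<DD> l z (0, a))"
        using smooth_on_dd_add[OF l z, of "(0, _)" "(0, _)"] smooth_on_dd_scaleR[OF l z, of _ "(0, _)"]
        by (intro linearI) simp_all
      from linear_sum_Basis[OF this, of a] show ?thesis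
        by (simp add: p_def inner_sum_right inner_commute[of _ a] mult.commute)
    qed
    interpret P: spray_form "chart_map c ` chart_dom c" s p
      by standard (use p Z_eq in simp)
    have helm: "G.helmholtz p"
      by (rule P.helmholtz_if_euler_lagrange[OF _ _ el]) (use l pl Z_eq in auto)
    obtain \<theta> where \<theta>: "\<theta> \<in> forms (induced_atlas A) TB.W 1" "semi_basic A TB.W 1 \<theta>" "represents \<theta> p"
      using represents_exists[OF p] by blast
    have "\<DD> p z0 (0, axis i 1) \<bullet> axis j 1 = \<DD> (\<lambda>y. \<DD> l y (0, axis j 1)) z0 (0, axis i 1)"
      unfolding dd_inner_left[OF p z0, symmetric]
      by (rule fun_cong[OF dd_cong_open(1)[OF TB.open_Z z0]]) (rule pl)
    then have "nontrivial_form A c \<theta>"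
      using ij z0 unfolding nontrivial_form_iff[OF T \<theta>(3)] Z_eq by metis
    then show "\<exists>\<theta>. \<theta> \<in> forms (induced_atlas A) TB.W 1 \<and> semi_basic A TB.W 1 \<theta> \<and> nontrivial_form A c \<theta> \<and>
       form_vanishes (induced_atlas A) TB.W 2 (d_endo (induced_atlas A) TB.W tangent_structure \<theta>) \<and>
       form_vanishes (induced_atlas A) TB.W 2 (d_endo (induced_atlas A) TB.W \<Phi> \<theta>) \<and>
       form_vanishes (induced_atlas A) TB.W 2
         (dyn_cov (induced_atlas A) TB.W S\<^sub>U (d_endo (induced_atlas A) TB.W v \<theta>))"
      using \<theta> helm helmholtz_iff[OF \<theta>(3)] by blast
  next
    assume "\<exists>\<theta>. \<theta> \<in> forms (induced_atlas A) TB.W 1 \<and> semi_basic A TB.W 1 \<theta> \<and> nontrivial_form A c \<theta> \<and>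
       form_vanishes (induced_atlas A) TB.W 2 (d_endo (induced_atlas A) TB.W tangent_structure \<theta>) \<and>
       form_vanishes (induced_atlas A) TB.W 2 (d_endo (induced_atlas A) TB.W \<Phi> \<theta>) \<and>
       form_vanishes (induced_atlas A) TB.W 2
         (dyn_cov (induced_atlas A) TB.W S\<^sub>U (d_endo (induced_atlas A) TB.W v \<theta>))"
    then obtain \<theta> p where \<theta>: "represents \<theta> p" "nontrivial_form A c \<theta>" and helm: "G.helmholtz p"
      using semi_basic_represents helmholtz_iff by metis
    interpret P: helmholtz_form "chart_map c ` chart_dom c" s p
      by standard (use \<theta>(1) helm Z_eq in \<open>auto simp: represents_def\<close>)
    obtain l where l: "smooth_on l TB.Z" "G.euler_lagrange l"
      and hess: "\<And>z a b. z \<in> TB.Z \<Longrightarrow> \<DD> (\<lambda>y. \<DD> l y (0, a)) z (0, b) = \<DD> p z (0, b) \<bullet> a"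
      using P.lagrangian_exists[OF H] unfolding Z_eq by blast
    define L where "L = l \<circ> TB.\<phi>"
    \<comment> \<open>\<open>l'\<close> need not equal \<open>l\<close> off the chart image, where
      \<open>chart_inv\<close> is arbitrary, so the derivatives are compared on the open set
      \<open>TB.Z\<close>.\<close>
    define l' where "l' = L \<circ> chart_inv (induced_chart A c)"
    have l': "l' z = l z" if "z \<in> TB.Z" for z
      using that by (simp add: l'_def L_def TB.\<phi>_inv)
    have dl': "\<DD> l' z = \<DD> l z" if "z \<in> TB.Z" for z
      by (rule dd_cong_open(1)[OF TB.open_Z that l'])
    have ddl': "\<DD> (\<lambda>y. \<DD> l' y a) z = \<DD> (\<lambda>y. \<DD> l y a) z" if "z \<in> TB.Z" for z a
      by (rule dd_cong_open(1)[OF TB.open_Z that]) (simp add: dl')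
    have sm: "smooth_on l' TB.Z" by (rule smooth_on_cong[OF TB.open_Z l(1)]) (simp add: l')
    have "G.euler_lagrange l'"
      using l(2) unfolding G.euler_lagrange_def Z_eq[symmetric] by (simp add: dl' ddl')
    moreover have "L \<in> smooth_funs (induced_atlas A) TB.W" using sm by (simp add: TB.smooth_funs_iff l'_def)
    ultimately have "form_vanishes (induced_atlas A) TB.W 1 (lagrange_diff (induced_atlas A) TB.W S\<^sub>U L)"
      using lagrange_diff_vanishes_iff by (simp add: l'_def)
    moreover have "lagrangian_function A c L"
      using \<theta>(2) sm hess ddl'
      unfolding lagrangian_function_iff[OF T] Let_def l'_def[symmetric] nontrivial_form_iff[OF T \<theta>(1)] Z_eq[symmetric]
      by auto
    ultimately show "\<exists>L. lagrangian_function A c L \<and>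
      form_vanishes (induced_atlas A) TB.W 1 (lagrange_diff (induced_atlas A) TB.W S\<^sub>U L)" by blast
  qed
qed

end
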